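(* Let $V$ be a simple cuspidal module over the $N=2$ Ramond algebra $\mathfrak g$. Then ${\rm b}(V)\le 2$.
   Context: All vector spaces are over $\mathbb C$. The $N=2$ Ramond algebra $\mathfrak g$ is the Lie superalgebra with basis $\{L_m,H_m,G_m^\pm,C\mid m\in\mathbb Z\}$ ($L_m,H_m,C$ even, $G_m^\pm$ odd) and relations, for $m,n,p,q\in\mathbb Z$: $[L_m,L_n]=(n-m)L_{m+n}+\frac1{12}(m^3-m)\delta_{m+n,0}C$, $[L_m,H_n]=nH_{m+n}$, $[H_m,H_n]=\frac13 m\delta_{m+n,0}C$, $[L_m,G_p^\pm]=(p-\frac m2)G_{p+m}^\pm$, $[H_m,G_p^\pm]=\pm G_{m+p}^\pm$, $[G_p^+,G_q^-]=-2L_{p+q}+(p-q)H_{p+q}+\frac13(p^2-\frac14)\delta_{p+q,0}C$, $[G_p^\pm,G_q^\pm]=0$, $[C,\mathfrak g]=0$. Modules are $\mathbb Z_2$-graded, $V=V_{\bar0}\oplus V_{\bar1}$, compatibly with the grading of $\mathfrak g$. For $\lambda\in\mathbb C$ the weight space is $V_\lambda=\{v\in V\mid L_0v=\lambda v\}$; $V$ is a weight module if it is the sum of its weight spaces. A weight module $V=\sum_{i\in\mathbb Z}V_{\lambda+i}$ (for some $\lambda\in\mathbb C$) is quasi-finite if all $V_{\lambda+i}$ are finite-dimensional, and cuspidal if moreover there is a positive integer $p$ with $\dim(V_{\lambda+i})_\tau\le p$ for all $i\in\mathbb Z$, $\tau\in\mathbb Z_2$; the minimal such $p$ is denoted ${\rm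 b}(V)$. *)

theory Defs
  imports Complex_Main "HOL-Library.Poly_Mapping" "HOL-Library.Z2"
begin

section \<open>The Ramond algebra\<close>

datatype ramond_basis = L int | H int | Gp int | Gm int | C

text \<open>The underlying vector space: finite formal linear combinations of basis elements.\<close>

type_synonym ramond = "ramond_basis \<Rightarrow>\<^sub>0 complex"

definition ramond_scale :: "complex \<Rightarrow> ramond \<Rightarrow> ramond" where
  "ramond_scale c x = Poly_Mapping.map (\<lambda>a. c * a) x"

lemma lookup_ramond_scale:
  "Poly_Mapping.lookup (ramond_scale c x) b = c * Poly_Mapping.lookup x b"
  by (simp add: ramond_scale_def Poly_Mapping.map.rep_eq when_def)

lemma vector_space_ramond_scale: "vector_space ramond_scale"
  by unfold_locales
    (auto intro!: poly_mapping_eqI simp: lookup_ramond_scale lookup_add algebra_simps)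

abbreviation basis_vec :: "ramond_basis \<Rightarrow> ramond" where
  "basis_vec b \<equiv> Poly_Mapping.single b 1"

text \<open>
  The brackets that are not listed among the defining relations are the ones forced by
  super skew-symmetry; in particular the bracket of two odd elements is symmetric.
\<close>

fun basis_bracket :: "ramond_basis \<Rightarrow> ramond_basis \<Rightarrow> ramond" where
  "basis_bracket (L m) (L n) =
     Poly_Mapping.single (L (m + n)) (of_int (n - m)) +
     Poly_Mapping.single C (if m + n = 0 then of_int (m ^ 3 - m) / 12 else 0)"
| "basis_bracket (L m) (H n) = Poly_Mapping.single (H (m + n)) (of_int n)"
| "basis_bracket (H n) (L m) = Poly_Mapping.single (H (m + n)) (- of_int n)"
| "basis_bracket (H m) (H n) =
     Poly_Mapping.single C (if m + n = 0 then of_int m / 3 else 0)"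
| "basis_bracket (L m) (Gp p) = Poly_Mapping.single (Gp (p + m)) (of_int p - of_int m / 2)"
| "basis_bracket (L m) (Gm p) = Poly_Mapping.single (Gm (p + m)) (of_int p - of_int m / 2)"
| "basis_bracket (Gp p) (L m) = Poly_Mapping.single (Gp (p + m)) (- (of_int p - of_int m / 2))"
| "basis_bracket (Gm p) (L m) = Poly_Mapping.single (Gm (p + m)) (- (of_int p - of_int m / 2))"
| "basis_bracket (H m) (Gp p) = Poly_Mapping.single (Gp (m + p)) 1"
| "basis_bracket (H m) (Gm p) = Poly_Mapping.single (Gm (m + p)) (- 1)"
| "basis_bracket (Gp p) (H m) = Poly_Mapping.single (Gp (m + p)) (- 1)"
| "basis_bracket (Gm p) (H m) = Poly_Mapping.single (Gm (m + p)) 1"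
| "basis_bracket (Gp p) (Gm q) =
     Poly_Mapping.single (L (p + q)) (- 2) +
     Poly_Mapping.single (H (p + q)) (of_int (p - q)) +
     Poly_Mapping.single C (if p + q = 0 then (of_int (p ^ 2) - 1 / 4) / 3 else 0)"
| "basis_bracket (Gm q) (Gp p) =
     Poly_Mapping.single (L (p + q)) (- 2) +
     Poly_Mapping.single (H (p + q)) (of_int (p - q)) +
     Poly_Mapping.single C (if p + q = 0 then (of_int (p ^ 2) - 1 / 4) / 3 else 0)"
| "basis_bracket (Gp p) (Gp q) = 0"
| "basis_bracket (Gm p) (Gm q) = 0"
| "basis_bracket C _ = 0"
| "basis_bracket _ C = 0"

definition ramond_bracket :: "ramond \<Rightarrow> ramond \<Rightarrow> ramond" where
  "ramond_bracket x y =
     (\<Sum>a\<in>Poly_Mapping.keys x. \<Sum>b\<in>Poly_Mapping.keys y.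
        ramond_scale (Poly_Mapping.lookup x a * Poly_Mapping.lookup y b) (basis_bracket a b))"

fun basis_parity :: "ramond_basis \<Rightarrow> bit" where
  "basis_parity (Gp _) = 1"
| "basis_parity (Gm _) = 1"
| "basis_parity _ = 0"

definition ramond_grade :: "bit \<Rightarrow> ramond set" where
  "ramond_grade \<sigma> = {x. \<forall>b\<in>Poly_Mapping.keys x. basis_parity b = \<sigma>}"

text \<open>The sign \<open>(-1)\<^bsup>\<sigma>\<tau>\<^esup>\<close>.\<close>

definition super_sign :: "bit \<Rightarrow> bit \<Rightarrow> complex" where
  "super_sign \<sigma> \<tau> = (if \<sigma> = 1 \<and> \<tau> = 1 then - 1 else 1)"

section \<open>Graded modules over the Ramond algebra\<close>

text \<open>The underlying space of the module is the whole type \<^typ>\<open>'v\<close>.\<close>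

locale ramond_module = vector_space scale
  for scale :: "complex \<Rightarrow> 'v::ab_group_add \<Rightarrow> 'v" +
  fixes act :: "ramond \<Rightarrow> 'v \<Rightarrow> 'v"
    and grade :: "bit \<Rightarrow> 'v set"
  assumes subspace_grade: "subspace (grade \<tau>)"
    and grade_sum: "\<exists>v0\<in>grade 0. \<exists>v1\<in>grade 1. v = v0 + v1"
    and grade_Int: "grade 0 \<inter> grade 1 = {0}"
    and linear_act_left: "Vector_Spaces.linear ramond_scale scale (\<lambda>x. act x v)"
    and linear_act_right: "Vector_Spaces.linear scale scale (act x)"
    and act_grade: "x \<in> ramond_grade \<sigma> \<Longrightarrow> v \<in> grade \<tau> \<Longrightarrow> act x v \<in> grade (\<sigma> + \<tau>)"
    and act_bracket: "x \<in> ramond_grade \<sigma> \<Longrightarrow> y \<in> ramond_grade \<tau> \<Longrightarrow>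
      act (ramond_bracket x y) v =
        act x (act y v) - scale (super_sign \<sigma> \<tau>) (act y (act x v))"
begin

definition graded_submodule :: "'v set \<Rightarrow> bool" where
  "graded_submodule W \<longleftrightarrow> subspace W \<and> (\<forall>x. \<forall>w\<in>W. act x w \<in> W) \<and>
     (\<forall>w\<in>W. \<exists>w0\<in>W \<inter> grade 0. \<exists>w1\<in>W \<inter> grade 1. w = w0 + w1)"

definition simple_module :: bool where
  "simple_module \<longleftrightarrow> (UNIV :: 'v set) \<noteq> {0} \<and>
     (\<forall>W. graded_submodule W \<longrightarrow> W = {0} \<or> W = UNIV)"

definition weight_space :: "complex \<Rightarrow> 'v set" where
  "weight_space \<mu> = {v. act (basis_vec (L 0)) v = scale \<mu> v}"

text \<open>Needed besides bounds on \<^term>\<open>dim\<close>, which is \<open>0\<close> on infinite-dimensional subspaces.\<close>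

definition fin_dim :: "'v set \<Rightarrow> bool" where
  "fin_dim S \<longleftrightarrow> (\<exists>B. finite B \<and> span B = S)"

definition quasi_finite_at :: "complex \<Rightarrow> bool" where
  "quasi_finite_at \<mu> \<longleftrightarrow> span (\<Union>i::int. weight_space (\<mu> + of_int i)) = UNIV \<and>
     (\<forall>i::int. fin_dim (weight_space (\<mu> + of_int i)))"

definition cuspidal_bound :: "nat \<Rightarrow> bool" where
  "cuspidal_bound p \<longleftrightarrow> 0 < p \<and>
     (\<exists>\<mu>. quasi_finite_at \<mu> \<and>
        (\<forall>(i::int) \<tau>. dim (weight_space (\<mu> + of_int i) \<inter> grade \<tau>) \<le> p))"

definition cuspidal :: bool where
  "cuspidal \<longleftrightarrow> (\<exists>p. cuspidal_bound p)"

text \<open>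
  The number \<open>b(V)\<close>. It does not depend on the choice of \<open>\<mu>\<close>, since the set of weights of a
  nonzero module determines the coset \<open>\<mu> + \<int>\<close>. Only meaningful for cuspidal modules.
\<close>

definition cuspidal_b :: nat where
  "cuspidal_b = (LEAST p. cuspidal_bound p)"

end

end

theory Submission
  imports Defs "HOL-Computational_Algebra.Computational_Algebra"
begin

text \<open>
  The central element acts by a scalar, which vanishes because a Heisenberg algebra with nonzero central
  charge has no module with bounded weight multiplicities. On vectors of \<open>H\<^sub>0\<close>-charge \<open>a \<noteq> 0\<close> all \<open>H\<^sub>m\<close> are
  injective, so every nonzero charge is visible in each weight and there are finitely many charges.
  Unless \<open>V\<close> is trivial, its highest or its lowest charge \<open>a\<close> is nonzero; exchanging \<open>G\<^sup>+\<close> and \<open>G\<^sup>-\<close> we may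
  assume that it is the highest. The component \<open>W\<close> of charge \<open>a\<close> is then simple over the \<open>L\<^sub>m\<close> and \<open>H\<^sub>m\<close>, and
  \<open>V\<close> is generated from \<open>W\<close> by the \<open>G\<^sup>-\<close>. Simplicity forces \<open>H\<^sub>m H\<^sub>n = a H\<^sub>m\<^sub>+\<^sub>n\<close> on \<open>W\<close>, so \<open>t\<^sup>m = H\<^sub>m / a\<close> makes
  \<open>W\<close> a module over Laurent polynomials, and finite dimensionality of the weight spaces of charge \<open>a - 1\<close>
  forces \<open>m \<mapsto> t\<^sup>-\<^sup>m L\<^sub>m\<close> to be affine; hence \<open>W\<close> has one-dimensional weight spaces with basis \<open>w\<^sub>n\<close>.
  As a vector of charge \<open>a - 1\<close> killed by all \<open>G\<^sup>+\<close> is zero, \<open>G\<^sup>-\<^sub>q w\<^sub>n\<^sub>-\<^sub>q\<close> is affine in \<open>q\<close>, so that the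
  components of charge \<open>a - 1\<close>, \<open>a - 2\<close>, \<open>a - 3\<close> have dimension at most \<open>2\<close>, \<open>1\<close>, \<open>0\<close> in each weight.
\<close>

section \<open>Linear algebra\<close>

text \<open>Bounded multiplicities mostly enter in one way: more vectors of one weight than the
  bound allows are written down, a linear relation between them is taken, and operators that tell
  these vectors apart turn it into a contradiction or an identity. The vanishing of the central
  charge, the injectivity of \<open>H\<^sub>m\<close> and the recurrence for
  \<open>t\<^sup>-\<^sup>m L\<^sub>m\<close> arise like this. Since only single weight spaces are
  finite-dimensional, arguments with eigenvectors need operators of weight zero, which is why
  \<open>H\<^sub>m\<close> and \<open>L\<^sub>m\<close> are composed with operators that shift the
  weight back. Injectivity alone does not make \<open>H\<^sub>m\<close> multiplicative on
  \<open>W\<close>: the rule is obtained on one vector from Lie's lemma before simplicity spreads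
  it. The bound is 2 for both parities because the charges \<open>a\<close> and \<open>a - 2\<close>
  share a parity and contribute 1 + 1, while charge \<open>a - 1\<close> has the other parity and
  contributes 2.\<close>

locale complex_vector_space = vector_space scale
  for scale :: "complex \<Rightarrow> 'v::ab_group_add \<Rightarrow> 'v" (infixr "*s" 75)
begin

text \<open>Phrased with independent subsets so that it passes to arbitrary subsets and excludes
  infinite dimension, where \<open>dim\<close> is 0.\<close>

definition bounded_dim :: "nat \<Rightarrow> 'v set \<Rightarrow> bool" where
  "bounded_dim n X \<longleftrightarrow> (\<forall>B\<subseteq>X. independent B \<longrightarrow> finite B \<and> card B \<le> n)"

text \<open>Linearity is required on \<open>X\<close> only: operators built from the choice function
  \<open>down\<close> below are known to be linear on single weight spaces only.\<close>

definition endo_on :: "'v set \<Rightarrow> ('v \<Rightarrow> 'v) \<Rightarrow> bool" where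
  "endo_on X T \<longleftrightarrow> (\<forall>x\<in>X. T x \<in> X) \<and> (\<forall>x\<in>X. \<forall>y\<in>X. T (x + y) = T x + T y) \<and>
     (\<forall>c. \<forall>x\<in>X. T (c *s x) = c *s T x)"

lemma endo_onD:
  assumes "endo_on X T"
  shows "x \<in> X \<Longrightarrow> T x \<in> X" "x \<in> X \<Longrightarrow> y \<in> X \<Longrightarrow> T (x + y) = T x + T y"
    "x \<in> X \<Longrightarrow> T (c *s x) = c *s T x"
  using assms unfolding endo_on_def by auto

lemma endo_on_zero: "endo_on X T \<Longrightarrow> subspace X \<Longrightarrow> T 0 = 0"
  using endo_onD(3)[of X T 0 0] subspace_0 by simp

lemma endo_on_diff:
  assumes "endo_on X T" "subspace X" "x \<in> X" "y \<in> X"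
  shows "T (x - y) = T x - T y"
proof -
  have "T (x + (-1) *s y) = T x + (-1) *s T y"
    using assms endo_onD(2)[OF assms(1)] endo_onD(3)[OF assms(1)] subspace_scale by metis
  then show ?thesis by simp
qed

lemma endo_on_sum:
  assumes "endo_on X T" "subspace X" "finite F" "\<And>i. i \<in> F \<Longrightarrow> f i \<in> X"
  shows "T (\<Sum>i\<in>F. c i *s f i) = (\<Sum>i\<in>F. c i *s T (f i))"
  using assms(3,4)
proof (induction F rule: finite_induct)
  case empty
  then show ?case using endo_on_zero assms by simp
next
  case (insert i F)
  have "(\<Sum>i\<in>F. c i *s f i) \<in> X"
    using insert by (intro subspace_sum[OF assms(2)] subspace_scale[OF assms(2)]) auto
  then show ?case
    using insert endo_onD(2,3)[OF assms(1)] subspace_scale[OF assms(2)] by simp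
qed

lemma endo_on_subset:
  "endo_on X T \<Longrightarrow> Y \<subseteq> X \<Longrightarrow> (\<And>y. y \<in> Y \<Longrightarrow> T y \<in> Y) \<Longrightarrow> endo_on Y T"
  unfolding endo_on_def by blast

lemma funpow_closed: "endo_on X T \<Longrightarrow> v \<in> X \<Longrightarrow> (T ^^ k) v \<in> X"
  by (induction k) (auto dest: endo_onD(1))

lemma bounded_dimD: "bounded_dim n X \<Longrightarrow> B \<subseteq> X \<Longrightarrow> independent B \<Longrightarrow> finite B \<and> card B \<le> n"
  by (simp add: bounded_dim_def)

lemma bounded_dim_mono: "bounded_dim n X \<Longrightarrow> Y \<subseteq> X \<Longrightarrow> bounded_dim n Y"
  unfolding bounded_dim_def by blast

lemma bounded_dim_proper:
  assumes "bounded_dim n X" "Y \<subseteq> X" "subspace Y" "x \<in> X" "x \<notin> Y"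
  shows "n > 0 \<and> bounded_dim (n - 1) Y"
proof -
  have main: "finite B \<and> card B + 1 \<le> n" if B: "B \<subseteq> Y" "independent B" for B
  proof -
    have "x \<notin> span B" using span_minimal[OF B(1) assms(3)] assms(5) by blast
    then have "independent (insert x B)" "x \<notin> B"
      using B independent_insert[of x B] span_base by auto
    moreover have "insert x B \<subseteq> X" using B assms by auto
    ultimately have "finite (insert x B) \<and> card (insert x B) \<le> n"
      by (intro bounded_dimD[OF assms(1)])
    then show ?thesis using \<open>x \<notin> B\<close> by auto
  qed
  have "n > 0" using main[of "{}"] independent_empty by simp
  moreover have "bounded_dim (n - 1) Y"
    unfolding bounded_dim_def
  proof (intro allI impI)
    fix B assume "B \<subseteq> Y" "independent B"
    then show "finite B \<and> card B \<le> n - 1" using main[of B] by (metis add_le_imp_le_diff)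
  qed
  ultimately show ?thesis by simp
qed

lemma bounded_dim_basis:
  assumes "bounded_dim n X"
  obtains B where "finite B" "B \<subseteq> X" "X \<subseteq> span B"
  using maximal_independent_subset[of X] bounded_dimD[OF assms] by metis

lemma bounded_dim_relation:
  assumes "bounded_dim n X" "finite F" "n < card F" "\<And>i. i \<in> F \<Longrightarrow> f i \<in> X"
  shows "\<exists>c. (\<exists>i\<in>F. c i \<noteq> 0) \<and> (\<Sum>i\<in>F. c i *s f i) = 0"
proof (cases "inj_on f F")
  case True
  then have "card (f ` F) = card F" by (simp add: card_image)
  moreover have "f ` F \<subseteq> X" using assms by auto
  ultimately have "dependent (f ` F)"
    using bounded_dimD[OF assms(1), of "f ` F"] assms(3) by auto
  then obtain u where u: "\<exists>v\<in>f ` F. u v \<noteq> 0" "(\<Sum>v\<in>f ` F. u v *s v) = 0"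
    using dependent_finite[of "f ` F"] assms(2) by auto
  then have "(\<Sum>i\<in>F. u (f i) *s f i) = 0"
    using sum.reindex[OF True, of "\<lambda>v. u v *s v"] by (simp add: o_def)
  then show ?thesis using u(1) by (intro exI[of _ "\<lambda>i. u (f i)"]) auto
next
  case False
  then obtain i j where ij: "i \<in> F" "j \<in> F" "i \<noteq> j" "f i = f j"
    unfolding inj_on_def by blast
  let ?c = "\<lambda>k. if k = i then 1 else if k = j then (-1::complex) else 0"
  have "(\<Sum>k\<in>F. ?c k *s f k) = (\<Sum>k\<in>{i,j}. ?c k *s f k)"
    by (rule sum.mono_neutral_right) (use ij assms in auto)
  then have "(\<Sum>k\<in>F. ?c k *s f k) = 0" using ij by simp
  then show ?thesis using ij by (intro exI[of _ ?c]) auto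
qed

lemma independent_eigenvectors_sum:
  assumes "endo_on X T" "subspace X" "finite F" "inj_on \<alpha> F" "\<And>i. i \<in> F \<Longrightarrow> f i \<in> X"
    "\<And>i. i \<in> F \<Longrightarrow> T (f i) = \<alpha> i *s f i" "(\<Sum>i\<in>F. f i) = 0" "i \<in> F"
  shows "f i = 0"
  using assms(3-8)
proof (induction F arbitrary: f i rule: finite_induct)
  case empty
  then show ?case by simp
next
  case (insert j F)
  have "T (\<Sum>i\<in>insert j F. 1 *s f i) = (\<Sum>i\<in>insert j F. 1 *s T (f i))"
    by (rule endo_on_sum[OF assms(1,2)]) (use insert in auto)
  moreover have "(\<Sum>i\<in>insert j F. T (f i)) = (\<Sum>i\<in>insert j F. \<alpha> i *s f i)"
    by (rule sum.cong) (use insert.prems(3) in auto)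
  ultimately have "(\<Sum>i\<in>insert j F. \<alpha> i *s f i) = 0"
    using insert.prems(4) endo_on_zero[OF assms(1,2)] by simp
  then have "(\<Sum>i\<in>insert j F. \<alpha> i *s f i - \<alpha> j *s f i) = 0"
    unfolding sum_subtractf using insert.prems(4) by (simp only: scale_sum_right[symmetric]) simp
  then have "(\<Sum>i\<in>F. (\<alpha> i - \<alpha> j) *s f i) = 0"
    using insert.hyps by (simp add: scale_left_diff_distrib)
  moreover have "T ((\<alpha> i - \<alpha> j) *s f i) = \<alpha> i *s ((\<alpha> i - \<alpha> j) *s f i)" if "i \<in> F" for i
    using endo_onD(3)[OF assms(1)] insert.prems(2,3) that by (simp add: mult.commute)
  ultimately have "(\<alpha> i - \<alpha> j) *s f i = 0" if "i \<in> F" for i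
    using insert.IH[of "\<lambda>i. (\<alpha> i - \<alpha> j) *s f i" i] insert.prems(1,2) that subspace_scale[OF assms(2)]
    by simp
  then have z: "f i = 0" if "i \<in> F" for i
    using insert.prems(1) insert.hyps that by (auto simp: inj_on_def)
  then have "f j = 0" using insert.prems(4) insert.hyps by simp
  then show ?case using z insert.prems(5) by auto
qed

lemma span_Union_decompose:
  assumes "x \<in> span (\<Union>i\<in>I. S i)" "\<And>i. i \<in> I \<Longrightarrow> subspace (S i)"
  obtains F s where "finite F" "F \<subseteq> I" "\<And>i. i \<in> F \<Longrightarrow> s i \<in> S i" "x = (\<Sum>i\<in>F. s i)"
proof -
  \<comment> \<open>Letting \<open>s\<close> vanish outside \<open>F\<close> makes the induction
    step uniform: the new vector is added to \<open>s j\<close> whether or not \<open>j\<close>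
    already lies in \<open>F\<close>.\<close>
  let ?P = "\<lambda>x. \<exists>F s. finite F \<and> F \<subseteq> I \<and> (\<forall>i. s i \<in> (if i \<in> F then S i else {0})) \<and> x = (\<Sum>i\<in>F. s i)"
  have "?P x"
  proof (rule span_induct_alt[OF assms(1)])
    show "?P 0" by (rule exI[of _ "{}"]) auto
  next
    fix c x y assume x: "x \<in> (\<Union>i\<in>I. S i)" and "?P y"
    then obtain F s j where F: "finite F" "F \<subseteq> I" "\<forall>i. s i \<in> (if i \<in> F then S i else {0})" "y = (\<Sum>i\<in>F. s i)"
      and j: "j \<in> I" "x \<in> S j" by auto
    let ?G = "insert j F" let ?s = "\<lambda>i. s i + (if i = j then c *s x else 0)"
    have sub: "subspace (S i)" if "i \<in> ?G" for i using that F j assms by auto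
    have "(\<Sum>i\<in>?G. s i) = y"
      unfolding F(4) by (rule sum.mono_neutral_right) (use F in \<open>auto split: if_splits\<close>)
    then have "c *s x + y = (\<Sum>i\<in>?G. ?s i)"
      using F(1) by (simp add: sum.distrib add.commute)
    moreover have "?s i \<in> (if i \<in> ?G then S i else {0})" for i
    proof (cases "i = j")
      case True
      have "s j \<in> S j" using F(3)[rule_format, of j] subspace_0[OF sub[of j]] by (auto split: if_splits)
      then show ?thesis using True j subspace_add[OF sub[of j]] subspace_scale[OF sub[of j]] by simp
    next
      case False
      then show ?thesis using F(3)[rule_format, of i] by simp
    qed
    ultimately show "?P (c *s x + y)"
      using F j by (intro exI[of _ ?G] exI[of _ ?s]) auto
  qed
  then obtain F s where "finite F" "F \<subseteq> I" "\<forall>i. s i \<in> (if i \<in> F then S i else {0})" "x = (\<Sum>i\<in>F. s i)"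
    by auto
  then show ?thesis by (intro that[of F s]) (auto split: if_splits)
qed

text \<open>Applying \<open>T - \<beta>\<close> to a decomposition of \<open>x\<close> leaves a
  relation between eigenvectors with distinct eigenvalues, so only a component with eigenvalue
  \<open>\<beta>\<close> survives. This isolates a single charge or a single weight in a spanning
  set.\<close>

lemma eigen_component:
  assumes "endo_on UNIV T" "\<And>i. i \<in> I \<Longrightarrow> subspace (S i)" "inj_on \<alpha> I"
    "\<And>i s. i \<in> I \<Longrightarrow> s \<in> S i \<Longrightarrow> T s = \<alpha> i *s s"
    "x \<in> span (\<Union>i\<in>I. S i)" "T x = \<beta> *s x"
  shows "x = 0 \<or> (\<exists>j\<in>I. \<alpha> j = \<beta> \<and> x \<in> S j)"
proof -
  obtain F s where F: "finite F" "F \<subseteq> I" "\<And>i. i \<in> F \<Longrightarrow> s i \<in> S i" "x = (\<Sum>i\<in>F. s i)"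
    using span_Union_decompose[OF assms(5,2)] by metis
  have Ts: "T (s i) = \<alpha> i *s s i" if "i \<in> F" for i using F assms(4) that by blast
  have TT: "T (c *s y) = c *s T y" for c y using assms(1) by (simp add: endo_on_def)
  have "T x = (\<Sum>i\<in>F. T (s i))"
    using endo_on_sum[OF assms(1) subspace_UNIV F(1), of s "\<lambda>_. 1"] F(4) by simp
  then have "(\<Sum>i\<in>F. \<alpha> i *s s i) = (\<Sum>i\<in>F. \<beta> *s s i)"
    using Ts F(4) assms(6) by (simp cong: sum.cong add: scale_sum_right)
  then have "(\<Sum>i\<in>F. (\<alpha> i - \<beta>) *s s i) = 0"
    by (simp add: scale_left_diff_distrib sum_subtractf)
  then have z: "(\<alpha> i - \<beta>) *s s i = 0" if "i \<in> F" for i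
    using independent_eigenvectors_sum[OF assms(1) subspace_UNIV F(1) inj_on_subset[OF assms(3) F(2)],
        of "\<lambda>i. (\<alpha> i - \<beta>) *s s i" i] that Ts TT by (simp add: mult.commute)
  show ?thesis
  proof (cases "\<exists>j\<in>F. s j \<noteq> 0")
    case True
    then obtain j where j: "j \<in> F" "s j \<noteq> 0" by blast
    then have \<beta>: "\<alpha> j = \<beta>" using z by force
    have "s i = 0" if "i \<in> F" "i \<noteq> j" for i
      using z[OF that(1)] \<beta> inj_onD[OF assms(3), of i j] F(2) that j by auto
    then have "x = (\<Sum>i\<in>F. if i = j then s i else 0)" unfolding F(4) by (intro sum.cong) auto
    then have "x = s j" using F(1) j by simp
    then show ?thesis using \<beta> j F by auto
  next
    case False
    then show ?thesis using F(4) by simp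
  qed
qed

lemma endo_UNIV_simps:
  assumes "endo_on UNIV T"
  shows "T (x + y) = T x + T y" "T (c *s x) = c *s T x" "T 0 = 0" "T (x - y) = T x - T y" "T (- x) = - T x"
  using endo_onD(2,3)[OF assms] endo_on_zero[OF assms subspace_UNIV] endo_on_diff[OF assms subspace_UNIV]
    endo_on_diff[OF assms subspace_UNIV, of 0 x] by simp_all

lemma endo_UNIV_sum:
  assumes "endo_on UNIV T" "finite F"
  shows "T (\<Sum>i\<in>F. c i *s f i) = (\<Sum>i\<in>F. c i *s T (f i))"
  by (rule endo_on_sum[OF assms(1) subspace_UNIV assms(2)]) simp

lemma endo_comp: "endo_on UNIV S \<Longrightarrow> endo_on UNIV T \<Longrightarrow> endo_on UNIV (\<lambda>x. S (T x))"
  by (simp add: endo_on_def)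

lemma endo_funpow: "endo_on UNIV T \<Longrightarrow> endo_on UNIV (T ^^ k)"
proof (induction k)
  case (Suc k)
  then show ?case by (auto simp: endo_on_def)
qed (simp add: endo_on_def)

lemma endo_span:
  assumes "endo_on UNIV T" "subspace Z" "\<And>x. x \<in> A \<Longrightarrow> T x \<in> Z" "x \<in> span A"
  shows "T x \<in> Z"
proof -
  have "subspace {x. T x \<in> Z}"
    using assms(2) unfolding subspace_def by (auto simp: endo_UNIV_simps[OF assms(1)])
  then have "span A \<subseteq> {x. T x \<in> Z}" using assms(3) by (intro span_minimal) auto
  then show ?thesis using assms(4) by blast
qed

lemma eq_uminus_self_imp_zero:
  fixes x :: 'v
  assumes "x = - x"
  shows "x = 0"
proof -
  have "2 *s x = x + x" using scale_left_distrib[of 1 1 x] by simp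
  also have "x + x = 0" using assms by (simp only: eq_neg_iff_add_eq_0)
  finally show ?thesis by simp
qed

lemma dim_Int_le:
  assumes "subspace P" "subspace Q" "P \<inter> Q = {0}" "A \<subseteq> P" "B \<subseteq> Q" "finite A" "X \<subseteq> span (A \<union> B)"
  shows "dim (X \<inter> P) \<le> card A"
proof (rule dim_le_card[OF _ assms(6)])
  show "X \<inter> P \<subseteq> span A"
  proof
    fix x assume x: "x \<in> X \<inter> P"
    then obtain y z where yz: "x = y + z" "y \<in> span A" "z \<in> span B"
      using assms(7) by (auto simp: span_Un)
    have "y \<in> P" "z \<in> Q" using yz span_minimal[OF assms(4,1)] span_minimal[OF assms(5,2)] by auto
    moreover have "z = x - y" using yz by simp
    then have "z \<in> P" using x \<open>y \<in> P\<close> subspace_diff[OF assms(1)] by simp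
    ultimately have "z = 0" using assms(3) by blast
    then show "x \<in> span A" using yz by simp
  qed
qed

section \<open>Polynomial combinations of a sequence\<close>

text \<open>If the variable acts on sequences as the shift, this is the entry at 0 of
  \<open>p\<close> applied to \<open>f\<close>. For \<open>f i = (T ^^ i) v\<close> it is
  \<open>p(T) v\<close>; its vanishing on all translates of a sequence is a linear recurrence with
  characteristic polynomial \<open>p\<close>.\<close>

definition psum :: "complex poly \<Rightarrow> (nat \<Rightarrow> 'v) \<Rightarrow> 'v" where
  "psum p f = (\<Sum>i\<le>degree p. coeff p i *s f i)"

lemma psum_ge: "degree p \<le> n \<Longrightarrow> psum p f = (\<Sum>i\<le>n. coeff p i *s f i)"
  unfolding psum_def by (rule sum.mono_neutral_left) (auto simp: coeff_eq_0)

lemma psum_add: "psum (p + q) f = psum p f + psum q f"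
proof -
  let ?n = "max (degree p) (degree q)"
  have "psum (p + q) f = (\<Sum>i\<le>?n. coeff (p + q) i *s f i)"
    by (rule psum_ge) (rule degree_add_le_max)
  also have "\<dots> = (\<Sum>i\<le>?n. coeff p i *s f i) + (\<Sum>i\<le>?n. coeff q i *s f i)"
    by (simp add: scale_left_distrib sum.distrib)
  finally show ?thesis using psum_ge[of p ?n f] psum_ge[of q ?n f] by simp
qed

lemma psum_smult: "psum (smult c p) f = c *s psum p f"
  using psum_ge[of "smult c p" "degree p" f]
  by (simp add: degree_smult_le psum_def scale_sum_right)

lemma psum_0 [simp]: "psum 0 f = 0"
  by (simp add: psum_def)

lemma psum_pCons: "psum (pCons a p) f = a *s f 0 + psum p (\<lambda>i. f (Suc i))"
proof -
  have "psum (pCons a p) f = (\<Sum>i\<le>Suc (degree p). coeff (pCons a p) i *s f i)"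
    by (rule psum_ge) (simp add: degree_pCons_le)
  also have "\<dots> = a *s f 0 + psum p (\<lambda>i. f (Suc i))"
    unfolding sum.atMost_Suc_shift psum_def by simp
  finally show ?thesis .
qed

lemma psum_monom: "psum (monom c n) f = c *s f n"
proof -
  have "psum (monom c n) f = (\<Sum>i\<le>n. coeff (monom c n) i *s f i)"
    by (rule psum_ge) (rule degree_monom_le)
  also have "\<dots> = (\<Sum>i\<le>n. if i = n then c *s f n else 0)"
    by (rule sum.cong) auto
  finally show ?thesis by simp
qed

lemma psum_diff: "psum (p - q) f = psum p f - psum q f"
  using psum_add[of p "smult (-1) q" f] psum_smult[of "-1" q f] by simp

lemma psum_sum: "psum (\<Sum>i\<in>F. p i) f = (\<Sum>i\<in>F. psum (p i) f)"
  by (induction F rule: infinite_finite_induct) (auto simp: psum_add)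

lemma psum_fun_add: "psum p (\<lambda>i. f i + g i) = psum p f + psum p g"
  by (simp add: psum_def scale_right_distrib sum.distrib)

lemma psum_fun_scale: "psum p (\<lambda>i. c *s f i) = c *s psum p f"
  by (simp add: psum_def scale_sum_right mult.commute)

lemma psum_fun_diff: "psum p (\<lambda>i. f i - g i) = psum p f - psum p g"
  by (simp add: psum_def scale_right_diff_distrib sum_subtractf)

lemma psum_fun_const: "psum p (\<lambda>i. x) = poly p 1 *s x"
  by (simp add: psum_def poly_altdef scale_sum_left)

lemma psum_mult: "psum (p * q) f = psum p (\<lambda>i. psum q (\<lambda>j. f (i + j)))"
proof (induction p arbitrary: f rule: pCons_induct)
  case 0
  then show ?case by simp
next
  case (pCons a p)
  have "psum (pCons a p * q) f = a *s psum q f + psum (p * q) (\<lambda>i. f (Suc i))"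
    by (simp add: mult_pCons_left psum_add psum_smult psum_pCons)
  then show ?case by (simp add: pCons.IH psum_pCons)
qed

lemma psum_linear_factor:
  "psum ([:- r, 1:] * q) f = psum q (\<lambda>i. f (Suc i)) - r *s psum q f"
  by (simp only: psum_mult) (simp add: psum_pCons)

text \<open>Multiplication by the index is the Euler operator \<open>X d/dX\<close> on polynomials;
  the factor \<open>X\<close> appears as the shift of \<open>f\<close>.\<close>

lemma psum_pderiv: "psum p (\<lambda>i. of_nat i *s f i) = psum (pderiv p) (\<lambda>i. f (Suc i))"
proof (induction p arbitrary: f rule: pCons_induct)
  case 0
  then show ?case by simp
next
  case (pCons a p)
  have "psum (pCons a p) (\<lambda>i. of_nat i *s f i) = psum p (\<lambda>i. f (Suc i) + of_nat i *s f (Suc i))"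
    by (simp add: psum_pCons scale_left_distrib)
  then show ?case
    by (simp add: psum_fun_add pCons.IH pderiv_pCons psum_add psum_pCons)
qed

lemma psum_endo:
  assumes "endo_on X T" "subspace X" "\<And>i. f i \<in> X"
  shows "T (psum p f) = psum p (\<lambda>i. T (f i))" "psum p f \<in> X"
  using endo_on_sum[OF assms(1,2)] assms(3)
  by (auto simp: psum_def intro!: subspace_sum[OF assms(2)] subspace_scale[OF assms(2)])

section \<open>Operators on bounded subspaces\<close>

lemma annihilating_poly:
  assumes "bounded_dim n X" "\<And>i. f i \<in> X"
  obtains p where "p \<noteq> 0" "psum p f = 0"
proof -
  obtain c where "\<exists>i\<le>n. c i \<noteq> 0" and c3: "(\<Sum>i\<in>{..n}. c i *s f i) = 0"
    using bounded_dim_relation[OF assms(1), of "{..n}" f] assms(2) by auto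
  then obtain i0 where c: "i0 \<in> {..n}" "c i0 \<noteq> 0" by auto
  let ?p = "\<Sum>i\<le>n. monom (c i) i"
  have "coeff ?p i0 = c i0" using c(1) by (simp add: coeff_sum)
  then have "?p \<noteq> 0" using c(2) by auto
  moreover have "psum ?p f = 0" using c3 by (simp add: psum_sum psum_monom)
  ultimately show ?thesis using that by blast
qed

lemma exists_min_degree:
  assumes "P p" "p \<noteq> (0::complex poly)"
  obtains q where "P q" "q \<noteq> 0" "\<And>r. P r \<Longrightarrow> r \<noteq> 0 \<Longrightarrow> degree q \<le> degree r"
  using ex_has_least_nat[of "\<lambda>p. P p \<and> p \<noteq> 0" p degree] assms by auto

lemma min_poly:
  assumes "bounded_dim n X" "subspace X" "endo_on X T" "v \<in> X" "v \<noteq> 0"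
  obtains p where "degree p > 0" "psum p (\<lambda>i. (T ^^ i) v) = 0"
    "\<And>q. q \<noteq> 0 \<Longrightarrow> degree q < degree p \<Longrightarrow> psum q (\<lambda>i. (T ^^ i) v) \<noteq> 0"
proof -
  let ?f = "\<lambda>i. (T ^^ i) v"
  have f: "?f i \<in> X" for i by (rule funpow_closed[OF assms(3,4)])
  obtain p0 where "p0 \<noteq> 0" "psum p0 ?f = 0" using annihilating_poly[OF assms(1), of ?f] f by blast
  then obtain p where p: "psum p ?f = 0" "p \<noteq> 0"
    "\<And>r. psum r ?f = 0 \<Longrightarrow> r \<noteq> 0 \<Longrightarrow> degree p \<le> degree r"
    using exists_min_degree[of "\<lambda>p. psum p ?f = 0" p0] by metis
  have "degree p > 0"
  proof (rule ccontr)
    assume "\<not> degree p > 0"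
    then obtain c where c: "p = [:c:]" by (metis degree_eq_zeroE gr0I)
    with p assms(5) show False by (simp add: psum_pCons)
  qed
  with p that show ?thesis by (metis leD)
qed

text \<open>If \<open>p\<close> is the minimal polynomial of \<open>v\<close> and \<open>r\<close>
  is a root of it, then \<open>p / (X - r)\<close> applied to \<open>v\<close> is nonzero and an
  eigenvector for \<open>r\<close>.\<close>

lemma eigenvector_exists:
  assumes "bounded_dim n X" "subspace X" "endo_on X T" "\<not> X \<subseteq> {0}"
  obtains v c where "v \<in> X" "v \<noteq> 0" "T v = c *s v"
proof -
  obtain v where v: "v \<in> X" "v \<noteq> 0" using assms(4) by blast
  let ?f = "\<lambda>i. (T ^^ i) v"
  have f: "?f i \<in> X" for i by (rule funpow_closed[OF assms(3) v(1)])
  obtain p where p: "degree p > 0" "psum p ?f = 0"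
    "\<And>q. q \<noteq> 0 \<Longrightarrow> degree q < degree p \<Longrightarrow> psum q ?f \<noteq> 0"
    using min_poly[OF assms(1-3) v] by metis
  have "\<not> constant (poly p)" using p(1) by (simp add: constant_degree)
  then obtain r where "poly p r = 0" using fundamental_theorem_of_algebra by blast
  then obtain q where q: "p = [:- r, 1:] * q" using poly_eq_0_iff_dvd by (metis dvdE)
  have q0: "q \<noteq> 0" using p(1) q by auto
  then have "degree p = Suc (degree q)" unfolding q by (subst degree_mult_eq) auto
  then have "psum q ?f \<noteq> 0" using p(3) q0 by simp
  moreover have "T (psum q ?f) = r *s psum q ?f"
    using p(2) psum_endo(1)[OF assms(3,2) f, of q] unfolding q psum_linear_factor by simp
  moreover have "psum q ?f \<in> X" by (rule psum_endo(2)[OF assms(3,2) f])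
  ultimately show ?thesis using that[of "psum q ?f" r] by simp
qed

text \<open>The constant term of the minimal polynomial of \<open>y\<close> is nonzero, since
  otherwise injectivity would cancel a factor \<open>T\<close>; solving the relation for
  \<open>y\<close> exhibits it as an image.\<close>

lemma injective_imp_surjective:
  assumes "bounded_dim n X" "subspace X" "endo_on X T" "\<And>x. x \<in> X \<Longrightarrow> T x = 0 \<Longrightarrow> x = 0" "y \<in> X"
  obtains x where "x \<in> X" "T x = y"
proof (cases "y = 0")
  case True
  then show ?thesis using that[of 0] endo_on_zero assms subspace_0 by blast
next
  case False
  let ?f = "\<lambda>i. (T ^^ i) y"
  have f: "?f i \<in> X" for i by (rule funpow_closed[OF assms(3,5)])
  obtain p where p: "degree p > 0" "psum p ?f = 0"
    "\<And>q. q \<noteq> 0 \<Longrightarrow> degree q < degree p \<Longrightarrow> psum q ?f \<noteq> 0"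
    using min_poly[OF assms(1-3,5) False] by metis
  obtain c q where pq: "p = pCons c q" by (cases p)
  have q: "q \<noteq> 0" "degree q < degree p" using p(1) pq by (auto split: if_splits)
  have X: "psum q ?f \<in> X" using psum_endo(2)[OF assms(3,2) f] .
  have e: "c *s y + T (psum q ?f) = 0"
    using p(2) psum_endo(1)[OF assms(3,2) f, of q] unfolding pq psum_pCons by simp
  have "c \<noteq> 0"
  proof
    assume "c = 0"
    then have "psum q ?f = 0" using e assms(4) X by simp
    then show False using p(3) q by blast
  qed
  have "T ((- inverse c) *s psum q ?f) = (- inverse c) *s T (psum q ?f)"
    using endo_onD(3)[OF assms(3) X] .
  also have "T (psum q ?f) = - (c *s y)" using e by (simp add: eq_neg_iff_add_eq_0 add.commute)
  finally have "T ((- inverse c) *s psum q ?f) = y" using \<open>c \<noteq> 0\<close> by simp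
  then show ?thesis using that X subspace_scale[OF assms(2)] by blast
qed

text \<open>Induction on the dimension bound: an operator that is not scalar on \<open>X\<close> has
  an eigenspace that is a proper subspace, and commuting operators preserve it. The family may
  therefore be infinite.\<close>

lemma common_eigenvector:
  assumes "bounded_dim n X" "subspace X" "\<not> X \<subseteq> {0}" "\<And>i. endo_on X (T i)"
    "\<And>i j x. x \<in> X \<Longrightarrow> T i (T j x) = T j (T i x)"
  obtains v c where "v \<in> X" "v \<noteq> 0" "\<And>i. T i v = c i *s v"
proof -
  have "\<exists>v\<in>X. v \<noteq> 0 \<and> (\<forall>i. \<exists>c. T i v = c *s v)"
    using assms
  proof (induction n arbitrary: X rule: less_induct)
    case (less n)
    show ?case
    proof (cases "\<forall>i. \<exists>c. \<forall>v\<in>X. T i v = c *s v")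
      case True
      then show ?thesis using less.prems(3) by blast
    next
      case False
      then obtain i where i: "\<And>c. \<exists>v\<in>X. T i v \<noteq> c *s v" by blast
      obtain u c where u: "u \<in> X" "u \<noteq> 0" "T i u = c *s u"
        using eigenvector_exists[OF less.prems(1,2) less.prems(4)[of i] less.prems(3)] by metis
      define Y where "Y = {v\<in>X. T i v = c *s v}"
      note E = endo_onD[OF less.prems(4)]
      have sub: "subspace Y"
        using less.prems(2) E endo_on_zero[OF less.prems(4) less.prems(2)]
        unfolding Y_def subspace_def by (auto simp: scale_right_distrib mult.commute)
      have "endo_on Y (T j)" for j
        by (rule endo_on_subset[OF less.prems(4)])
          (auto simp: Y_def less.prems(5)[of _ i j] E)
      moreover obtain w where "w \<in> X" "w \<notin> Y" using i[of c] by (auto simp: Y_def)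
      then have "n > 0 \<and> bounded_dim (n - 1) Y"
        using bounded_dim_proper[OF less.prems(1) _ sub] by (auto simp: Y_def)
      moreover have "\<not> Y \<subseteq> {0}" using u by (auto simp: Y_def)
      ultimately have "\<exists>v\<in>Y. v \<noteq> 0 \<and> (\<forall>i. \<exists>c. T i v = c *s v)"
        using less.IH[of "n - 1" Y] sub less.prems(5) by (auto simp: Y_def)
      then show ?thesis by (auto simp: Y_def)
    qed
  qed
  then show ?thesis using that by metis
qed

text \<open>Each application of \<open>N\<close> moves an eigenvalue of \<open>A\<close> by
  \<open>c\<close>. If \<open>N\<close> were injective, one eigenvector of \<open>A\<close> would
  give arbitrarily many distinct eigenvalues in a space of bounded dimension.\<close>

lemma ad_eigen_kernel:
  assumes "bounded_dim n X" "subspace X" "\<not> X \<subseteq> {0}" "endo_on X A" "endo_on X N"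
    "\<And>x. x \<in> X \<Longrightarrow> A (N x) = N (A x) + c *s N x" "c \<noteq> 0"
  obtains x where "x \<in> X" "x \<noteq> 0" "N x = 0"
proof -
  have "\<exists>x\<in>X. x \<noteq> 0 \<and> N x = 0"
  proof (rule ccontr)
    assume "\<not> (\<exists>x\<in>X. x \<noteq> 0 \<and> N x = 0)"
    then have inj: "N x \<noteq> 0" if "x \<in> X" "x \<noteq> 0" for x using that by blast
    obtain v \<alpha> where v: "v \<in> X" "v \<noteq> 0" "A v = \<alpha> *s v"
      using eigenvector_exists[OF assms(1,2,4,3)] by metis
    let ?f = "\<lambda>k. (N ^^ k) v"
    have fX: "?f k \<in> X" for k by (rule funpow_closed[OF assms(5) v(1)])
    have f0: "?f k \<noteq> 0" for k by (induction k) (use v inj fX in auto)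
    have eig: "A (?f k) = (\<alpha> + of_nat k * c) *s ?f k" for k
    proof (induction k)
      case (Suc k)
      have "A (?f (Suc k)) = N (A (?f k)) + c *s ?f (Suc k)" using assms(6)[OF fX[of k]] by simp
      also have "N (A (?f k)) = (\<alpha> + of_nat k * c) *s ?f (Suc k)"
        unfolding Suc endo_onD(3)[OF assms(5) fX] by simp
      finally show ?case by (simp add: algebra_simps scale_left_distrib)
    qed (simp add: v)
    obtain d where d: "\<exists>k\<in>{..n}. d k \<noteq> 0" "(\<Sum>k\<in>{..n}. d k *s ?f k) = 0"
      using bounded_dim_relation[OF assms(1), of "{..n}" ?f] fX by auto
    have "inj_on (\<lambda>k. \<alpha> + of_nat k * c) {..n}" using assms(7) by (auto simp: inj_on_def)
    then have "d k *s ?f k = 0" if "k \<in> {..n}" for k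
      using independent_eigenvectors_sum[OF assms(4,2), of "{..n}" _ "\<lambda>k. d k *s ?f k" k] d(2) that
        fX subspace_scale[OF assms(2)] eig endo_onD(3)[OF assms(4) fX] by (simp add: mult.commute)
    then show False using d(1) f0 by auto
  qed
  then show ?thesis using that by blast
qed

text \<open>Lie's lemma: the span of the \<open>A\<^sup>j v\<close> is invariant under the \<open>T i\<close>, which act on it by triangular
  matrices with constant diagonal.\<close>

lemma lie_eigenvalue:
  assumes "bounded_dim n X" "subspace X" "endo_on X A" "\<And>i. endo_on X (T i)"
    "\<And>i. endo_on X (B i)" "\<And>i x. x \<in> X \<Longrightarrow> A (T i x) = T i (A x) + B i x"
    "\<And>i. \<exists>J e. finite J \<and> (\<forall>x\<in>X. B i x = (\<Sum>j\<in>J. e j *s T j x))"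
    "v \<in> X" "v \<noteq> 0" "\<And>i. T i v = \<tau> i *s v" "\<And>i. B i v = \<nu> i *s v"
  shows "\<nu> i = 0"
proof (rule ccontr)
  assume nz: "\<nu> i \<noteq> 0"
  define F where "F k = span ((\<lambda>j. (A ^^ j) v) ` {..<k})" for k
  let ?f = "\<lambda>j. (A ^^ j) v"
  have fX: "?f k \<in> X" for k by (rule funpow_closed[OF assms(3,8)])
  have FX: "F k \<subseteq> X" for k unfolding F_def by (rule span_minimal[OF _ assms(2)]) (use fX in auto)
  have Fsub: "subspace (F k)" for k by (simp add: F_def)
  have Fmono: "F j \<subseteq> F k" if "j \<le> k" for j k unfolding F_def by (rule span_mono) (use that in auto)
  have fF: "?f j \<in> F k" if "j < k" for j k unfolding F_def using that by (intro span_base) auto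
  have Find: "P x" if "x \<in> F k" "subspace {x\<in>X. P x}" "\<And>j. j < k \<Longrightarrow> P (?f j)" for P x k
  proof -
    have "F k \<subseteq> {x\<in>X. P x}" unfolding F_def by (rule span_minimal) (use that fX in auto)
    then show ?thesis using that(1) by blast
  qed
  have subI: "subspace {x\<in>X. S x - c *s x \<in> Z}" if "endo_on X S" "subspace Z" for S c Z
  proof (rule subspaceI)
    fix x y assume a: "x \<in> {x\<in>X. S x - c *s x \<in> Z}" "y \<in> {x\<in>X. S x - c *s x \<in> Z}"
    have "S (x + y) - c *s (x + y) = (S x - c *s x) + (S y - c *s y)"
      using a endo_onD(2)[OF that(1)] by (simp add: scale_right_distrib)
    then show "x + y \<in> {x\<in>X. S x - c *s x \<in> Z}"
      using a subspace_add[OF that(2)] subspace_add[OF assms(2)] by auto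
  next
    fix d x assume a: "x \<in> {x\<in>X. S x - c *s x \<in> Z}"
    have "S (d *s x) - c *s (d *s x) = d *s (S x - c *s x)"
      using a endo_onD(3)[OF that(1)] by (simp add: scale_right_diff_distrib mult.commute)
    then show "d *s x \<in> {x\<in>X. S x - c *s x \<in> Z}"
      using a subspace_scale[OF that(2)] subspace_scale[OF assms(2)] by auto
  qed (use that endo_on_zero[OF that(1) assms(2)] subspace_0 assms(2) in auto)
  have AF: "A x \<in> F (Suc k)" if "x \<in> F k" for x k
  proof -
    have "A x - 0 *s x \<in> F (Suc k)"
    proof (rule Find[OF that subI[OF assms(3) Fsub]])
      fix j assume "j < k"
      then have "?f (Suc j) \<in> F (Suc k)" by (intro fF) simp
      then show "A (?f j) - 0 *s ?f j \<in> F (Suc k)" by simp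
    qed
    then show ?thesis by simp
  qed
  \<comment> \<open>Modulo \<open>F (j - 1)\<close>, the operator \<open>T l\<close> has
    \<open>\<tau> l\<close> on the diagonal and \<open>- j \<nu> l\<close> next to it. For
    \<open>j = 0\<close> the truncated \<open>j - 1\<close> is harmless, as its coefficient is
    0.\<close>
  have tri: "T l (?f j) - \<tau> l *s ?f j + (of_nat j * \<nu> l) *s ?f (j - 1) \<in> F (j - 1)" for l j
  proof (induction j arbitrary: l)
    case 0
    then show ?case using assms(10) Fsub subspace_0 by simp
  next
    case (Suc j)
    define r where "r m = T m (?f j) - \<tau> m *s ?f j + (of_nat j * \<nu> m) *s ?f (j - 1)" for m
    have r: "r m \<in> F (j - 1)" for m using Suc[of m] by (simp add: r_def)
    have Tm: "T m (?f j) - \<tau> m *s ?f j \<in> F j" for m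
    proof -
      have "T m (?f j) - \<tau> m *s ?f j = r m - (of_nat j * \<nu> m) *s ?f (j - 1)" by (simp add: r_def)
      moreover have "(of_nat j * \<nu> m) *s ?f (j - 1) \<in> F j"
        by (cases j) (auto intro: subspace_scale[OF Fsub] fF subspace_0[OF Fsub])
      ultimately show ?thesis using r[of m] Fmono[of "j - 1" j] subspace_diff[OF Fsub] by fastforce
    qed
    \<comment> \<open>\<open>B l\<close> is a combination of the \<open>T m\<close>, hence also
      triangular; evaluation at \<open>v\<close> identifies its diagonal entry as
      \<open>\<nu> l\<close>.\<close>
    have B: "B l (?f j) - \<nu> l *s ?f j \<in> F j"
    proof -
      obtain J e where J: "finite J" "\<And>x. x \<in> X \<Longrightarrow> B l x = (\<Sum>m\<in>J. e m *s T m x)"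
        using assms(7)[of l] by blast
      have "\<nu> l *s v = (\<Sum>m\<in>J. e m * \<tau> m) *s v"
        using J(2)[OF assms(8)] assms(10,11) by (simp add: scale_sum_left)
      then have "\<nu> l = (\<Sum>m\<in>J. e m * \<tau> m)" using assms(9) by simp
      then have "B l (?f j) - \<nu> l *s ?f j = (\<Sum>m\<in>J. e m *s (T m (?f j) - \<tau> m *s ?f j))"
        using J(2)[OF fX[of j]] by (simp add: scale_sum_left scale_right_diff_distrib sum_subtractf)
      then show ?thesis using Tm by (auto intro: subspace_sum[OF Fsub] subspace_scale[OF Fsub])
    qed
    have A2: "A (T l (?f j)) = \<tau> l *s ?f (Suc j) - (of_nat j * \<nu> l) *s ?f j + A (r l)"
    proof -
      have "T l (?f j) + (of_nat j * \<nu> l) *s ?f (j - 1) = \<tau> l *s ?f j + r l" by (simp add: r_def)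
      then have e1: "A (T l (?f j) + (of_nat j * \<nu> l) *s ?f (j - 1)) = A (\<tau> l *s ?f j + r l)" by simp
      have e2: "A (T l (?f j) + (of_nat j * \<nu> l) *s ?f (j - 1))
          = A (T l (?f j)) + (of_nat j * \<nu> l) *s A (?f (j - 1))"
        using endo_onD(2,3)[OF assms(3)] fX endo_onD(1)[OF assms(4)[of l]] subspace_scale[OF assms(2)]
        by simp
      have "r l \<in> X" using r[of l] FX by blast
      then have e3: "A (\<tau> l *s ?f j + r l) = \<tau> l *s A (?f j) + A (r l)"
        using endo_onD(2,3)[OF assms(3)] fX subspace_scale[OF assms(2)] by simp
      have e4: "(of_nat j * \<nu> l) *s A (?f (j - 1)) = (of_nat j * \<nu> l) *s ?f j" by (cases j) auto
      have "A (T l (?f j)) + (of_nat j * \<nu> l) *s ?f j = \<tau> l *s ?f (Suc j) + A (r l)"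
        using e1[unfolded e2 e3 e4] by simp
      then show ?thesis by (simp add: algebra_simps eq_diff_eq)
    qed
    have "A (r l) \<in> F j"
    proof (cases j)
      case 0
      then have "r l = 0" using r[of l] by (simp add: F_def)
      then show ?thesis using endo_on_zero[OF assms(3,2)] subspace_0[OF Fsub] by simp
    next
      case (Suc i)
      then show ?thesis using AF[OF r[of l]] by simp
    qed
    moreover have "T l (?f (Suc j)) = A (T l (?f j)) - B l (?f j)"
      using assms(6)[OF fX[of j]] by simp
    then have "T l (?f (Suc j)) - \<tau> l *s ?f (Suc j) + (of_nat (Suc j) * \<nu> l) *s ?f (Suc j - 1)
        = A (r l) - (B l (?f j) - \<nu> l *s ?f j)"
      unfolding A2 by (simp add: algebra_simps scale_left_distrib)
    ultimately show ?case using B subspace_diff[OF Fsub] by simp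
  qed
  have "\<exists>j. ?f j \<in> F j"
  proof (rule ccontr)
    assume ne: "\<nexists>j. ?f j \<in> F j"
    have "independent (?f ` {..<k}) \<and> inj_on ?f {..<k}" for k
    proof (induction k)
      case (Suc k)
      have "?f k \<notin> F k" using ne by blast
      then have "?f k \<notin> span (?f ` {..<k})" by (simp add: F_def)
      then show ?case using Suc independent_insert[of "?f k" "?f ` {..<k}"] span_base[of "?f k" "?f ` {..<k}"]
        by (auto simp: lessThan_Suc)
    qed (simp add: independent_empty)
    then have "independent (?f ` {..<Suc n})" "inj_on ?f {..<Suc n}" by blast+
    then have "card (?f ` {..<Suc n}) = Suc n" using card_image by fastforce
    moreover have "?f ` {..<Suc n} \<subseteq> X" using fX by blast
    ultimately show False
      using bounded_dimD[OF assms(1), of "?f ` {..<Suc n}"] \<open>independent (?f ` {..<Suc n})\<close> by simp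
  qed
  then obtain J where J: "?f J \<in> F J" "\<And>j. j < J \<Longrightarrow> ?f j \<notin> F j"
    using exists_least_iff[of "\<lambda>j. ?f j \<in> F j"] by blast
  have "J \<noteq> 0"
  proof
    assume "J = 0"
    then show False using J(1) assms(9) by (simp add: F_def)
  qed
  have low: "T i x - \<tau> i *s x \<in> F (J - 1)" if "x \<in> F J" for x
  proof (rule Find[OF that subI[OF assms(4) Fsub]])
    fix j assume j: "j < J"
    have "(of_nat j * \<nu> i) *s ?f (j - 1) \<in> F (J - 1)"
    proof (cases j)
      case (Suc k)
      then show ?thesis using j by (intro subspace_scale[OF Fsub] fF) simp
    qed (simp add: subspace_0[OF Fsub])
    moreover have "F (j - 1) \<subseteq> F (J - 1)" using j by (intro Fmono) simp
    ultimately have "(T i (?f j) - \<tau> i *s ?f j + (of_nat j * \<nu> i) *s ?f (j - 1)) - (of_nat j * \<nu> i) *s ?f (j - 1) \<in> F (J - 1)"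
      using tri[where l=i and j=j] by (intro subspace_diff[OF Fsub]) auto
    then show "T i (?f j) - \<tau> i *s ?f j \<in> F (J - 1)" by simp
  qed
  \<comment> \<open>As \<open>?f J\<close> lies in \<open>F J\<close>, the term next to the diagonal
    can be isolated; it would put \<open>?f (J - 1)\<close> into \<open>F (J - 1)\<close>, against
    the minimality of \<open>J\<close>. This replaces the usual trace argument.\<close>
  have "(T i (?f J) - \<tau> i *s ?f J + (of_nat J * \<nu> i) *s ?f (J - 1)) - (T i (?f J) - \<tau> i *s ?f J) \<in> F (J - 1)"
    using tri[where l=i and j=J] low[OF J(1)] by (rule subspace_diff[OF Fsub])
  then have "(of_nat J * \<nu> i) *s ?f (J - 1) \<in> F (J - 1)" by simp
  then have "inverse (of_nat J * \<nu> i) *s ((of_nat J * \<nu> i) *s ?f (J - 1)) \<in> F (J - 1)"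
    by (rule subspace_scale[OF Fsub])
  moreover have "inverse (of_nat J * \<nu> i) * (of_nat J * \<nu> i) = 1"
    using nz \<open>J \<noteq> 0\<close> by (intro left_inverse) simp
  ultimately have "?f (J - 1) \<in> F (J - 1)" unfolding scale_scale by simp
  then show False using J(2)[of "J - 1"] \<open>J \<noteq> 0\<close> by simp
qed

section \<open>The Heisenberg subalgebra\<close>

text \<open>The vectors \<open>(h j)\<^sup>e v\<close> with \<open>e * j = \<Prod>F\<close> have the same weight, but different eigenvalues under
  the operators \<open>h i h (- i)\<close>.\<close>

lemma heisenberg_powers_dependent:
  assumes "\<And>m. endo_on UNIV (h m)"
    and comm: "\<And>m n x. h m (h n x) - h n (h m x) = (if m + n = 0 then of_int m * \<kappa> else 0) *s x"
    and X: "\<And>m i x. x \<in> X i \<Longrightarrow> h m x \<in> X (i + m)" "\<And>i. bounded_dim n (X i)"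
    and v: "v \<in> X 0" "v \<noteq> 0"
    and F: "finite F" "F \<subseteq> {0::int<..}" "n < card F"
    and x: "\<And>j. j \<in> F \<Longrightarrow> h j (h (- j) v) = x j *s v"
      "\<And>j s. j \<in> F \<Longrightarrow> x j \<noteq> of_nat (Suc s) * of_int j * \<kappa>"
  shows "\<kappa> = 0"
proof (rule ccontr)
  assume \<kappa>: "\<kappa> \<noteq> 0"
  note lin = endo_UNIV_simps[OF assms(1)]
  have comm0: "h m (h n x) = h n (h m x)" if "m + n \<noteq> 0" for m n x
    using comm[of m n x] that by simp
  let ?p = "\<lambda>j r. (h j ^^ r) v"
  have pX: "?p j r \<in> X (of_nat r * j)" for j r
  proof (induction r)
    case (Suc r)
    then show ?case using X(1)[OF Suc, of j] by (simp add: algebra_simps)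
  qed (simp add: v)
  have e1: "h j (h (- j) (?p j r)) = (x j - of_nat r * of_int j * \<kappa>) *s ?p j r" if "j \<in> F" for j r
  proof (induction r)
    case (Suc r)
    have "h (- j) (h j (?p j r)) = h j (h (- j) (?p j r)) - (of_int j * \<kappa>) *s ?p j r"
      using comm[of j "- j" "?p j r"] by (simp add: algebra_simps)
    also have "\<dots> = (x j - of_nat (Suc r) * of_int j * \<kappa>) *s ?p j r"
      unfolding Suc by (simp add: algebra_simps scale_left_diff_distrib scale_left_distrib)
    finally show ?case by (simp add: lin)
  qed (simp add: x that)
  have nz: "?p j r \<noteq> 0" if "j \<in> F" for j r
  proof (induction r)
    case (Suc r)
    show ?case
    proof
      assume "?p j (Suc r) = 0"
      then have "h (- j) (h j (?p j r)) = 0" by (simp add: lin)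
      moreover have "h (- j) (h j (?p j r)) = h j (h (- j) (?p j r)) - (of_int j * \<kappa>) *s ?p j r"
        using comm[of j "- j" "?p j r"] by (simp add: algebra_simps)
      ultimately have "(x j - of_nat (Suc r) * of_int j * \<kappa>) *s ?p j r = 0"
        unfolding e1[OF that] by (simp add: algebra_simps scale_left_diff_distrib scale_left_distrib)
      then show False using Suc x(2)[OF that, of r] by simp
    qed
  qed (simp add: v)
  have e2: "h i (h (- i) (?p j r)) = x i *s ?p j r" if "i \<in> F" "j \<in> F" "i \<noteq> j" for i j r
  proof (induction r)
    case (Suc r)
    have "i > 0" "j > 0" using that F(2) by auto
    then have "i + j \<noteq> 0" "- i + j \<noteq> 0" using that by auto
    then have "h i (h (- i) (h j (?p j r))) = h j (h i (h (- i) (?p j r)))"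
      using comm0 by metis
    then show ?case using Suc by (simp add: lin)
  qed (simp add: x that)
  define N where "N = \<Prod>F"
  define u where "u j = ?p j (nat (N div j))" for j
  have Npos: "N > 0" unfolding N_def using F by (intro prod_pos) auto
  have dv: "of_nat (nat (N div j)) * j = N" "N div j > 0" if "j \<in> F" for j
  proof -
    have d: "j dvd N" "j > 0" using that F unfolding N_def by (auto intro: dvd_prodI)
    then show "N div j > 0" using Npos by (simp add: pos_imp_zdiv_pos_iff zdvd_imp_le)
    then show "of_nat (nat (N div j)) * j = N" using d by simp
  qed
  have uX: "u j \<in> X N" if "j \<in> F" for j using pX[where j=j and r="nat (N div j)"] dv[OF that] by (simp add: u_def)
  obtain c where c: "\<exists>i\<in>F. c i \<noteq> 0" "(\<Sum>i\<in>F. c i *s u i) = 0"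
    using bounded_dim_relation[OF X(2)[of N] F(1,3), of u] uX by auto
  then obtain i where i: "i \<in> F" "c i \<noteq> 0" by blast
  \<comment> \<open>This operator kills \<open>u j\<close> for \<open>j \<noteq> i\<close> by
    \<open>e2\<close> and multiplies \<open>u i\<close> by \<open>- N \<kappa>\<close> by
    \<open>e1\<close>.\<close>
  let ?T = "\<lambda>y. h i (h (- i) y) - x i *s y"
  have T: "endo_on UNIV ?T" by (auto simp: endo_on_def lin scale_right_distrib scale_right_diff_distrib mult.commute)
  have "0 = ?T (\<Sum>j\<in>F. c j *s u j)" unfolding c(2) by (simp add: lin)
  also have "\<dots> = (\<Sum>j\<in>F. c j *s ?T (u j))" by (rule endo_UNIV_sum[OF T F(1)])
  also have "\<dots> = (\<Sum>j\<in>F. if j = i then c i *s ?T (u i) else 0)"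
    by (rule sum.cong) (use e2[OF i(1)] in \<open>auto simp: u_def\<close>)
  also have "\<dots> = c i *s ?T (u i)" using F(1) i(1) by simp
  also have "?T (u i) = (- (of_nat (nat (N div i)) * of_int i * \<kappa>)) *s u i"
    unfolding u_def e1[OF i(1)] by (simp add: algebra_simps scale_left_diff_distrib)
  finally have "of_nat (nat (N div i)) * of_int i * \<kappa> = 0"
    using i nz[OF i(1)] by (simp add: u_def)
  then show False using dv(2)[OF i(1)] \<kappa> F(2) i(1) by auto
qed

text \<open>The operators \<open>h j (h (- j))\<close> with \<open>j > 0\<close> commute on
  \<open>X 0\<close>, so they have a common eigenvector \<open>v\<close>, with eigenvalues
  \<open>x j\<close>. A power of \<open>h j\<close> can kill \<open>v\<close> only if
  \<open>x j\<close> is a positive integer multiple of \<open>j \<kappa>\<close>, and then no power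
  of \<open>h (- j)\<close> kills it. Among \<open>2 n + 1\<close> indices more than
  \<open>n\<close> are of the same kind, and the second kind is reduced to the first by
  \<open>m \<mapsto> - m\<close>, \<open>\<kappa> \<mapsto> - \<kappa>\<close>.\<close>

lemma heisenberg_central_charge_zero:
  assumes "\<And>m. endo_on UNIV (h m)"
    and comm: "\<And>m n x. h m (h n x) - h n (h m x) = (if m + n = 0 then of_int m * \<kappa> else 0) *s x"
    and X: "\<And>m i x. x \<in> X i \<Longrightarrow> h m x \<in> X (i + m)" "\<And>i. bounded_dim n (X i)" "\<And>i. subspace (X i)"
    and ne: "\<not> X (0::int) \<subseteq> {0}"
  shows "\<kappa> = 0"
proof (rule ccontr)
  assume \<kappa>: "\<kappa> \<noteq> 0"
  note lin = endo_UNIV_simps[OF assms(1)]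
  have comm0: "h m (h n x) = h n (h m x)" if "m + n \<noteq> 0" for m n x
    using comm[of m n x] that by simp
  define T where "T k x = h (1 + int k) (h (- (1 + int k)) x)" for k x
  have Tend: "endo_on (X 0) (T k)" for k
    unfolding endo_on_def T_def using X(1)[OF X(1)[of _ 0 "- (1 + int k)"], of _ "1 + int k"] by (auto simp: lin)
  have Tcomm: "T i (T j x) = T j (T i x)" for i j x
  proof (cases "i = j")
    case False
    let ?i = "1 + int i" let ?j = "1 + int j"
    have "?i + ?j \<noteq> 0" "?i + - ?j \<noteq> 0" "- ?i + ?j \<noteq> 0" "- ?i + - ?j \<noteq> 0" using False by auto
    then have c: "h ?i (h ?j x) = h ?j (h ?i x)" "h ?i (h (- ?j) x) = h (- ?j) (h ?i x)"
      "h (- ?i) (h ?j x) = h ?j (h (- ?i) x)" "h (- ?i) (h (- ?j) x) = h (- ?j) (h (- ?i) x)" for x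
      by (blast intro: comm0)+
    show ?thesis unfolding T_def by (simp only: c)
  qed simp
  obtain v y where v: "v \<in> X 0" "v \<noteq> 0" "\<And>k. T k v = y k *s v"
    by (rule common_eigenvector[where T=T, OF X(2,3) ne Tend Tcomm]) (rule that; assumption)
  define x where "x j = y (nat (j - 1))" for j
  have x: "h j (h (- j) v) = x j *s v" if "j > 0" for j
    using v(3)[of "nat (j - 1)"] that by (simp add: T_def x_def)
  define P where "P = {j \<in> {1..2 * int n + 1}. \<forall>s. x j \<noteq> of_nat (Suc s) * of_int j * \<kappa>}"
  define Q where "Q = {1..2 * int n + 1} - P"
  have "P \<subseteq> {1..2 * int n + 1}" "Q \<subseteq> {1..2 * int n + 1}" by (auto simp: P_def Q_def)
  then have fin: "finite P" "finite Q" "P \<union> Q = {1..2 * int n + 1}" "P \<inter> Q = {}"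
    using finite_subset[of _ "{1..2 * int n + 1}"] by (auto simp: Q_def)
  then have "card P + card Q = card {1..2 * int n + 1}" by (metis card_Un_disjoint)
  then have "n < card P \<or> n < card Q" by auto
  then show False
  proof
    assume "n < card P"
    then have "\<kappa> = 0"
      by (intro heisenberg_powers_dependent[where F=P and h=h and X=X and n=n and v=v and x=x and \<kappa>=\<kappa>])
        (use assms(1) comm X v fin x in \<open>auto simp: P_def\<close>)
    then show False using \<kappa> by simp
  next
    assume Q: "n < card Q"
    have comm': "h (- m) (h (- n) z) - h (- n) (h (- m) z) = (if m + n = 0 then of_int m * (- \<kappa>) else 0) *s z" for m n z
      using comm[of "- m" "- n" z] by (auto simp: add_eq_0_iff2)
    have X': "h (- m) z \<in> X (- (i + m))" if "z \<in> X (- i)" for m i z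
      using X(1)[OF that, of "- m"] by (simp add: algebra_simps)
    have x': "h (- j) (h (- (- j)) v) = (x j - of_int j * \<kappa>) *s v" if "j \<in> Q" for j
    proof -
      have "j > 0" using that by (auto simp: Q_def)
      then show ?thesis using x[of j] comm[of j "- j" v]
        by (simp add: scale_left_diff_distrib algebra_simps)
    qed
    have x'': "x j - of_int j * \<kappa> \<noteq> of_nat (Suc s) * of_int j * (- \<kappa>)" if j: "j \<in> Q" for j s
    proof
      assume e: "x j - of_int j * \<kappa> = of_nat (Suc s) * of_int j * (- \<kappa>)"
      from j obtain s' where "x j = of_nat (Suc s') * of_int j * \<kappa>" and "j > 0"
        by (auto simp: Q_def P_def)
      with e have "of_nat (s' + Suc s) * (of_int j * \<kappa>) = 0" by (simp add: algebra_simps)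
      then show False using \<kappa> \<open>j > 0\<close> by (simp del: of_nat_add of_nat_Suc)
    qed
    have "- \<kappa> = 0"
      by (intro heisenberg_powers_dependent[where F=Q and h="\<lambda>m. h (- m)" and X="\<lambda>i. X (- i)" and n=n
            and v=v and x="\<lambda>j. x j - of_int j * \<kappa>" and \<kappa>="- \<kappa>"])
        (use assms(1) comm' X(2) X' v fin x' x'' Q in \<open>auto simp: Q_def simp del: of_nat_Suc\<close>)
    then show False using \<kappa> by simp
  qed
qed

end

section \<open>Bounded modules with trivial central charge\<close>

text \<open>The module as a family of operators, with the central terms gone from the relations. The
  form is stable under exchanging \<open>gp\<close> with \<open>gm\<close> and negating
  \<open>h\<close>, so the case of lowest charge is the same locale with other parameters.
  \<open>nb\<close> bounds both parities together.\<close>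

locale ramond_operators = complex_vector_space scale
  for scale :: "complex \<Rightarrow> 'v::ab_group_add \<Rightarrow> 'v" (infixr "*s" 75) +
  fixes l h gp gm :: "int \<Rightarrow> 'v \<Rightarrow> 'v" and grade :: "bit \<Rightarrow> 'v set" and \<mu> :: complex and nb :: nat
  assumes endo: "endo_on UNIV (l m)" "endo_on UNIV (h m)" "endo_on UNIV (gp m)" "endo_on UNIV (gm m)"
    and ll: "l m (l n v) - l n (l m v) = of_int (n - m) *s l (m + n) v"
    and lh: "l m (h n v) - h n (l m v) = of_int n *s h (m + n) v"
    and hh: "h m (h n v) = h n (h m v)"
    and lgp: "l m (gp p v) - gp p (l m v) = (of_int p - of_int m / 2) *s gp (p + m) v"
    and lgm: "l m (gm p v) - gm p (l m v) = (of_int p - of_int m / 2) *s gm (p + m) v"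
    and hgp: "h m (gp p v) - gp p (h m v) = gp (m + p) v"
    and hgm: "h m (gm p v) - gm p (h m v) = - gm (m + p) v"
    and gpgm: "gp p (gm q v) + gm q (gp p v) = (- 2) *s l (p + q) v + of_int (p - q) *s h (p + q) v"
    and gpgp: "gp p (gp q v) = - gp q (gp p v)"
    and gmgm: "gm p (gm q v) = - gm q (gm p v)"
    and subspace_grade: "subspace (grade \<tau>)"
    and grade_Int: "grade 0 \<inter> grade 1 = {0}"
    and grade_closed: "v \<in> grade \<tau> \<Longrightarrow> l m v \<in> grade \<tau>" "v \<in> grade \<tau> \<Longrightarrow> h m v \<in> grade \<tau>"
      "v \<in> grade \<tau> \<Longrightarrow> gp m v \<in> grade (\<tau> + 1)" "v \<in> grade \<tau> \<Longrightarrow> gm m v \<in> grade (\<tau> + 1)"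
    and bounded: "bounded_dim nb {v. l 0 v = (\<mu> + of_int i) *s v}"
    and simple: "subspace Y \<Longrightarrow> (\<And>m y. y \<in> Y \<Longrightarrow> l m y \<in> Y) \<Longrightarrow> (\<And>m y. y \<in> Y \<Longrightarrow> h m y \<in> Y) \<Longrightarrow>
      (\<And>m y. y \<in> Y \<Longrightarrow> gp m y \<in> Y) \<Longrightarrow> (\<And>m y. y \<in> Y \<Longrightarrow> gm m y \<in> Y) \<Longrightarrow>
      Y \<subseteq> span (Y \<inter> grade 0 \<union> Y \<inter> grade 1) \<Longrightarrow> y \<in> Y \<Longrightarrow> y \<noteq> 0 \<Longrightarrow> Y = UNIV"
begin

lemmas lin = endo_UNIV_simps[OF endo(1)] endo_UNIV_simps[OF endo(2)]
  endo_UNIV_simps[OF endo(3)] endo_UNIV_simps[OF endo(4)]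

text \<open>Parity is recorded besides charge and weight, so that whatever is spanned by vectors of
  components is graded, as \<open>simple\<close> demands.\<close>

definition component :: "complex \<Rightarrow> int \<Rightarrow> bit \<Rightarrow> 'v set" where
  "component a i \<tau> = {v \<in> grade \<tau>. h 0 v = a *s v \<and> l 0 v = (\<mu> + of_int i) *s v}"

lemma componentD: "v \<in> component a i \<tau> \<Longrightarrow> v \<in> grade \<tau>" "v \<in> component a i \<tau> \<Longrightarrow> h 0 v = a *s v"
    "v \<in> component a i \<tau> \<Longrightarrow> l 0 v = (\<mu> + of_int i) *s v"
  by (auto simp: component_def)

lemma subspace_component: "subspace (component a i \<tau>)"
  using subspace_grade[of \<tau>] unfolding component_def subspace_def
  by (auto simp: lin scale_right_distrib mult.commute)

lemma bounded_component: "bounded_dim nb (component a i \<tau>)"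
  by (rule bounded_dim_mono[OF bounded[of i]]) (auto simp: component_def)

lemma hl: "h n (l m v) = l m (h n v) - of_int n *s h (m + n) v"
  using lh[of m n v] by (simp add: algebra_simps)

lemma component_l: "v \<in> component a i \<tau> \<Longrightarrow> l m v \<in> component a (i + m) \<tau>"
  using grade_closed(1)[of v \<tau> m] ll[of 0 m v]
  by (auto simp: component_def hl lin algebra_simps scale_left_distrib)

lemma component_h: "v \<in> component a i \<tau> \<Longrightarrow> h m v \<in> component a (i + m) \<tau>"
  using grade_closed(2)[of v \<tau> m] lh[of 0 m v]
  by (auto simp: component_def hh[of 0] lin algebra_simps scale_left_distrib)

lemma component_gp: "v \<in> component a i \<tau> \<Longrightarrow> gp m v \<in> component (a + 1) (i + m) (\<tau> + 1)"
  using grade_closed(3)[of v \<tau> m] lgp[of 0 m v] hgp[of 0 m v]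
  by (auto simp: component_def lin algebra_simps scale_left_distrib)

lemma component_gm: "v \<in> component a i \<tau> \<Longrightarrow> gm m v \<in> component (a - 1) (i + m) (\<tau> + 1)"
  using grade_closed(4)[of v \<tau> m] lgm[of 0 m v] hgm[of 0 m v]
  by (auto simp: component_def lin algebra_simps scale_left_distrib)

lemma component_h_funpow: "v \<in> component a i \<tau> \<Longrightarrow> (h m ^^ k) v \<in> component a (i + of_nat k * m) \<tau>"
proof (induction k)
  case (Suc k)
  then show ?case using component_h[OF Suc.IH, of m] by (simp add: algebra_simps)
qed simp

lemma component_l_funpow: "v \<in> component a i \<tau> \<Longrightarrow> (l m ^^ k) v \<in> component a (i + of_nat k * m) \<tau>"
proof (induction k)
  case (Suc k)
  then show ?case using component_l[OF Suc.IH, of m] by (simp add: algebra_simps)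
qed simp

text \<open>On a component of charge \<open>a \<noteq> 0\<close> the operators \<open>h m\<close> and \<open>l (- m)\<close> generate a Weyl algebra.\<close>

lemma h_l_power:
  assumes "v \<in> component a i \<tau>" "h m v = 0"
  shows "h m ((l (- m) ^^ Suc k) v) = (- (of_nat (Suc k) * of_int m * a)) *s (l (- m) ^^ k) v"
proof (induction k)
  case 0
  then show ?case using assms by (simp add: hl lin componentD(2))
next
  case (Suc k)
  have component: "(l (- m) ^^ Suc k) v \<in> component a (i + of_nat (Suc k) * - m) \<tau>" by (rule component_l_funpow[OF assms(1)])
  have "h m ((l (- m) ^^ Suc (Suc k)) v) = l (- m) (h m ((l (- m) ^^ Suc k) v)) - (of_int m * a) *s (l (- m) ^^ Suc k) v"
    using componentD(2)[OF component] by (simp add: hl)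
  also have "\<dots> = (- (of_nat (Suc k) * of_int m * a) - of_int m * a) *s (l (- m) ^^ Suc k) v"
    unfolding Suc by (simp only: lin funpow.simps o_apply scale_left_diff_distrib)
  also have "- (of_nat (Suc k) * of_int m * a) - of_int m * a = - (of_nat (Suc (Suc k)) * of_int m * a)"
    by (simp add: algebra_simps)
  finally show ?case .
qed

lemma h_power_l_power:
  assumes "v \<in> component a i \<tau>" "h m v = 0" "a \<noteq> 0" "m \<noteq> 0"
  shows "\<exists>c. c \<noteq> 0 \<and> (h m ^^ k) ((l (- m) ^^ k) v) = c *s v"
proof (induction k)
  case (Suc k)
  then obtain c where c: "c \<noteq> 0" "(h m ^^ k) ((l (- m) ^^ k) v) = c *s v" by blast
  let ?d = "- (of_nat (Suc k) * of_int m * a)"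
  have "(h m ^^ Suc k) ((l (- m) ^^ Suc k) v) = (h m ^^ k) (h m ((l (- m) ^^ Suc k) v))"
    by (simp only: funpow_Suc_right o_def)
  also have "\<dots> = (h m ^^ k) (?d *s (l (- m) ^^ k) v)" by (simp only: h_l_power[OF assms(1,2)])
  also have "\<dots> = (?d * c) *s v" by (simp only: c(2) endo_UNIV_simps(2)[OF endo_funpow[OF endo(2)]] scale_scale)
  finally show ?case using c(1) assms(3,4) by (intro exI[of _ "?d * c"]) (simp del: of_nat_Suc)
qed (auto intro: exI[of _ 1])

lemma h_power_l_power_zero:
  assumes "v \<in> component a i \<tau>" "h m v = 0" "a \<noteq> 0" "m \<noteq> 0" "k < j"
  shows "(h m ^^ j) ((l (- m) ^^ k) v) = 0"
proof -
  obtain c where c: "(h m ^^ k) ((l (- m) ^^ k) v) = c *s v"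
    using h_power_l_power[OF assms(1-4)] by blast
  obtain d where d: "j = d + Suc k" using less_imp_Suc_add[OF assms(5)] by (auto simp: add.commute)
  have "(h m ^^ j) ((l (- m) ^^ k) v) = (h m ^^ d) (h m ((h m ^^ k) ((l (- m) ^^ k) v)))"
    unfolding d funpow_add by simp
  then show ?thesis using assms(2) endo_UNIV_simps(3)[OF endo_funpow[OF endo(2)]] by (simp add: c lin)
qed

text \<open>Kernel vectors of \<open>nb + 1\<close> different weights are moved to the one with
  smallest index by powers of \<open>l (- m)\<close>. By the Weyl relation, \<open>e\<close>
  applications of \<open>h m\<close> undo \<open>l (- m) ^^ e\<close> up to a nonzero factor and
  kill all smaller powers, so the moved vectors would be independent.\<close>

lemma finite_kernel_weights:
  assumes "a \<noteq> 0" "m \<noteq> 0"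
  shows "finite {k::int. \<exists>v\<in>component a (i + m * k) \<tau>. v \<noteq> 0 \<and> h m v = 0}" (is "finite ?K")
proof (rule ccontr)
  define K where "K = ?K"
  assume "infinite ?K"
  then have "infinite K" by (simp add: K_def)
  then obtain F where F: "F \<subseteq> K" "finite F" "card F = Suc nb"
    using infinite_arbitrarily_large[of K "Suc nb"] by auto
  then have "\<forall>k\<in>F. \<exists>v. v \<in> component a (i + m * k) \<tau> \<and> v \<noteq> 0 \<and> h m v = 0" by (auto simp: K_def)
  then obtain w where w: "\<And>k. k \<in> F \<Longrightarrow> w k \<in> component a (i + m * k) \<tau>" "\<And>k. k \<in> F \<Longrightarrow> w k \<noteq> 0"
    "\<And>k. k \<in> F \<Longrightarrow> h m (w k) = 0" by metis
  let ?e = "\<lambda>k. nat (k - Min F)"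
  define u where "u k = (l (- m) ^^ ?e k) (w k)" for k
  have le: "Min F \<le> k" if "k \<in> F" for k using that F by simp
  have uS: "u k \<in> component a (i + m * Min F) \<tau>" if "k \<in> F" for k
    using component_l_funpow[OF w(1)[OF that], where m="- m" and k="?e k"] le[OF that] by (simp add: u_def algebra_simps)
  obtain c where c: "\<exists>k\<in>F. c k \<noteq> 0" "(\<Sum>k\<in>F. c k *s u k) = 0"
    using bounded_dim_relation[OF bounded_component F(2), of u a "i + m * Min F" \<tau>] uS F(3) by auto
  let ?G = "{k\<in>F. c k \<noteq> 0}"
  define k where "k = Max ?G"
  have "?G \<noteq> {}" "finite ?G" using c F by auto
  then have k: "k \<in> F" "c k \<noteq> 0" "\<And>j. j \<in> F \<Longrightarrow> k < j \<Longrightarrow> c j = 0"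
    using Max_in[of ?G] Max_ge[of ?G] unfolding k_def by (blast, blast, force)
  let ?T = "h m ^^ ?e k"
  have "0 = ?T (\<Sum>j\<in>F. c j *s u j)" unfolding c(2) by (simp add: endo_UNIV_simps(3)[OF endo_funpow[OF endo(2)]])
  also have "\<dots> = (\<Sum>j\<in>F. c j *s ?T (u j))" by (rule endo_UNIV_sum[OF endo_funpow[OF endo(2)] F(2)])
  also have "\<dots> = (\<Sum>j\<in>F. if j = k then c k *s ?T (u k) else 0)"
  proof (rule sum.cong)
    fix j assume j: "j \<in> F"
    show "c j *s ?T (u j) = (if j = k then c k *s ?T (u k) else 0)"
    proof (cases "j < k")
      case True
      then have "?e j < ?e k" using le[OF j] by simp
      then have "?T (u j) = 0" unfolding u_def
        using h_power_l_power_zero[OF w(1)[OF j] w(3)[OF j] assms] by blast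
      then show ?thesis using True by simp
    next
      case False
      then show ?thesis using k(3)[OF j] by auto
    qed
  qed simp
  also have "\<dots> = c k *s ?T (u k)" using F(2) k(1) by simp
  finally have "?T (u k) = 0" using k(2) by simp
  then show False unfolding u_def
    using h_power_l_power[OF w(1)[OF k(1)] w(3)[OF k(1)] assms, of "?e k"] w(2)[OF k(1)] by auto
qed

text \<open>If \<open>h m v = 0\<close> for some \<open>v \<noteq> 0\<close>, then some \<open>z \<noteq> 0\<close> is killed by all \<open>h (m * j)\<close> with \<open>j \<noteq> 0\<close>, because the
  kernel of \<open>h m\<close> lives in finitely many weights. The vectors \<open>l (- m * q) (l (m * q) z)\<close>, \<open>q > 0\<close>, of the
  same weight are then linearly independent.\<close>

lemma h_injective:
  assumes "a \<noteq> 0" "v \<in> component a i \<tau>" "h m v = 0"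
  shows "v = 0"
proof (cases "m = 0")
  case True
  then show ?thesis using assms componentD(2)[OF assms(2)] by simp
next
  case m: False
  show ?thesis
  proof (rule ccontr)
    assume v: "v \<noteq> 0"
    define K where "K = {k::int. \<exists>v\<in>component a (i + m * k) \<tau>. v \<noteq> 0 \<and> h m v = 0}"
    have K: "finite K" unfolding K_def by (rule finite_kernel_weights[OF assms(1) m])
    have "0 \<in> K" using v assms by (auto simp: K_def)
    then have "Max K \<in> K" using K by (intro Max_in) auto
    then obtain w where w: "w \<in> component a (i + m * Max K) \<tau>" "w \<noteq> 0" "h m w = 0" by (auto simp: K_def)
    \<comment> \<open>The \<open>h\<close> commute, so \<open>h (m * j)\<close> preserves the kernel
      of \<open>h m\<close>. At an extremal index its values must vanish: here at the top for
      \<open>j > 0\<close>, below at the bottom of \<open>K'\<close> for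
      \<open>j < 0\<close>.\<close>
    have wpos: "h (m * j) w = 0" if "j > 0" for j
    proof (rule ccontr)
      assume "h (m * j) w \<noteq> 0"
      moreover have "h (m * j) w \<in> component a (i + m * (Max K + j)) \<tau>" using component_h[OF w(1), of "m * j"] by (simp add: algebra_simps)
      moreover have "h m (h (m * j) w) = 0" using hh[of m "m * j" w] w(3) by (simp add: lin)
      ultimately have "Max K + j \<in> K" by (auto simp: K_def)
      then show False using Max_ge[OF K] that by fastforce
    qed
    define K' where "K' = {k::int. \<exists>v\<in>component a (i + m * k) \<tau>. v \<noteq> 0 \<and> (\<forall>j>0. h (m * j) v = 0)}"
    have "K' \<subseteq> K"
    proof
      fix k assume "k \<in> K'"
      then obtain v where "v \<in> component a (i + m * k) \<tau>" "v \<noteq> 0" "\<And>j. j > 0 \<Longrightarrow> h (m * j) v = 0" by (auto simp: K'_def)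
      moreover from this(3)[of 1] have "h m v = 0" by simp
      ultimately show "k \<in> K" by (auto simp: K_def)
    qed
    then have K': "finite K'" using K finite_subset by blast
    have "Max K \<in> K'" using w wpos by (auto simp: K'_def)
    then have "Min K' \<in> K'" using K' by (intro Min_in) auto
    then obtain z where z: "z \<in> component a (i + m * Min K') \<tau>" "z \<noteq> 0" "\<And>j. j > 0 \<Longrightarrow> h (m * j) z = 0"
      by (auto simp: K'_def)
    have zneg: "h (m * j) z = 0" if "j < 0" for j
    proof (rule ccontr)
      assume "h (m * j) z \<noteq> 0"
      moreover have "h (m * j) z \<in> component a (i + m * (Min K' + j)) \<tau>" using component_h[OF z(1), of "m * j"] by (simp add: algebra_simps)
      moreover have "h (m * j') (h (m * j) z) = 0" if "j' > 0" for j'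
        using hh[of "m * j'" "m * j" z] z(3)[OF that] by (simp add: lin)
      ultimately have "Min K' + j \<in> K'" by (auto simp: K'_def)
      then show False using Min_le[OF K'] that by fastforce
    qed
    have z0: "h (m * j) z = 0" if "j \<noteq> 0" for j using z(3)[of j] zneg[of j] that by (cases "j > 0") auto
    \<comment> \<open>As \<open>z\<close> is killed by \<open>h (m * j)\<close> for
      \<open>j \<noteq> 0\<close>, each \<open>h\<close> has to be absorbed by an \<open>l\<close>
      of opposite index, leaving \<open>h 0\<close>, that is \<open>a\<close>. This needs
      \<open>p = q\<close>, so these operators separate the vectors \<open>?u q\<close>.\<close>
    have pair: "h (m * p) (h (- (m * p)) (l (- (m * q)) (l (m * q) z)))
        = (if p = q then - ((of_int (m * p) * a) ^ 2) else 0) *s z" if "p > 0" "q > 0" for p q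
    proof -
      have z0': "h (- (m * p)) z = 0" "h (- (m * q)) z = 0" "h (m * p) z = 0" "h (m * q) z = 0"
        using z0[of "- p"] z0[of "- q"] z0[of p] z0[of q] that by auto
      have pq: "h (m * q - m * p) z = (if p = q then a else 0) *s z"
        using z0[of "q - p"] componentD(2)[OF z(1)] by (auto simp: algebra_simps)
      have "h (- (m * p) - m * q) (l (m * q) z) = 0"
        using z0' z0[of "- p - q"] that by (simp add: hl lin algebra_simps)
      then have "h (- (m * p)) (l (- (m * q)) (l (m * q) z)) = (if p = q then of_int (m * p) * a else 0) *s l (- (m * q)) z"
        using z0' pq by (simp add: hl lin algebra_simps)
      then have *: "h (m * p) (h (- (m * p)) (l (- (m * q)) (l (m * q) z)))
        = (if p = q then of_int (m * p) * a else 0) *s h (m * p) (l (- (m * q)) z)" by (simp add: lin)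
      show ?thesis
      proof (cases "p = q")
        case True
        then show ?thesis unfolding * using z0' componentD(2)[OF z(1)] by (simp add: hl lin power2_eq_square algebra_simps)
      qed (simp add: *)
    qed
    let ?F = "{1..int nb + 1}" let ?u = "\<lambda>q. l (- (m * q)) (l (m * q) z)"
    have uS: "?u q \<in> component a (i + m * Min K') \<tau>" for q
      using component_l[OF component_l[OF z(1), of "m * q"], of "- (m * q)"] by simp
    have "nb < card ?F" by simp
    then obtain c where c: "\<exists>q\<in>?F. c q \<noteq> 0" "(\<Sum>q\<in>?F. c q *s ?u q) = 0"
      using bounded_dim_relation[OF bounded_component, of ?F ?u a "i + m * Min K'" \<tau>] uS by auto
    then obtain p where p: "p \<in> ?F" "c p \<noteq> 0" by blast
    let ?T = "\<lambda>x. h (m * p) (h (- (m * p)) x)"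
    have "0 = ?T (\<Sum>q\<in>?F. c q *s ?u q)" unfolding c(2) by (simp add: lin)
    also have "\<dots> = (\<Sum>q\<in>?F. c q *s ?T (?u q))" by (rule endo_UNIV_sum[OF endo_comp[OF endo(2) endo(2)]]) simp
    also have "\<dots> = (\<Sum>q\<in>?F. if q = p then c p *s (- ((of_int (m * p) * a) ^ 2)) *s z else 0)"
      by (rule sum.cong) (use p in \<open>auto simp: pair\<close>)
    also have "\<dots> = c p *s (- ((of_int (m * p) * a) ^ 2)) *s z" using p by simp
    finally show False using p z(2) assms(1) m by simp
  qed
qed

text \<open>Dimension arguments apply to endomorphisms of one component, hence the product
  \<open>h m h (- m)\<close>; a preimage under it gives one under \<open>h m\<close>.\<close>

lemma h_surjective:
  assumes "a \<noteq> 0" "w \<in> component a (i + m) \<tau>"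
  obtains v where "v \<in> component a i \<tau>" "h m v = w"
proof -
  let ?T = "\<lambda>x. h m (h (- m) x)"
  have E: "endo_on (component a (i + m) \<tau>) ?T"
  proof (rule endo_on_subset[OF endo_comp[OF endo(2) endo(2)]])
    show "?T y \<in> component a (i + m) \<tau>" if "y \<in> component a (i + m) \<tau>" for y
      using component_h[OF component_h[OF that, of "- m"], of m] by simp
  qed simp
  obtain x where x: "x \<in> component a (i + m) \<tau>" "?T x = w"
  proof (rule injective_imp_surjective[OF bounded_component subspace_component E _ assms(2)])
    fix x assume x: "x \<in> component a (i + m) \<tau>" "?T x = 0"
    have "h (- m) x = 0" using h_injective[OF assms(1) component_h[OF x(1)] x(2)] .
    then show "x = 0" using h_injective[OF assms(1) x(1)] by blast
  qed blast
  show ?thesis using that[of "h (- m) x"] component_h[OF x(1), of "- m"] x(2) by simp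
qed

lemma component_nonzero_all_weights:
  assumes "a \<noteq> 0" "v \<in> component a i \<tau>" "v \<noteq> 0"
  shows "\<exists>w\<in>component a j \<tau>. w \<noteq> 0"
  using component_h[OF assms(2), of "j - i"] h_injective[OF assms(1,2), of "j - i"] assms(3) by auto

lemma finite_nonzero_charges: "finite {b. b \<noteq> 0 \<and> (\<exists>i \<tau>. \<exists>v\<in>component b i \<tau>. v \<noteq> 0)}"
proof (rule ccontr)
  define K where "K = {b. b \<noteq> 0 \<and> (\<exists>i \<tau>. \<exists>v\<in>component b i \<tau>. v \<noteq> 0)}"
  assume "infinite {b. b \<noteq> 0 \<and> (\<exists>i \<tau>. \<exists>v\<in>component b i \<tau>. v \<noteq> 0)}"
  then have "infinite K" by (simp add: K_def)
  then obtain F where F: "F \<subseteq> K" "finite F" "card F = Suc nb"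
    using infinite_arbitrarily_large[of K "Suc nb"] by auto
  have "\<exists>v. (\<exists>\<tau>. v \<in> component b 0 \<tau>) \<and> v \<noteq> 0" if "b \<in> F" for b
  proof -
    have "b \<in> K" using that F(1) by blast
    then obtain i \<tau> v where "b \<noteq> 0" "v \<in> component b i \<tau>" "v \<noteq> 0" by (auto simp: K_def)
    then show ?thesis using component_nonzero_all_weights[of b v i \<tau> 0] by blast
  qed
  then obtain w where w: "\<And>b. b \<in> F \<Longrightarrow> \<exists>\<tau>. w b \<in> component b 0 \<tau>" "\<And>b. b \<in> F \<Longrightarrow> w b \<noteq> 0" by metis
  have w0: "w b \<in> {v. l 0 v = (\<mu> + of_int 0) *s v}" if "b \<in> F" for b using w(1)[OF that] componentD(3) by blast
  obtain c where c: "\<exists>b\<in>F. c b \<noteq> 0" "(\<Sum>b\<in>F. c b *s w b) = 0"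
    using bounded_dim_relation[OF bounded[of 0] F(2), of w] w0 F(3) by auto
  then obtain b where b: "b \<in> F" "c b \<noteq> 0" by blast
  have "h 0 (c b *s w b) = b *s (c b *s w b)" if "b \<in> F" for b
    using w(1)[OF that] componentD(2) by (auto simp: lin mult.commute)
  then have "c b *s w b = 0"
    using independent_eigenvectors_sum[OF endo(2)[of 0] subspace_UNIV F(2), of id "\<lambda>b. c b *s w b" b] c(2) b(1) by auto
  then show False using b w(2) by simp
qed

section \<open>Generation from a singular component\<close>

text \<open>\<open>W\<close> is a parameter because generation is used three times: for the whole
  component of highest charge, for its stable subfamilies, and for hypothetical vectors of charge
  \<open>a - 1\<close> killed by all \<open>gp\<close>. The index \<open>i\<close> is the weight
  reached, not the weight at the start.\<close>

primrec gm_words :: "(int \<Rightarrow> 'v set) \<Rightarrow> nat \<Rightarrow> int \<Rightarrow> 'v set" where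
  "gm_words W 0 i = W i"
| "gm_words W (Suc k) i = span (\<Union>q. gm q ` gm_words W k (i - q))"

lemma gm_words_gm: "y \<in> gm_words W k j \<Longrightarrow> gm q y \<in> gm_words W (Suc k) (j + q)"
  by (auto intro!: span_base exI[of _ q])

lemma gm_words_gm_eq: "y \<in> gm_words W k j \<Longrightarrow> j + q = i \<Longrightarrow> gm q y \<in> gm_words W (Suc k) i"
  using gm_words_gm by blast

context
  fixes W :: "int \<Rightarrow> 'v set" and a :: complex and \<tau> :: bit
  assumes W_sub: "\<And>i. subspace (W i)" and W_component: "\<And>i. W i \<subseteq> component a i \<tau>"
    and W_l: "\<And>i m w. w \<in> W i \<Longrightarrow> l m w \<in> W (i + m)"
    and W_h: "\<And>i m w. w \<in> W i \<Longrightarrow> h m w \<in> W (i + m)"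
    and W_gp: "\<And>i m w. w \<in> W i \<Longrightarrow> gp m w = 0"
    and W_ne: "\<exists>i. \<exists>w\<in>W i. w \<noteq> 0"
begin

lemma subspace_gm_words: "subspace (gm_words W k i)"
  by (cases k) (auto simp: W_sub)

lemma gm_words_component: "gm_words W k i \<subseteq> component (a - of_nat k) i (\<tau> + of_nat k)"
proof (induction k arbitrary: i)
  case (Suc k)
  show ?case unfolding gm_words.simps
  proof (rule span_minimal[OF _ subspace_component], safe)
    fix q y assume "y \<in> gm_words W k (i - q)"
    then have "y \<in> component (a - of_nat k) (i - q) (\<tau> + of_nat k)" using Suc by blast
    from component_gm[OF this, of q] show "gm q y \<in> component (a - of_nat (Suc k)) i (\<tau> + of_nat (Suc k))"
      by (simp add: algebra_simps)
  qed
qed (simp only: gm_words.simps of_nat_0 diff_zero add_0_right W_component)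

lemma gm_words_l: "y \<in> gm_words W k i \<Longrightarrow> l m y \<in> gm_words W k (i + m)"
proof (induction k arbitrary: i y)
  case (Suc k)
  note sub = subspace_gm_words[of "Suc k" "i + m"]
  show ?case
  proof (rule endo_span[OF endo(1) sub _ Suc.prems[unfolded gm_words.simps]])
    fix x assume "x \<in> (\<Union>q. gm q ` gm_words W k (i - q))"
    then obtain q y where y: "y \<in> gm_words W k (i - q)" "x = gm q y" by blast
    have "l m x = gm q (l m y) + (of_int q - of_int m / 2) *s gm (q + m) y"
      using lgm[of m q y] y(2) by (simp add: algebra_simps)
    moreover have "gm q (l m y) \<in> gm_words W (Suc k) (i + m)"
      by (rule gm_words_gm_eq[OF Suc.IH[OF y(1)]]) simp
    moreover have "gm (q + m) y \<in> gm_words W (Suc k) (i + m)"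
      by (rule gm_words_gm_eq[OF y(1)]) simp
    ultimately show "l m x \<in> gm_words W (Suc k) (i + m)"
      using subspace_add[OF sub] subspace_scale[OF sub] by metis
  qed
qed (simp add: W_l)

lemma gm_words_h: "y \<in> gm_words W k i \<Longrightarrow> h m y \<in> gm_words W k (i + m)"
proof (induction k arbitrary: i y)
  case (Suc k)
  note sub = subspace_gm_words[of "Suc k" "i + m"]
  show ?case
  proof (rule endo_span[OF endo(2) sub _ Suc.prems[unfolded gm_words.simps]])
    fix x assume "x \<in> (\<Union>q. gm q ` gm_words W k (i - q))"
    then obtain q y where y: "y \<in> gm_words W k (i - q)" "x = gm q y" by blast
    have "h m x = gm q (h m y) - gm (m + q) y"
      using hgm[of m q y] y(2) by (simp add: algebra_simps)
    moreover have "gm q (h m y) \<in> gm_words W (Suc k) (i + m)"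
      by (rule gm_words_gm_eq[OF Suc.IH[OF y(1)]]) simp
    moreover have "gm (m + q) y \<in> gm_words W (Suc k) (i + m)"
      by (rule gm_words_gm_eq[OF y(1)]) simp
    ultimately show "h m x \<in> gm_words W (Suc k) (i + m)"
      using subspace_diff[OF sub] by metis
  qed
qed (simp add: W_h)

text \<open>Moving \<open>gp p\<close> past \<open>gm q\<close> leaves \<open>l (p + q)\<close> and
  \<open>h (p + q)\<close>, which preserve the word length, and \<open>gp p\<close> on a shorter
  word. Since \<open>gp\<close> kills \<open>W\<close>, it shortens words by one, and the words span
  a submodule.\<close>

lemma gm_words_gp: "y \<in> gm_words W (Suc k) i \<Longrightarrow> gp p y \<in> gm_words W k (i + p)"
proof (induction k arbitrary: i y)
  case (0 i y)
  note sub = subspace_gm_words[of 0 "i + p"]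
  show ?case
  proof (rule endo_span[OF endo(3) sub _ 0[unfolded gm_words.simps]])
    fix x assume "x \<in> (\<Union>q. gm q ` W (i - q))"
    then obtain q y where y: "y \<in> W (i - q)" "x = gm q y" by blast
    have "gp p x = (- 2) *s l (p + q) y + of_int (p - q) *s h (p + q) y"
      using gpgm[of p q y] y W_gp by (simp add: lin)
    moreover have "l (p + q) y \<in> gm_words W 0 (i + p)" "h (p + q) y \<in> gm_words W 0 (i + p)"
      using W_l[OF y(1), of "p + q"] W_h[OF y(1), of "p + q"] by (simp_all add: algebra_simps)
    ultimately show "gp p x \<in> gm_words W 0 (i + p)"
      using subspace_add[OF sub] subspace_scale[OF sub] by metis
  qed
next
  case (Suc k i y)
  note sub = subspace_gm_words[of "Suc k" "i + p"]
  show ?case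
  proof (rule endo_span[OF endo(3) sub _ Suc.prems[unfolded gm_words.simps(2)[of W "Suc k"]]])
    fix x assume "x \<in> (\<Union>q. gm q ` gm_words W (Suc k) (i - q))"
    then obtain q y where y: "y \<in> gm_words W (Suc k) (i - q)" "x = gm q y" by blast
    have "gp p x = ((- 2) *s l (p + q) y + of_int (p - q) *s h (p + q) y) - gm q (gp p y)"
      using gpgm[of p q y] y(2) by (simp add: algebra_simps)
    moreover have "l (p + q) y \<in> gm_words W (Suc k) (i + p)" "h (p + q) y \<in> gm_words W (Suc k) (i + p)"
      using gm_words_l[OF y(1), of "p + q"] gm_words_h[OF y(1), of "p + q"] by (simp_all add: algebra_simps)
    moreover have "gm q (gp p y) \<in> gm_words W (Suc k) (i + p)"
      by (rule gm_words_gm_eq[OF Suc.IH[OF y(1)]]) simp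
    ultimately show "gp p x \<in> gm_words W (Suc k) (i + p)"
      using subspace_add[OF sub] subspace_scale[OF sub] subspace_diff[OF sub] by metis
  qed
qed

lemma span_gm_words: "span (\<Union>k. \<Union>i. gm_words W k i) = UNIV" (is "span ?G = UNIV")
proof -
  have sub: "subspace (span ?G)" by simp
  have inc: "y \<in> gm_words W k i \<Longrightarrow> y \<in> span ?G" for y k i by (rule span_base) blast
  obtain i w where w: "w \<in> W i" "w \<noteq> 0" using W_ne by blast
  show ?thesis
  proof (rule simple[OF sub])
    fix m y assume y: "y \<in> span ?G"
    show "l m y \<in> span ?G"
      by (rule endo_span[OF endo(1) sub _ y]) (use gm_words_l inc in blast)
    show "h m y \<in> span ?G"
      by (rule endo_span[OF endo(2) sub _ y]) (use gm_words_h inc in blast)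
    show "gm m y \<in> span ?G"
      by (rule endo_span[OF endo(4) sub _ y]) (use gm_words_gm inc in blast)
    show "gp m y \<in> span ?G"
    proof (rule endo_span[OF endo(3) sub _ y])
      fix x assume "x \<in> ?G"
      then obtain k i where x: "x \<in> gm_words W k i" by blast
      show "gp m x \<in> span ?G"
      proof (cases k)
        case 0
        then show ?thesis using x W_gp subspace_0[OF sub] by simp
      next
        case (Suc k')
        then show ?thesis using x gm_words_gp inc by blast
      qed
    qed
  next
    have "x \<in> span ?G \<inter> grade 0 \<union> span ?G \<inter> grade 1" if "x \<in> ?G" for x
    proof -
      obtain k i where x: "x \<in> gm_words W k i" using \<open>x \<in> ?G\<close> by blast
      then have "x \<in> grade (\<tau> + of_nat k)" using gm_words_component componentD(1) by blast
      moreover have "\<tau> + of_nat k = 0 \<or> \<tau> + of_nat k = 1" by (metis bit_not_one_iff)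
      ultimately show ?thesis using inc[OF x] by auto
    qed
    then show "span ?G \<subseteq> span (span ?G \<inter> grade 0 \<union> span ?G \<inter> grade 1)"
      by (intro span_mono) blast
  next
    show "w \<in> span ?G" using inc[of w 0 i] w by simp
    show "w \<noteq> 0" by (rule w)
  qed
qed

text \<open>Words of length \<open>k\<close> have charge \<open>a - k\<close>, so comparing
  eigenvalues of \<open>h 0\<close> and then of \<open>l 0\<close> selects one length and one
  weight.\<close>

lemma gm_words_charge:
  assumes "x \<in> component b j \<sigma>" "x \<noteq> 0"
  shows "\<exists>k. b = a - of_nat k \<and> x \<in> gm_words W k j"
proof -
  define Z where "Z k = span (\<Union>i. gm_words W k i)" for k
  have "h 0 y - (a - of_nat k) *s y \<in> {0}" if "y \<in> Z k" for y k
  proof (rule endo_span[where T="\<lambda>y. h 0 y - (a - of_nat k) *s y"])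
    show "endo_on UNIV (\<lambda>y. h 0 y - (a - of_nat k) *s y)"
      by (simp add: endo_on_def lin scale_right_distrib scale_right_diff_distrib mult.commute)
    show "x \<in> (\<Union>i. gm_words W k i) \<Longrightarrow> h 0 x - (a - of_nat k) *s x \<in> {0}" for x
      using gm_words_component componentD(2) by fastforce
  qed (use that in \<open>simp_all add: Z_def\<close>)
  then have Zh: "h 0 y = (a - of_nat k) *s y" if "y \<in> Z k" for y k using that by force
  have "(\<Union>k. \<Union>i. gm_words W k i) \<subseteq> span (\<Union>k. Z k)"
    unfolding Z_def by (auto intro!: span_base exI)
  then have "span (\<Union>k. \<Union>i. gm_words W k i) \<subseteq> span (\<Union>k. Z k)"
    by (rule span_minimal[OF _ subspace_span])
  then have "span (\<Union>k. Z k) = UNIV" unfolding span_gm_words by blast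
  then have "x = 0 \<or> (\<exists>k\<in>UNIV. a - of_nat k = b \<and> x \<in> Z k)"
    using assms(1) Zh by (intro eigen_component[OF endo(2)[of 0]]) (auto simp: Z_def component_def inj_on_def)
  then obtain k where k: "b = a - of_nat k" "x \<in> Z k" using assms(2) by auto
  have "x = 0 \<or> (\<exists>i\<in>UNIV. \<mu> + of_int i = \<mu> + of_int j \<and> x \<in> gm_words W k i)"
    using k(2) assms(1) gm_words_component[of k]
    by (intro eigen_component[OF endo(1)[of 0]]) (auto simp: Z_def component_def inj_on_def subspace_gm_words)
  then show ?thesis using k assms(2) by auto
qed

lemma gm_words_weight:
  assumes "l 0 x = (\<mu> + of_int j) *s x"
  shows "x \<in> span (\<Union>k. gm_words W k j)"
proof (cases "x = 0")
  case False
  define Z where "Z i = span (\<Union>k. gm_words W k i)" for i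
  have "l 0 y - (\<mu> + of_int i) *s y \<in> {0}" if "y \<in> Z i" for y i
  proof (rule endo_span[where T="\<lambda>y. l 0 y - (\<mu> + of_int i) *s y"])
    show "endo_on UNIV (\<lambda>y. l 0 y - (\<mu> + of_int i) *s y)"
      by (simp add: endo_on_def lin scale_right_distrib scale_right_diff_distrib mult.commute)
    show "x \<in> (\<Union>k. gm_words W k i) \<Longrightarrow> l 0 x - (\<mu> + of_int i) *s x \<in> {0}" for x
      using gm_words_component componentD(3) by fastforce
  qed (use that in \<open>simp_all add: Z_def\<close>)
  then have Zl: "l 0 y = (\<mu> + of_int i) *s y" if "y \<in> Z i" for y i using that by force
  have "(\<Union>k. \<Union>i. gm_words W k i) \<subseteq> span (\<Union>i. Z i)"
    unfolding Z_def by (auto intro!: span_base exI)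
  then have "span (\<Union>k. \<Union>i. gm_words W k i) \<subseteq> span (\<Union>i. Z i)"
    by (rule span_minimal[OF _ subspace_span])
  then have "span (\<Union>i. Z i) = UNIV" unfolding span_gm_words by blast
  then have "x = 0 \<or> (\<exists>i\<in>UNIV. \<mu> + of_int i = \<mu> + of_int j \<and> x \<in> Z i)"
    using assms Zl by (intro eigen_component[OF endo(1)[of 0]]) (auto simp: Z_def inj_on_def)
  then show ?thesis using False by (auto simp: Z_def)
qed (simp add: span_zero)

end
end

section \<open>The component of highest charge\<close>

locale highest_charge = ramond_operators scale l h gp gm grade \<mu> nb
  for scale :: "complex \<Rightarrow> 'v::ab_group_add \<Rightarrow> 'v" (infixr "*s" 75) and l h gp gm grade \<mu> nb +
  fixes a :: complex and \<tau> :: bit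
  assumes a_nonzero: "a \<noteq> 0"
    and highest: "v \<in> component a i \<tau> \<Longrightarrow> gp m v = 0"
    and nontrivial: "\<exists>i. \<exists>v\<in>component a i \<tau>. v \<noteq> 0"
begin

abbreviation W :: "int \<Rightarrow> 'v set" where "W i \<equiv> component a i \<tau>"

text \<open>The subfamily generates the whole module by words in \<open>gm\<close>, but only the
  empty word stays in charge \<open>a\<close>.\<close>

lemma W_simple:
  assumes "\<And>i. subspace (X i)" "\<And>i. X i \<subseteq> W i"
    "\<And>i m w. w \<in> X i \<Longrightarrow> l m w \<in> X (i + m)" "\<And>i m w. w \<in> X i \<Longrightarrow> h m w \<in> X (i + m)"
    "w0 \<in> X i0" "w0 \<noteq> 0"
  shows "X i = W i"
proof
  show "W i \<subseteq> X i"
  proof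
    fix x assume x: "x \<in> W i"
    show "x \<in> X i"
    proof (cases "x = 0")
      case True
      then show ?thesis using subspace_0 assms(1) by blast
    next
      case False
      have "\<exists>k. a = a - of_nat k \<and> x \<in> gm_words X k i"
        by (rule gm_words_charge[where W=X and \<tau>=\<tau>, OF assms(1-4)])
          (use assms highest x False in blast)+
      then show ?thesis by auto
    qed
  qed
qed (rule assms(2))

lemma W_inj: "v \<in> W i \<Longrightarrow> w \<in> W i \<Longrightarrow> h m v = h m w \<Longrightarrow> v = w"
  using h_injective[OF a_nonzero subspace_diff[OF subspace_component]] by (metis lin(9) right_minus_eq)

lemma W_nonzero: "\<not> W i \<subseteq> {0}"
  using nontrivial component_nonzero_all_weights[OF a_nonzero] by blast

section \<open>Integer powers of \<open>h 1\<close> on the component of highest charge\<close>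

text \<open>\<open>h 1\<close> is known to be injective only within a component, so the chosen
  preimage is tied to the weight below that of \<open>w\<close>.\<close>

definition down :: "'v \<Rightarrow> 'v" where
  "down w = (SOME v. h 1 v = w \<and> (\<exists>i. v \<in> W i \<and> w \<in> W (i + 1)))"

lemma down: assumes "w \<in> W i" shows "down w \<in> W (i - 1)" "h 1 (down w) = w"
proof -
  obtain v where "v \<in> W (i - 1)" "h 1 v = w"
    using h_surjective[OF a_nonzero, of w "i - 1" 1 \<tau>] assms by auto
  then have "\<exists>v. h 1 v = w \<and> (\<exists>i. v \<in> W i \<and> w \<in> W (i + 1))"
    using assms by (intro exI[of _ v]) (auto intro: exI[of _ "i - 1"])
  from someI_ex[OF this] obtain j where j: "h 1 (down w) = w" "down w \<in> W j" "w \<in> W (j + 1)"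
    unfolding down_def by blast
  show "h 1 (down w) = w" by (rule j)
  show "down w \<in> W (i - 1)"
  \<comment> \<open>The zero vector has every weight and does not determine the index
    \<open>j\<close> of the choice.\<close>
  proof (cases "w = 0")
    case True
    then have "down w = 0" using h_injective[OF a_nonzero j(2), of 1] j(1) by simp
    then show ?thesis by (simp add: subspace_0[OF subspace_component])
  next
    case False
    have "(\<mu> + of_int i) *s w = (\<mu> + of_int (j + 1)) *s w" by (rule trans[OF componentD(3)[OF assms, symmetric] componentD(3)[OF j(3)]])
    then have "(of_int i :: complex) = of_int (j + 1)" using False by simp
    then have "i = j + 1" by (simp only: of_int_eq_iff)
    then show ?thesis using j by simp
  qed
qed

definition shift :: "int \<Rightarrow> 'v \<Rightarrow> 'v" where
  "shift k = (if 0 \<le> k then h 1 ^^ nat k else down ^^ nat (- k))"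

lemma shift_0: "shift 0 v = v"
  by (simp add: shift_def)

lemma shift_W: "v \<in> W i \<Longrightarrow> shift k v \<in> W (i + k)"
proof -
  assume v: "v \<in> W i"
  have "(down ^^ n) v \<in> W (i - int n)" for n
  proof (induction n)
    case (Suc n)
    then show ?case using down(1)[OF Suc] by (simp add: algebra_simps)
  qed (simp add: v)
  from this[of "nat (- k)"] component_h_funpow[OF v, where m=1 and k="nat k"] show ?thesis
    by (cases "0 \<le> k") (simp_all add: shift_def)
qed

lemma shift_Suc: assumes "v \<in> W i" shows "shift (k + 1) v = h 1 (shift k v)"
proof (cases "0 \<le> k")
  case True
  then have "nat (k + 1) = Suc (nat k)" by simp
  then show ?thesis using True by (simp add: shift_def)
next
  case False
  then have n: "nat (- k) = Suc (nat (- (k + 1)))" by simp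
  have "shift k v = down (shift (k + 1) v)"
    using False n by (auto simp: shift_def)
  then show ?thesis using down(2)[OF shift_W[OF assms, of "k + 1"]] by simp
qed

text \<open>Injectivity of \<open>h 1\<close> on each weight determines such a sequence by its value
  at 0. Identities for \<open>shift k\<close>, also with negative \<open>k\<close>, are thereby
  reduced to one application of \<open>h 1\<close>.\<close>

lemma shift_unique:
  assumes "\<And>k. F k \<in> W (i + k)" "\<And>k. h 1 (F k) = F (k + 1)"
  shows "F k = shift k (F 0)"
proof -
  have F0: "F 0 \<in> W i" using assms(1)[of 0] by simp
  show ?thesis
  proof (induction k rule: int_induct[of _ 0])
    case base
    then show ?case by (simp add: shift_0)
  next
    case (step1 k)
    then show ?case using assms(2)[of k] shift_Suc[OF F0, of k] by simp
  next
    case (step2 k)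
    have "h 1 (F (k - 1)) = h 1 (shift (k - 1) (F 0))"
      using assms(2)[of "k - 1"] shift_Suc[OF F0, of "k - 1"] step2 by simp
    then show ?case by (rule W_inj[OF assms(1) shift_W[OF F0]])
  qed
qed

lemma shift_add: "v \<in> W i \<Longrightarrow> w \<in> W i \<Longrightarrow> shift k (v + w) = shift k v + shift k w"
  using shift_unique[of "\<lambda>k. shift k v + shift k w" i k] subspace_add[OF subspace_component]
  by (simp add: shift_W shift_Suc shift_0 lin)

lemma shift_scale: "v \<in> W i \<Longrightarrow> shift k (c *s v) = c *s shift k v"
  using shift_unique[of "\<lambda>k. c *s shift k v" i k] subspace_scale[OF subspace_component]
  by (simp add: shift_W shift_Suc shift_0 lin)

lemma shift_diff: "v \<in> W i \<Longrightarrow> w \<in> W i \<Longrightarrow> shift k (v - w) = shift k v - shift k w"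
  using shift_unique[of "\<lambda>k. shift k v - shift k w" i k] subspace_diff[OF subspace_component]
  by (simp add: shift_W shift_Suc shift_0 lin)

lemma shift_shift: assumes "v \<in> W i" shows "shift j (shift k v) = shift (j + k) v"
proof -
  have "shift (j + k) v = shift j (shift (0 + k) v)"
  proof (rule shift_unique[of "\<lambda>j. shift (j + k) v" "i + k"])
    show "shift (j + k) v \<in> W (i + k + j)" for j
      using shift_W[OF assms, of "j + k"] by (simp add: algebra_simps)
    show "h 1 (shift (j + k) v) = shift (j + 1 + k) v" for j
      using shift_Suc[OF assms, of "j + k"] by (simp add: algebra_simps)
  qed
  then show ?thesis by simp
qed

lemma h_shift: "v \<in> W i \<Longrightarrow> h m (shift k v) = shift k (h m v)"
  using shift_unique[of "\<lambda>k. h m (shift k v)" "i + m" k] component_h[OF shift_W[of v i], of m] shift_Suc[of v i]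
  by (simp add: shift_0 hh[of 1 m] algebra_simps)

text \<open>The Leibniz rule for \<open>l n\<close> and the \<open>k\<close>-th power of
  \<open>h 1\<close>, using that \<open>[l n, h 1]\<close> is \<open>h (n + 1)\<close>, for negative
  \<open>k\<close> as well.\<close>

lemma l_shift:
  assumes "v \<in> W i"
  shows "l n (shift k v) = shift k (l n v) + of_int k *s shift (k - 1) (h (n + 1) v)"
proof -
  let ?F = "\<lambda>k. l n (shift k v) - of_int k *s shift (k - 1) (h (n + 1) v)"
  have F: "?F k \<in> W (i + n + k)" for k
  proof -
    have "l n (shift k v) \<in> W (i + n + k)" using component_l[OF shift_W[OF assms, of k], of n] by (simp add: algebra_simps)
    moreover have "shift (k - 1) (h (n + 1) v) \<in> W (i + n + k)"
      using shift_W[OF component_h[OF assms, of "n + 1"], of "k - 1"] by (simp add: algebra_simps)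
    ultimately show ?thesis using subspace_diff[OF subspace_component] subspace_scale[OF subspace_component] by blast
  qed
  have "h 1 (?F k) = ?F (k + 1)" for k
  proof -
    have "h 1 (shift (k - 1) (h (n + 1) v)) = shift k (h (n + 1) v)"
      using shift_Suc[OF component_h[OF assms], of "k - 1"] by simp
    moreover have "h (n + 1) (shift k v) = shift k (h (n + 1) v)" by (rule h_shift[OF assms])
    moreover have "shift (1 + k) v = h 1 (shift k v)"
      using shift_Suc[OF assms, of k] by (simp add: add.commute)
    ultimately show ?thesis
      by (simp add: lin hl scale_left_distrib algebra_simps)
  qed
  from shift_unique[of ?F, OF F this, of k] have "?F k = shift k (l n v)" by (simp add: shift_0)
  then show ?thesis by (simp add: algebra_simps)
qed

section \<open>Multiplicativity of \<open>h m\<close> on the component of highest charge\<close>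

text \<open>\<open>T m\<close> is \<open>h m (h 1)\<^sup>-\<^sup>m\<close>. On common eigenvectors Lie's lemma makes the eigenvalue of the commutator
  \<open>[A n, T m]\<close> vanish; \<open>n = - 1\<close> and then \<open>n = 1\<close> give a recurrence for the eigenvalues of \<open>T m\<close>, which is
  broken at \<open>m = 0\<close>, whence the two steps below.\<close>

definition T :: "int \<Rightarrow> 'v \<Rightarrow> 'v" where "T m v = h m (shift (- m) v)"

definition A :: "int \<Rightarrow> 'v \<Rightarrow> 'v" where "A n v = shift (- n) (l n v)"

lemma T_W: "v \<in> W i \<Longrightarrow> T m v \<in> W i"
  using component_h[OF shift_W[of v i "- m"], of m] by (simp add: T_def)

lemma A_W: "v \<in> W i \<Longrightarrow> A n v \<in> W i"
  using shift_W[OF component_l[of v a i \<tau> n], of "- n"] by (simp add: A_def)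

lemma T_endo: "endo_on (W i) (T m)"
  unfolding endo_on_def by (auto simp: T_W) (auto simp: T_def shift_add[of _ i] shift_scale[of _ i] lin)

lemma A_endo: "endo_on (W i) (A m)"
proof -
  have "A m (x + y) = A m x + A m y" "A m (c *s x) = c *s A m x" if "x \<in> W i" "y \<in> W i" for x y c
    unfolding A_def using shift_add[OF component_l[OF that(1)] component_l[OF that(2)]] shift_scale[OF component_l[OF that(1)]]
    by (simp_all add: lin)
  then show ?thesis unfolding endo_on_def using A_W by blast
qed

lemma T_eq: "v \<in> W i \<Longrightarrow> T m v = shift (- m) (h m v)"
  by (simp add: T_def h_shift)

lemma T_comm: "v \<in> W i \<Longrightarrow> T m (T n v) = T n (T m v)"
proof -
  assume v: "v \<in> W i"
  have "T m (T n v) = h m (h n (shift (- (m + n)) v))" for m n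
    using h_shift[OF shift_W[OF v], of n "- m" "- n"] shift_shift[OF v, of "- m" "- n"] by (simp add: T_def)
  from this[of m n] this[of n m] show ?thesis by (simp add: hh[of n m] add.commute)
qed

lemma T_0: "v \<in> W i \<Longrightarrow> T 0 v = a *s v"
  by (simp add: T_def shift_0 componentD(2))

lemma T_1: "v \<in> W i \<Longrightarrow> T 1 v = v"
  using shift_Suc[of v i "-1"] by (simp add: T_def shift_0)

text \<open>The two terms come from commuting \<open>l n\<close> with \<open>h m\<close> and with
  the power of \<open>h 1\<close>. The second is quadratic in the \<open>T\<close>, whereas Lie's
  lemma needs commutators linear in them; it is therefore used for values of \<open>n\<close> at
  which \<open>T (n + 1)\<close> is a known scalar.\<close>

lemma A_T:
  assumes "v \<in> W i"
  shows "A n (T m v) = T m (A n v) + of_int m *s (T (m + n) v - T m (T (n + 1) v))"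
proof -
  note sh = shift_W[OF assms] and hW = component_h[OF assms] and lW = component_l[OF assms]
  have "l n (T m v) = h m (l n (shift (- m) v)) + of_int m *s h (m + n) (shift (- m) v)"
    unfolding T_def using lh[of n m] by (simp add: algebra_simps)
  also have "l n (shift (- m) v) = shift (- m) (l n v) - of_int m *s shift (- m - 1) (h (n + 1) v)"
    using l_shift[OF assms, of n "- m"] by simp
  finally have e: "l n (T m v) = h m (shift (- m) (l n v)) - of_int m *s h m (shift (- m - 1) (h (n + 1) v))
      + of_int m *s h (m + n) (shift (- m) v)" by (simp add: lin)
  have w1: "h m (shift (- m) (l n v)) \<in> W (i + n)"
    using component_h[OF shift_W[OF lW[of n], of "- m"], of m] by simp
  have w2: "h m (shift (- m - 1) (h (n + 1) v)) \<in> W (i + n)"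
    using component_h[OF shift_W[OF hW[of "n + 1"], of "- m - 1"], of m] by (simp add: algebra_simps)
  have w3: "h (m + n) (shift (- m) v) \<in> W (i + n)"
    using component_h[OF sh[of "- m"], of "m + n"] by (simp add: algebra_simps)
  have s1: "shift (- n) (h m (shift (- m) (l n v))) = T m (A n v)"
    using h_shift[OF shift_W[OF lW], of m "- n" "- m" n] shift_shift[OF lW, of "- n" "- m" n]
      shift_shift[OF lW, of "- m" "- n" n] by (simp add: T_def A_def algebra_simps)
  have s2: "shift (- n) (h m (shift (- m - 1) (h (n + 1) v))) = T m (T (n + 1) v)"
  proof -
    let ?y = "h (n + 1) v" and ?c = "- (m + n + 1)"
    have "shift (- n) (h m (shift (- m - 1) ?y)) = h m (shift (- n) (shift (- m - 1) ?y))"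
      by (rule h_shift[OF shift_W[OF hW], symmetric])
    also have "shift (- n) (shift (- m - 1) ?y) = shift ?c ?y"
      unfolding shift_shift[OF hW] by (rule arg_cong[where f="\<lambda>k. shift k ?y"]) simp
    also have "\<dots> = shift (- m) (shift (- (n + 1)) ?y)"
      unfolding shift_shift[OF hW] by (rule arg_cong[where f="\<lambda>k. shift k ?y"]) simp
    finally show ?thesis using T_eq[OF assms, of "n + 1"] by (simp add: T_def[of m])
  qed
  have s3: "shift (- n) (h (m + n) (shift (- m) v)) = T (m + n) v"
    using h_shift[OF sh, of "m + n" "- n" "- m"] shift_shift[OF assms, of "- n" "- m"]
    by (simp add: T_def algebra_simps)
  show ?thesis
    unfolding A_def[of n "T m v"] e
    using w1 w2 w3 subspace_diff[OF subspace_component] subspace_scale[OF subspace_component]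
    by (simp add: shift_add[where i="i + n"] shift_diff[where i="i + n"] shift_scale[where i="i + n"]
        s1 s2 s3 scale_right_diff_distrib)
qed

text \<open>For \<open>n = - 1\<close> the commutator is linear because \<open>T 0\<close> is the
  scalar \<open>a\<close>. The resulting rule \<open>t (m - 1) = a * t m\<close> for
  \<open>m \<noteq> 0\<close>, together with \<open>t 1 = 1\<close>, determines \<open>t m\<close>
  for \<open>m \<ge> 0\<close>.\<close>

lemma T_eigenvector_nonneg:
  obtains v where "v \<in> W 0" "v \<noteq> 0" "\<And>m. m \<ge> 0 \<Longrightarrow> T m v = a powi (1 - m) *s v"
proof -
  obtain v t where v: "v \<in> W 0" "v \<noteq> 0" "\<And>m. T m v = t m *s v"
    by (rule common_eigenvector[where T=T, OF bounded_component subspace_component W_nonzero[of 0] T_endo T_comm]) (assumption, (rule that; assumption))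
  have r: "t (m - 1) = a * t m" if "m \<noteq> 0" for m
  proof -
    let ?B = "\<lambda>m x. of_int m *s (T (m - 1) x - a *s T m x)"
    have "of_int m * (t (m - 1) - a * t m) = 0"
    proof (rule lie_eigenvalue[where X="W 0" and A="A (-1)" and T=T and B="?B" and v=v and \<tau>=t, OF bounded_component subspace_component A_endo T_endo])
      show "endo_on (W 0) (?B m)" for m
        using endo_onD[OF T_endo[of 0]] subspace_diff[OF subspace_component] subspace_scale[OF subspace_component]
        by (auto simp: endo_on_def scale_right_distrib scale_right_diff_distrib mult.commute mult.left_commute)
      show "A (-1) (T m x) = T m (A (-1) x) + ?B m x" if "x \<in> W 0" for m x
        using A_T[OF that, of "-1" m] T_0[OF that] endo_onD(3)[OF T_endo that] by simp
      show "\<exists>J e. finite J \<and> (\<forall>x\<in>W 0. ?B m x = (\<Sum>j\<in>J. e j *s T j x))" for m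
        by (rule exI[of _ "{m - 1, m}"], rule exI[of _ "\<lambda>j. if j = m then - of_int m * a else of_int m"])
          (simp add: scale_right_diff_distrib)
      show "?B m v = (of_int m * (t (m - 1) - a * t m)) *s v" for m
        by (simp add: v(3) scale_left_diff_distrib scale_right_diff_distrib right_diff_distrib)
    qed (use v in auto)
    then show ?thesis using that by simp
  qed
  have t1: "t 1 = 1" using T_1[OF v(1)] v(2) v(3)[of 1] by (metis scale_cancel_right scale_one)
  have "t m = a powi (1 - m)" if "m \<ge> 0" for m
  proof (cases "m = 0")
    case True
    then show ?thesis using r[of 1] t1 by simp
  next
    case False
    with that have "1 \<le> m" by simp
    then show ?thesis
    proof (induction m rule: int_ge_induct)
      case (step m)
      have "a * t (m + 1) = a * a powi (- m)"
        using r[of "m + 1"] step a_nonzero by (simp add: power_int_add[of a 1 "- m", simplified])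
      then show ?case using a_nonzero by simp
    qed (simp add: t1)
  qed
  then show ?thesis using that v by metis
qed

text \<open>On the joint eigenspace \<open>X\<close> for \<open>m \<ge> 0\<close>,
  \<open>T 2\<close> is the scalar \<open>1 / a\<close>, so \<open>n = 1\<close> becomes available;
  the rule \<open>t (m + 1) = t m / a\<close> for \<open>m \<noteq> 0\<close> then descends from
  \<open>t 0 = a\<close> to negative \<open>m\<close>.\<close>

lemma T_eigenvector:
  obtains v where "v \<in> W 0" "v \<noteq> 0" "\<And>m. T m v = a powi (1 - m) *s v"
proof -
  define X where "X = {v\<in>W 0. \<forall>m\<ge>0. T m v = a powi (1 - m) *s v}"
  have XW: "X \<subseteq> W 0" by (auto simp: X_def)
  note TD = endo_onD[OF T_endo[of 0]]
  have Xsub: "subspace X"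
    using subspace_component[of a 0 \<tau>] endo_on_zero[OF T_endo subspace_component] TD
    unfolding X_def subspace_def by (auto simp: scale_right_distrib mult.commute)
  have XT: "T m x \<in> X" if "x \<in> X" for m x
    using that T_comm[of x 0 _ m] TD by (auto simp: X_def)
  have XA: "A 1 x \<in> X" if x: "x \<in> X" for x
  proof -
    have xW: "x \<in> W 0" using x XW by blast
    have "T m (A 1 x) = a powi (1 - m) *s A 1 x" if m: "m \<ge> 0" for m
    proof -
      have "T (m + 1) x = a powi (- m) *s x" using x m by (auto simp: X_def)
      moreover have "T m (T 2 x) = a powi (- m) *s x"
      proof -
        have "T m (T 2 x) = (inverse a * a powi (1 - m)) *s x"
          using x m TD(3)[OF xW, of m] by (auto simp: X_def)
        also have "inverse a * a powi (1 - m) = a powi (- m)"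
          using power_int_add[of a "-1" "1 - m"] a_nonzero by (simp add: power_int_minus)
        finally show ?thesis .
      qed
      moreover have "A 1 (T m x) = a powi (1 - m) *s A 1 x"
        using x m endo_onD(3)[OF A_endo xW] by (auto simp: X_def)
      ultimately show ?thesis using A_T[OF xW, of 1 m] by simp
    qed
    then show ?thesis using A_W[OF xW, of 1] by (auto simp: X_def)
  qed
  have Xne: "\<not> X \<subseteq> {0}"
    by (rule T_eigenvector_nonneg) (auto simp: X_def)
  have bX: "bounded_dim nb X" by (rule bounded_dim_mono[OF bounded_component XW])
  have TX: "endo_on X (T m)" for m by (rule endo_on_subset[OF T_endo XW XT])
  have AX: "endo_on X (A 1)" by (rule endo_on_subset[OF A_endo XW XA])
  have TcX: "T m (T n x) = T n (T m x)" if "x \<in> X" for m n x using T_comm that XW by blast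
  obtain v t where v: "v \<in> X" "v \<noteq> 0" "\<And>m. T m v = t m *s v"
    by (rule common_eigenvector[where T=T, OF bX Xsub Xne TX TcX]) (assumption, (rule that; assumption))
  have r: "t (m + 1) = inverse a * t m" if "m \<noteq> 0" for m
  proof -
    let ?B = "\<lambda>m x. of_int m *s (T (m + 1) x - inverse a *s T m x)"
    have "of_int m * (t (m + 1) - inverse a * t m) = 0"
    proof (rule lie_eigenvalue[where X=X and A="A 1" and T=T and B="?B" and v=v and \<tau>=t, OF bX Xsub AX TX])
      show "endo_on X (?B m)" for m
        using endo_onD[OF TX] subspace_diff[OF Xsub] subspace_scale[OF Xsub]
        by (auto simp: endo_on_def scale_right_distrib scale_right_diff_distrib mult.commute mult.left_commute)
      show "A 1 (T m x) = T m (A 1 x) + ?B m x" if "x \<in> X" for m x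
      proof -
        have "T 2 x = inverse a *s x" using that by (auto simp: X_def dest!: spec[of _ 2])
        moreover have "x \<in> W 0" using that XW by blast
        ultimately show ?thesis using A_T[of x 0 1 m] TD(3)[of x m "inverse a"] by simp
      qed
      show "\<exists>J e. finite J \<and> (\<forall>x\<in>X. ?B m x = (\<Sum>j\<in>J. e j *s T j x))" for m
        by (rule exI[of _ "{m + 1, m}"], rule exI[of _ "\<lambda>j. if j = m then - of_int m * inverse a else of_int m"])
          (simp add: scale_right_diff_distrib)
      show "?B m v = (of_int m * (t (m + 1) - inverse a * t m)) *s v" for m
        by (simp add: v(3) scale_left_diff_distrib scale_right_diff_distrib right_diff_distrib)
    qed (use v in auto)
    then show ?thesis using that by simp
  qed
  have tn: "t m = a powi (1 - m)" for m
  proof (cases "m \<ge> 0")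
    case True
    then have "t m *s v = a powi (1 - m) *s v" using v by (auto simp: X_def)
    then show ?thesis using v(2) by simp
  next
    case False
    then have "m \<le> 0" by simp
    then show ?thesis
    proof (induction m rule: int_le_induct)
      case base
      have "t 0 *s v = a powi (1 - 0) *s v" using v(1) v(3)[of 0] by (auto simp: X_def)
      then show ?case using v(2) by simp
    next
      case (step m)
      have "inverse a * t (m - 1) = inverse a * a powi (2 - m)"
        using r[of "m - 1"] step a_nonzero power_int_add[of a "-1" "2 - m"] by (simp add: power_int_minus)
      then show ?case using a_nonzero by (simp add: algebra_simps)
    qed
  qed
  then show ?thesis using that[of v] v XW by auto
qed

text \<open>The rule holds on the vector of \<open>T_eigenvector\<close>, and the vectors on which
  it holds form a family stable under \<open>l\<close> and \<open>h\<close>, to which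
  \<open>W_simple\<close> applies.\<close>

lemma h_h: "w \<in> W i \<Longrightarrow> h j (h k w) = a *s h (j + k) w"
proof -
  assume w: "w \<in> W i"
  define Z where "Z i = {w\<in>W i. \<forall>j k. h j (h k w) = a *s h (j + k) w}" for i
  obtain v where v: "v \<in> W 0" "v \<noteq> 0" "\<And>m. T m v = a powi (1 - m) *s v"
    using T_eigenvector by metis
  have hm: "h m v = a powi (1 - m) *s shift m v" for m
  proof -
    have "shift m (T m v) = h m v"
      using T_eq[OF v(1)] shift_shift[OF component_h[OF v(1)]] by (simp add: shift_0)
    then show ?thesis using v(3) shift_scale[OF v(1)] by simp
  qed
  have "h j (h k v) = a *s h (j + k) v" for j k
  proof -
    have "h j (h k v) = a powi (1 - k) *s shift k (h j v)"
      by (simp add: hm[of k] lin h_shift[OF v(1)])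
    also have "\<dots> = (a powi (1 - k) * a powi (1 - j)) *s shift (j + k) v"
      using shift_scale[OF shift_W[OF v(1)]] shift_shift[OF v(1)] by (simp add: hm[of j] add.commute)
    also have "a powi (1 - k) * a powi (1 - j) = a * a powi (1 - (j + k))"
      using a_nonzero power_int_add[of a "1 - k" "1 - j"] power_int_add[of a 1 "1 - (j + k)"]
      by (simp add: algebra_simps)
    finally show ?thesis by (simp add: hm[of "j + k"])
  qed
  then have "v \<in> Z 0" using v(1) by (simp add: Z_def)
  moreover have "subspace (Z i)" for i
    using subspace_component[of a i \<tau>] unfolding Z_def subspace_def by (auto simp: lin scale_right_distrib mult.commute)
  moreover have "h m w \<in> Z (i + m)" if "w \<in> Z i" for i m w
  proof -
    have "h j (h k (h m w)) = a *s h (j + k) (h m w)" for j k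
      using that hh[of k m] hh[of j m] hh[of "j + k" m] by (simp add: Z_def lin add.assoc)
    then show ?thesis using that component_h by (auto simp: Z_def)
  qed
  moreover have "l m w \<in> Z (i + m)" if z: "w \<in> Z i" for i m w
  proof -
    have H: "h j (h k w) = a *s h (j + k) w" for j k using z by (simp add: Z_def)
    have "h j (h k (l m w)) = a *s h (j + k) (l m w)" for j k
      using H[of j k] H[of "j + m" k] H[of j "k + m"]
      by (simp add: hl lin scale_left_distrib scale_right_diff_distrib algebra_simps H)
    then show ?thesis using z component_l by (auto simp: Z_def)
  qed
  ultimately have "Z i = W i" using v(2)
    by (intro W_simple[of Z v 0]) (auto simp: Z_def)
  then show ?thesis using w by (auto simp: Z_def)
qed


section \<open>The module structure over Laurent polynomials\<close>

definition t :: "int \<Rightarrow> 'v \<Rightarrow> 'v" where "t m v = inverse a *s h m v"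

text \<open>For \<open>u\<close> in \<open>W 0\<close>, \<open>l m\<close> sends
  \<open>t i u\<close> to \<open>t (i + m) (D m u + i u)\<close>; the \<open>D m\<close> thus carry
  the whole action of the \<open>l m\<close>, on the single space \<open>W 0\<close>.\<close>

definition D :: "int \<Rightarrow> 'v \<Rightarrow> 'v" where "D m v = t (- m) (l m v)"

lemma t_endo: "endo_on UNIV (t m)"
  by (auto simp: endo_on_def t_def lin scale_right_distrib mult.commute)

lemma D_endo_UNIV: "endo_on UNIV (D m)"
  unfolding D_def by (rule endo_comp[OF t_endo endo(1)])

lemmas t_lin = endo_UNIV_simps[OF t_endo]
lemmas D_lin = endo_UNIV_simps[OF D_endo_UNIV]

lemma t_W: "w \<in> W i \<Longrightarrow> t m w \<in> W (i + m)"
  unfolding t_def by (intro subspace_scale[OF subspace_component] component_h)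

lemma D_W: "w \<in> W i \<Longrightarrow> D m w \<in> W i"
  using t_W[OF component_l[of w a i \<tau> m], of "- m"] by (simp add: D_def)

lemma D_endo: "endo_on (W i) (D m)"
  by (rule endo_on_subset[OF D_endo_UNIV]) (auto intro: D_W)

lemma t_t: "w \<in> W i \<Longrightarrow> t j (t k w) = t (j + k) w"
  by (simp add: t_def lin h_h a_nonzero)

lemma t_0: "w \<in> W i \<Longrightarrow> t 0 w = w"
  by (simp add: t_def componentD(2) a_nonzero)

lemma h_t: "w \<in> W i \<Longrightarrow> h m w = a *s t m w"
  by (simp add: t_def a_nonzero)

lemma l_t: "l n (t k v) = t k (l n v) + of_int k *s t (n + k) v"
  using lh[of n k v] by (simp add: t_def lin algebra_simps)

lemma l_D: "w \<in> W i \<Longrightarrow> l m w = t m (D m w)"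
  using t_t[OF component_l[of w a i \<tau> m], of m "- m"] t_0[OF component_l] by (simp add: D_def)

lemma D_0: "w \<in> W 0 \<Longrightarrow> D 0 w = \<mu> *s w"
  using t_0[OF component_l[of w a 0 \<tau> 0]] componentD(3)[of w a 0 \<tau>] by (simp add: D_def)

text \<open>The terms in \<open>D m\<close> and \<open>D n\<close> arise from commuting
  \<open>l n\<close> past \<open>t (- m)\<close> and \<open>l m\<close> past
  \<open>t (- n)\<close>.\<close>

lemma D_D:
  assumes "v \<in> W i"
  shows "D m (D n v) - D n (D m v) = of_int (n - m) *s D (m + n) v + of_int m *s D m v - of_int n *s D n v"
proof -
  have DD: "D m (D n v) = t (- (m + n)) (l m (l n v)) - of_int n *s D n v" for m n
  proof -
    note Sn = component_l[OF assms, of n]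
    have "D m (D n v) = t (- m) (t (- n) (l m (l n v))) - of_int n *s t (- m) (t (m - n) (l n v))"
      unfolding D_def by (simp add: l_t t_lin)
    also have "t (- m) (t (m - n) (l n v)) = D n v"
      unfolding t_t[OF Sn] D_def by simp
    also have "t (- m) (t (- n) (l m (l n v))) = t (- (m + n)) (l m (l n v))"
      unfolding t_t[OF component_l[OF Sn]] by simp
    finally show ?thesis .
  qed
  have "t (- (m + n)) (l m (l n v)) - t (- (n + m)) (l n (l m v)) = of_int (n - m) *s D (m + n) v"
    unfolding D_def using ll[of m n v] t_lin(4)[of "- (m + n)" "l m (l n v)" "l n (l m v)"]
    by (simp add: t_lin add.commute)
  then show ?thesis unfolding DD by (simp add: algebra_simps)
qed

text \<open>The translates of \<open>X\<close> by the \<open>t i\<close> form a family stable under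
  \<open>l\<close> and \<open>h\<close>, to which \<open>W_simple\<close> applies.\<close>

lemma D_irreducible:
  assumes "subspace X" "X \<subseteq> W 0" "\<And>m x. x \<in> X \<Longrightarrow> D m x \<in> X" "x0 \<in> X" "x0 \<noteq> 0"
  shows "X = W 0"
proof -
  define Z where "Z i = t i ` X" for i
  have sub: "subspace (Z i)" for i
  proof (rule subspaceI)
    show "0 \<in> Z i" unfolding Z_def using subspace_0[OF assms(1)] t_lin(3) by force
    show "x + y \<in> Z i" if "x \<in> Z i" "y \<in> Z i" for x y
      using that subspace_add[OF assms(1)] unfolding Z_def by (auto simp flip: t_lin(1))
    show "c *s x \<in> Z i" if "x \<in> Z i" for c x
      using that subspace_scale[OF assms(1)] unfolding Z_def by (auto simp flip: t_lin(2))
  qed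
  have Z0: "Z 0 = X" unfolding Z_def using t_0 assms(2) by force
  have "Z 0 = W 0"
  proof (rule W_simple[OF sub])
    show "Z i \<subseteq> W i" for i using t_W[of _ 0 i] assms(2) by (auto simp: Z_def)
    show "l m w \<in> Z (i + m)" if wZ: "w \<in> Z i" for i m w
    proof -
      obtain x where x: "x \<in> X" "w = t i x" using wZ by (auto simp: Z_def)
      have xW: "x \<in> W 0" using x assms(2) by blast
      have "l m w = t (i + m) (D m x + of_int i *s x)"
        unfolding x(2) l_t l_D[OF xW] t_t[OF D_W[OF xW]] by (simp add: t_lin add.commute)
      moreover have "D m x + of_int i *s x \<in> X"
        using assms(3)[OF x(1)] x(1) subspace_add[OF assms(1)] subspace_scale[OF assms(1)] by blast
      ultimately show ?thesis by (auto simp: Z_def)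
    qed
    show "h m w \<in> Z (i + m)" if wZ: "w \<in> Z i" for i m w
    proof -
      obtain x where x: "x \<in> X" "w = t i x" using wZ by (auto simp: Z_def)
      have xW: "x \<in> W 0" using x assms(2) by blast
      have "h m w = t (i + m) (a *s x)"
        unfolding x(2) h_t[OF t_W[OF xW]] t_t[OF xW] by (simp add: t_lin add.commute)
      then show ?thesis using x subspace_scale[OF assms(1)] by (auto simp: Z_def)
    qed
    show "x0 \<in> Z 0" "x0 \<noteq> 0" using assms Z0 by auto
  qed
  then show ?thesis by (simp add: Z0)
qed

lemma gp_gm_D:
  assumes "u \<in> W 0"
  shows "t (- p) (gp p (gm q (t (- q) u))) = (- 2) *s D (p + q) u + (2 * of_int q + of_int (p - q) * a) *s u"
proof -
  note tq = t_W[OF assms, of "- q"]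
  have "gp p (gm q (t (- q) u)) = (- 2) *s l (p + q) (t (- q) u) + of_int (p - q) *s h (p + q) (t (- q) u)"
    using gpgm[of p q "t (- q) u"] highest[OF tq] by (simp add: lin)
  also have "h (p + q) (t (- q) u) = a *s t p u"
    unfolding h_t[OF tq] t_t[OF assms] by simp
  also have "l (p + q) (t (- q) u) = t (- q) (l (p + q) u) - of_int q *s t p u"
    by (simp add: l_t)
  finally have "t (- p) (gp p (gm q (t (- q) u))) =
    (- 2) *s (t (- p) (t (- q) (l (p + q) u)) - of_int q *s t (- p) (t p u)) + of_int (p - q) *s (a *s t (- p) (t p u))"
    by (simp only: t_lin)
  also have "t (- p) (t p u) = u" using t_t[OF assms] t_0[OF assms] by simp
  also have "t (- p) (t (- q) (l (p + q) u)) = D (p + q) u"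
    unfolding t_t[OF component_l[OF assms]] D_def by simp
  finally show ?thesis by (simp add: scale_right_diff_distrib scale_left_distrib)
qed

section \<open>Linear recurrences for the operators \<open>D\<close>\<close>

text \<open>\<open>f\<close> is the characteristic polynomial of a recurrence for the two-sided
  sequence \<open>p \<mapsto> D p u\<close>; quantifying over all translates makes these polynomials
  an ideal.\<close>

definition annihilates :: "complex poly \<Rightarrow> 'v \<Rightarrow> bool" where
  "annihilates f u \<longleftrightarrow> (\<forall>p. psum f (\<lambda>j. D (p + int j) u) = 0)"

lemma annihilates_mult: "annihilates f u \<Longrightarrow> annihilates (g * f) u"
  unfolding annihilates_def
proof
  fix p assume a: "\<forall>p. psum f (\<lambda>j. D (p + int j) u) = 0"
  have "psum f (\<lambda>j. D (p + int (i + j)) u) = 0" for i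
    using spec[OF a, of "p + int i"] by (simp add: add.assoc)
  then show "psum (g * f) (\<lambda>j. D (p + int j) u) = 0"
    by (simp add: psum_mult psum_def[of g])
qed

lemma annihilates_diff: "annihilates f u \<Longrightarrow> annihilates g u \<Longrightarrow> annihilates (f - g) u"
  by (simp add: annihilates_def psum_diff)

lemma subspace_annihilates: "subspace {u. annihilates f u}"
  unfolding subspace_def annihilates_def by (auto simp: D_lin psum_fun_add psum_fun_scale psum_def[of f "\<lambda>_. 0"])

text \<open>A linear relation between the \<open>gm q (t (- q) u)\<close> becomes, after applying all \<open>gp p\<close>, a recurrence for
  \<open>q \<mapsto> D q u\<close> up to terms that are affine in \<open>p\<close>, which the factor \<open>(X - 1)\<^sup>2\<close> kills.\<close>

lemma exists_annihilating_poly: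
  assumes "u \<in> W 0"
  shows "\<exists>f. f \<noteq> 0 \<and> annihilates f u"
proof -
  have gS: "gm q (t (- q) u) \<in> component (a - 1) 0 (\<tau> + 1)" for q
    using component_gm[OF t_W[OF assms, of "- q"], of q] by simp
  obtain f where f: "f \<noteq> 0" "psum f (\<lambda>j. gm (int j) (t (- int j) u)) = 0"
    by (rule annihilating_poly[OF bounded_component gS])
  define F where "F p = psum f (\<lambda>j. D (p + int j) u)" for p
  define G where "G = psum f (\<lambda>j. (of_int (int j) * (2 - a)) *s u)"
  have F: "F p = (1 / 2) *s (G + (of_int p * a * poly f 1) *s u)" for p
  proof -
    have E: "endo_on UNIV (\<lambda>x. t (- p) (gp p x))" by (rule endo_comp[OF t_endo endo(3)])
    have "0 = t (- p) (gp p (psum f (\<lambda>j. gm (int j) (t (- int j) u))))"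
      unfolding f(2) by (simp add: lin t_lin)
    also have "\<dots> = psum f (\<lambda>j. t (- p) (gp p (gm (int j) (t (- int j) u))))"
      by (rule psum_endo(1)[OF E subspace_UNIV]) simp
    also have "\<dots> = psum f (\<lambda>j. (- 2) *s D (p + int j) u + ((of_int (int j) * (2 - a)) *s u + (of_int p * a) *s u))"
      unfolding gp_gm_D[OF assms] by (simp add: algebra_simps scale_left_distrib scale_left_diff_distrib)
    also have "\<dots> = (- 2) *s F p + (G + poly f 1 *s ((of_int p * a) *s u))"
      unfolding psum_fun_add psum_fun_scale psum_fun_const F_def G_def by simp
    finally have "2 *s F p = G + (of_int p * a * poly f 1) *s u"
      by (simp add: mult.commute add_eq_0_iff eq_neg_iff_add_eq_0 algebra_simps)
    then have "(1 / 2) *s (2 *s F p) = (1 / 2) *s (G + (of_int p * a * poly f 1) *s u)" by simp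
    then show ?thesis by simp
  qed
  have "annihilates ([:1, - 2, 1:] * f) u"
    unfolding annihilates_def
  proof
    fix p
    have "psum ([:1, - 2, 1:] * f) (\<lambda>j. D (p + int j) u) = F p + ((- 2) *s F (p + 1) + F (p + 2))"
      unfolding psum_mult by (simp add: psum_pCons F_def algebra_simps)
    also have "\<dots> = 0"
      unfolding F by (simp add: scale_right_distrib scale_left_distrib distrib_right distrib_left scale_left_diff_distrib) (simp add: field_simps flip: scale_left_distrib)
    finally show "psum ([:1, - 2, 1:] * f) (\<lambda>j. D (p + int j) u) = 0" .
  qed
  moreover have "[:1, - 2, 1:] * f \<noteq> 0" using f(1) by (simp del: mult_pCons_left)
  ultimately show ?thesis by blast
qed

definition annihilator :: "complex poly set" where
  "annihilator = {f. \<forall>u\<in>W 0. annihilates f u}"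

lemma annihilator_nonzero: "\<exists>f\<in>annihilator. f \<noteq> 0"
proof -
  obtain B where B: "finite B" "B \<subseteq> W 0" "W 0 \<subseteq> span B" by (rule bounded_dim_basis[OF bounded_component])
  have "\<forall>b\<in>B. \<exists>f. f \<noteq> 0 \<and> annihilates f b" using exists_annihilating_poly B(2) by blast
  then obtain f where f: "\<And>b. b \<in> B \<Longrightarrow> f b \<noteq> 0" "\<And>b. b \<in> B \<Longrightarrow> annihilates (f b) b" by metis
  have "annihilates (\<Prod>b\<in>B. f b) b" if "b \<in> B" for b
    using annihilates_mult[OF f(2)[OF that], of "\<Prod>b\<in>B - {b}. f b"] prod.remove[OF B(1) that, of f]
    by (simp add: mult.commute)
  then have "span B \<subseteq> {u. annihilates (\<Prod>b\<in>B. f b) u}"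
    by (intro span_minimal subspace_annihilates) auto
  then have "(\<Prod>b\<in>B. f b) \<in> annihilator" using B(3) by (auto simp: annihilator_def)
  then show ?thesis using f(1) B(1) by (intro bexI[of _ "\<Prod>b\<in>B. f b"]) auto
qed

text \<open>Commuting the recurrence \<open>g\<close> with \<open>D 1\<close> produces coefficients
  affine in the index, hence by \<open>psum_pderiv\<close> the derivative of \<open>g\<close>; the
  stray term \<open>D 1 u\<close> carries the factor \<open>poly g 1\<close>.\<close>

lemma annihilator_derivative:
  assumes "g \<in> annihilator" "poly g 1 = 0"
  shows "[:- 1, 1:] * pderiv g \<in> annihilator"
proof -
  have "psum ([:- 1, 1:] * pderiv g) (\<lambda>j. D (p + 1 + int j) u) = 0" if u: "u \<in> W 0" for p u
  proof -
    have an: "psum g (\<lambda>j. D (q + int j) v) = 0" if "v \<in> W 0" for q v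
      using assms(1) that by (auto simp: annihilator_def annihilates_def)
    have "0 = D 1 (psum g (\<lambda>j. D (p + int j) u)) - psum g (\<lambda>j. D (p + int j) (D 1 u))"
      by (simp add: an u D_W D_lin)
    also have "\<dots> = psum g (\<lambda>j. D 1 (D (p + int j) u) - D (p + int j) (D 1 u))"
      unfolding psum_fun_diff using psum_endo(1)[OF D_endo_UNIV subspace_UNIV] by simp
    also have "\<dots> = psum g (\<lambda>j. (of_int (p - 1) *s D (p + 1 + int j) u + of_nat j *s D (p + 1 + int j) u)
        + D 1 u - (of_int p *s D (p + int j) u + of_nat j *s D (p + int j) u))"
      unfolding D_D[OF u] by (simp add: algebra_simps scale_left_distrib scale_left_diff_distrib)
    also have "\<dots> = psum g (\<lambda>j. of_nat j *s D (p + 1 + int j) u) - psum g (\<lambda>j. of_nat j *s D (p + int j) u)"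
      unfolding psum_fun_diff psum_fun_add psum_fun_scale psum_fun_const an[OF u] assms(2) by simp
    also have "\<dots> = psum (pderiv g) (\<lambda>j. D (p + 1 + int (Suc j)) u) - psum (pderiv g) (\<lambda>j. D (p + int (Suc j)) u)"
      unfolding psum_pderiv by simp
    also have "\<dots> = psum ([:- 1, 1:] * pderiv g) (\<lambda>j. D (p + 1 + int j) u)"
      unfolding psum_linear_factor by (simp add: algebra_simps)
    finally show ?thesis by simp
  qed
  from this[of _ "_ - 1"] show ?thesis by (simp add: annihilator_def annihilates_def)
qed

text \<open>The generator \<open>f\<close> of the annihilator divides \<open>(X - 1)\<^sup>2 f'\<close>, so that \<open>1\<close> is its only root.\<close>

lemma annihilator_power: "\<exists>k. [:- 1, 1:] ^ k \<in> annihilator"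
proof -
  obtain f where f: "f \<in> annihilator" "f \<noteq> 0" "\<And>g. g \<in> annihilator \<Longrightarrow> g \<noteq> 0 \<Longrightarrow> degree f \<le> degree g"
    using exists_min_degree[of "\<lambda>f. f \<in> annihilator"] annihilator_nonzero by metis
  have dvd: "f dvd g" if g: "g \<in> annihilator" for g
  proof -
    have "g - (g div f) * f \<in> annihilator"
      using g f(1) annihilates_mult annihilates_diff by (simp add: annihilator_def)
    then have "g mod f \<in> annihilator" by (simp add: minus_div_mult_eq_mod)
    then have "g mod f = 0" using f(3) degree_mod_less[OF f(2), of g] by fastforce
    then show ?thesis by (simp add: mod_eq_0_iff_dvd)
  qed
  have root: "r = 1" if r: "poly f r = 0" for r
  proof (rule ccontr)
    assume "r \<noteq> 1"
    let ?X = "[:- 1, 1:] :: complex poly"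
    \<comment> \<open>The factor provides the zero at 1 that the derivative lemma requires and that
      \<open>f\<close> need not have.\<close>
    have "?X * f \<in> annihilator" using f(1) annihilates_mult by (simp add: annihilator_def del: mult_pCons_left)
    then have "?X * pderiv (?X * f) \<in> annihilator" by (rule annihilator_derivative) simp
    then have "f dvd ?X * pderiv (?X * f)" by (rule dvd)
    moreover have "?X * pderiv (?X * f) = ?X * ?X * pderiv f + ?X * f"
    proof -
      have "pderiv ?X = 1" by (simp add: pderiv_pCons)
      then show ?thesis by (simp only: pderiv_mult mult_1_right distrib_left mult.assoc)
    qed
    ultimately have d: "f dvd ?X * ?X * pderiv f"
      by (metis dvd_add_left_iff dvd_triv_right)
    have f': "pderiv f \<noteq> 0"
    proof
      assume "pderiv f = 0"
      then obtain c where "f = [:c:]" using pderiv_eq_0_iff[of f] degree_eq_zeroE by metis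
      then show False using r f(2) by simp
    qed
    have X0: "?X * ?X * pderiv f \<noteq> 0" using f' by (simp del: mult_pCons_left)
    \<comment> \<open>At a root \<open>r \<noteq> 1\<close> the factors \<open>X - 1\<close>
      contribute nothing to the order, while differentiation lowers it by one; this contradicts
      divisibility by \<open>f\<close>.\<close>
    have "order r ?X = 0" using \<open>r \<noteq> 1\<close> by (simp add: order_0I)
    then have "order r (?X * ?X * pderiv f) = order r (pderiv f)"
      using X0 by (metis (no_types) add_0 mult_eq_0_iff order_mult)
    moreover have "order r f \<le> order r (?X * ?X * pderiv f)"
      using d X0 by (rule dvd_imp_order_le[rotated])
    ultimately show False using order_pderiv[OF f(2) r] by simp
  qed
  have "smult (lead_coeff f) (\<Prod>z | poly f z = 0. [:- z, 1:] ^ order z f) = f"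
    by (rule complex_poly_decompose)
  moreover have "{z. poly f z = 0} = {} \<or> {z. poly f z = 0} = {1}" using root by blast
  ultimately have "f = smult (lead_coeff f) ([:- 1, 1:] ^ order 1 f) \<or> f = smult (lead_coeff f) ([:- 1, 1:] ^ 0)"
    by auto
  then obtain k where k: "f = smult (lead_coeff f) ([:- 1, 1:] ^ k)" by blast
  have "[:inverse (lead_coeff f):] * f \<in> annihilator"
    using f(1) annihilates_mult by (simp add: annihilator_def del: mult_pCons_left)
  moreover have "[:inverse (lead_coeff f):] * f = [:- 1, 1:] ^ k"
    using f(2) by (subst k) simp
  ultimately show ?thesis by metis
qed

text \<open>For \<open>e \<ge> 2\<close> the operator \<open>z = D ((X - 1)\<^sup>e)\<close> satisfies \<open>[D m, z] = (e - 1) m z\<close>, hence it is nilpotent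
  with an invariant kernel.\<close>

lemma annihilator_power_step:
  assumes "[:- 1, 1:] ^ Suc e \<in> annihilator" "e \<ge> 2"
  shows "[:- 1, 1:] ^ e \<in> annihilator"
proof -
  define w :: "complex poly" where "w = [:- 1, 1:] ^ e"
  define z where "z u = psum w (\<lambda>j. D (int j) u)" for u
  have w1: "poly w 1 = 0" using assms(2) by (simp add: w_def)
  have w': "[:- 1, 1:] * pderiv w = smult (of_nat e) w"
  proof -
    have "pderiv w = smult (of_nat e) ([:- 1, 1:] ^ (e - 1))"
      using assms(2) unfolding w_def by (simp add: pderiv_power pderiv_pCons)
    then show ?thesis using assms(2) by (cases e) (simp_all add: w_def)
  qed
  have an: "psum ([:- 1, 1:] * w) (\<lambda>j. D (p + int j) u) = 0" if "u \<in> W 0" for p u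
    using assms(1) that unfolding w_def power_Suc annihilator_def annihilates_def by blast
  have const: "\<And>p. F p = F 0 + of_int p *s c" if "\<And>p. F (p + 1) = F p + c" for F :: "int \<Rightarrow> 'v" and c
  proof -
    fix p show "F p = F 0 + of_int p *s c"
    proof (induction p rule: int_induct[of _ 0])
      case (step1 p)
      then show ?case using that[of p] by (simp add: scale_left_distrib algebra_simps)
    next
      case (step2 p)
      then show ?case using that[of "p - 1"] by (simp add: scale_left_diff_distrib algebra_simps)
    qed simp
  qed
  \<comment> \<open>The product of \<open>X - 1\<close> and \<open>w\<close> annihilates, so these
    sums do not depend on the translate \<open>p\<close>.\<close>
  have zp: "psum w (\<lambda>j. D (p + int j) u) = z u" if u: "u \<in> W 0" for p u
  proof -
    have "psum w (\<lambda>j. D (p + 1 + int j) u) = psum w (\<lambda>j. D (p + int j) u) + 0" for p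
      using an[OF u, of p] unfolding psum_linear_factor by (simp add: algebra_simps)
    from const[of "\<lambda>p. psum w (\<lambda>j. D (p + int j) u)", OF this] show ?thesis by (simp add: z_def)
  qed
  \<comment> \<open>With the extra index the sums grow linearly in \<open>p\<close>: their first
    difference is \<open>e z u\<close>, by the identity for the derivative of
    \<open>w\<close>.\<close>
  have y: "psum w (\<lambda>j. of_nat j *s D (p + int j) u)
      = psum w (\<lambda>j. of_nat j *s D (int j) u) + of_int p *s (of_nat e *s z u)" if u: "u \<in> W 0" for p u
  proof -
    let ?y = "\<lambda>p. psum w (\<lambda>j. of_nat j *s D (p + int j) u)"
    have "?y (p + 1) = ?y p + of_nat e *s z u" for p
    proof -
      have "?y (p + 1) - ?y p = psum ([:- 1, 1:] * pderiv w) (\<lambda>j. D (p + 1 + int j) u)"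
        unfolding psum_pderiv psum_linear_factor by (simp add: algebra_simps)
      also have "\<dots> = of_nat e *s z u" unfolding w' psum_smult zp[OF u] ..
      finally show ?thesis by (simp add: algebra_simps)
    qed
    from const[of ?y, OF this] show ?thesis by simp
  qed
  have comm: "D m (z u) = z (D m u) + (of_int m * of_nat (e - 1)) *s z u" if u: "u \<in> W 0" for m u
  proof -
    have "D m (z u) - z (D m u) = psum w (\<lambda>j. D m (D (int j) u) - D (int j) (D m u))"
      unfolding z_def psum_fun_diff using psum_endo(1)[OF D_endo_UNIV subspace_UNIV] by simp
    also have "\<dots> = psum w (\<lambda>j. of_nat j *s D (m + int j) u - of_int m *s D (m + int j) u
        + of_int m *s D m u - of_nat j *s D (int j) u)"
      unfolding D_D[OF u] by (simp add: algebra_simps scale_left_diff_distrib)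
    also have "\<dots> = (of_int m * of_nat e) *s z u - of_int m *s z u"
      unfolding psum_fun_diff psum_fun_add psum_fun_scale psum_fun_const zp[OF u] y[OF u] w1 by simp
    also have "\<dots> = (of_int m * of_nat (e - 1)) *s z u"
      using assms(2) by (simp add: of_nat_diff algebra_simps scale_left_diff_distrib)
    finally show ?thesis by (simp add: algebra_simps)
  qed
  have zW: "z u \<in> W 0" if "u \<in> W 0" for u
    unfolding z_def psum_def using that D_W by (intro subspace_sum[OF subspace_component] subspace_scale[OF subspace_component])
  have z_endo: "endo_on UNIV z"
    by (auto simp: endo_on_def z_def D_lin psum_fun_add psum_fun_scale)
  \<comment> \<open>The eigenvalue \<open>e - 1\<close> must be nonzero. For \<open>e = 1\<close>
    this breaks down: \<open>z\<close> would be \<open>D 1 - D 0\<close>, the slope that remains in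
    the affine formula.\<close>
  have "endo_on (W 0) z" by (rule endo_on_subset[OF z_endo]) (auto intro: zW)
  then obtain x where x: "x \<in> W 0" "x \<noteq> 0" "z x = 0"
    by (rule ad_eigen_kernel[OF bounded_component subspace_component W_nonzero D_endo[of 0 1], where c="of_nat (e - 1)"])
      (use comm[of _ 1] assms(2) in auto)
  define X where "X = {u\<in>W 0. z u = 0}"
  have "X = W 0"
  proof (rule D_irreducible[of X x])
    show "subspace X"
      using subspace_component[of a 0 \<tau>] unfolding X_def subspace_def by (auto simp: endo_UNIV_simps[OF z_endo])
    show "D m u \<in> X" if "u \<in> X" for m u
      using that comm[of u m] D_W D_lin(3) by (simp add: X_def)
  qed (use x in \<open>auto simp: X_def\<close>)
  then show ?thesis using zp by (auto simp: X_def annihilator_def annihilates_def w_def)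
qed

lemma D_affine: "u \<in> W 0 \<Longrightarrow> D m u = \<mu> *s u + of_int m *s (D 1 u - \<mu> *s u)"
proof -
  assume u: "u \<in> W 0"
  have "[:- 1, 1:] ^ 2 \<in> annihilator"
  proof -
    obtain k where k: "[:- 1, 1:] ^ k \<in> annihilator" using annihilator_power by blast
    \<comment> \<open>The exponent is raised to at least 2, from where the descent can stop exactly
      at 2.\<close>
    have "[:- 1, 1:] ^ 2 * [:- 1, 1:] ^ k \<in> annihilator"
      using k annihilates_mult by (simp add: annihilator_def del: mult_pCons_left)
    then have up: "[:- 1, 1:] ^ (k + 2) \<in> annihilator" by (simp only: power_add mult.commute)
    have "[:- 1, 1:] ^ (j + 2) \<in> annihilator \<Longrightarrow> [:- 1, 1:] ^ 2 \<in> annihilator" for j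
    proof (induction j)
      case (Suc j)
      then show ?case using annihilator_power_step[of "j + 2"] by (simp only: add_Suc)
    qed (simp only: add_0)
    from this[OF up] show ?thesis .
  qed
  then have an: "psum ([:- 1, 1:] * ([:- 1, 1:] * 1)) (\<lambda>j. D (p + int j) u) = 0" for p
    using u by (simp add: annihilator_def annihilates_def power2_eq_square)
  have rec: "D (p + 2) u - D (p + 1) u = D (p + 1) u - D p u" for p
    using an[of p] unfolding psum_linear_factor by (simp add: psum_def algebra_simps)
  define d where "d = D 1 u - D 0 u"
  have d: "D (p + 1) u - D p u = d" for p
  proof (induction p rule: int_induct[of _ 0])
    case (step1 p)
    then show ?case using rec[of p] by (simp add: algebra_simps)
  next
    case (step2 p)
    then show ?case using rec[of "p - 1"] by (simp add: algebra_simps)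
  qed (simp add: d_def)
  have "D m u = D 0 u + of_int m *s d"
  proof (induction m rule: int_induct[of _ 0])
    case (step1 p)
    then show ?case using d[of p] by (simp add: scale_left_distrib algebra_simps)
  next
    case (step2 p)
    then show ?case using d[of "p - 1"] by (simp add: scale_left_diff_distrib algebra_simps)
  qed simp
  then show ?thesis by (simp add: d_def D_0[OF u])
qed

text \<open>\<open>D_affine\<close> expresses every \<open>D m\<close> through \<open>D 1\<close>,
  so an eigenvector of \<open>D 1\<close> spans a stable line, which must be \<open>W 0\<close>.
  Over the \<open>l m\<close> this is a module of the intermediate series, with
  \<open>\<beta>\<close> the slope of the affine map.\<close>

lemma W_basis:
  obtains w \<beta> where "\<And>i. W i = span {w i}" "\<And>i. w i \<in> W i" "\<And>i. w i \<noteq> 0"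
    "\<And>m i. l m (w i) = (\<mu> + \<beta> * of_int m + of_int i) *s w (i + m)" "\<And>m i. h m (w i) = a *s w (i + m)"
proof -
  obtain u \<delta> where u: "u \<in> W 0" "u \<noteq> 0" "D 1 u = \<delta> *s u"
    using eigenvector_exists[OF bounded_component subspace_component D_endo[of 0 1] W_nonzero] by metis
  define \<beta> where "\<beta> = \<delta> - \<mu>"
  have Du: "D m u = (\<mu> + \<beta> * of_int m) *s u" for m
    using D_affine[OF u(1), of m] u(3)
    by (simp add: \<beta>_def scale_left_distrib scale_left_diff_distrib mult.commute scale_right_diff_distrib right_diff_distrib left_diff_distrib)
  have W0: "span {u} = W 0"
  proof (rule D_irreducible)
    show "span {u} \<subseteq> W 0" using u(1) by (intro span_minimal subspace_component) simp
    show "D m x \<in> span {u}" if "x \<in> span {u}" for m x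
      by (rule endo_span[OF D_endo_UNIV subspace_span _ that]) (auto simp: Du intro: span_scale span_base)
  qed (use u in \<open>auto intro: span_base\<close>)
  define w where "w i = t i u" for i
  have wW: "w i \<in> W i" for i using t_W[OF u(1), of i] by (simp add: w_def)
  have tw: "t m (w i) = w (m + i)" for m i by (simp add: w_def t_t[OF u(1)])
  have w0: "w i \<noteq> 0" for i
  proof
    assume "w i = 0"
    then have "t (- i) (w i) = 0" by (simp add: t_lin)
    then show False unfolding tw using u t_0 by (simp add: w_def)
  qed
  show ?thesis
  proof (rule that[of w \<beta>])
    show "W i = span {w i}" for i
    proof
      show "span {w i} \<subseteq> W i" using wW by (intro span_minimal subspace_component) simp
      show "W i \<subseteq> span {w i}"
      proof
        fix x assume x: "x \<in> W i"
        then have "t (- i) x \<in> span {u}" using t_W[OF x, of "- i"] W0 by simp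
        then obtain c where "t (- i) x = c *s u" by (auto simp: span_singleton)
        then have "t i (t (- i) x) = c *s w i" by (simp add: t_lin w_def)
        then have "x = c *s w i" using t_t[OF x] t_0[OF x] by simp
        then show "x \<in> span {w i}" by (simp add: span_scale span_base)
      qed
    qed
    show "l m (w i) = (\<mu> + \<beta> * of_int m + of_int i) *s w (i + m)" for m i
    proof -
      have "l m (w i) = t i (t m (D m u)) + of_int i *s w (m + i)"
        unfolding w_def l_t using l_D[OF u(1)] by simp
      also have "t i (t m (D m u)) = (\<mu> + \<beta> * of_int m) *s w (i + m)"
        unfolding Du by (simp add: t_lin w_def t_t[OF u(1)])
      finally show ?thesis by (simp add: scale_left_distrib add.commute)
    qed
    show "h m (w i) = a *s w (i + m)" for m i
      using h_t[OF wW] tw by (simp add: add.commute)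
  qed (use wW w0 in auto)
qed

section \<open>The components of lower charge\<close>

text \<open>Such a nonzero vector would generate only the charges \<open>a - 1 - k\<close>, and
  charge \<open>a\<close> would be missing.\<close>

lemma no_singular_vectors:
  assumes "x \<in> component (a - 1) i \<sigma>" "\<And>p. gp p x = 0"
  shows "x = 0"
proof (rule ccontr)
  assume "x \<noteq> 0"
  define X where "X i = {x\<in>component (a - 1) i \<sigma>. \<forall>p. gp p x = 0}" for i
  obtain j v where v: "v \<in> component a j \<tau>" "v \<noteq> 0" using nontrivial by blast
  have "\<exists>k. a = a - 1 - of_nat k \<and> v \<in> gm_words X k j"
  proof (rule gm_words_charge[where W=X and \<tau>=\<sigma>, OF _ _ _ _ _ _ v])
    show "subspace (X i)" for i
      using subspace_component[of "a - 1" i \<sigma>] unfolding X_def subspace_def by (auto simp: lin)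
    show "l m w \<in> X (i + m)" if "w \<in> X i" for i m w
    proof -
      have "gp p (l m w) = 0" for p using that lgp[of m p w] by (simp add: X_def lin)
      then show ?thesis using that component_l by (simp add: X_def)
    qed
    show "h m w \<in> X (i + m)" if "w \<in> X i" for i m w
    proof -
      have "gp p (h m w) = 0" for p using that hgp[of m p w] by (simp add: X_def lin)
      then show ?thesis using that component_h by (simp add: X_def)
    qed
    show "\<exists>i. \<exists>w\<in>X i. w \<noteq> 0" using assms \<open>x \<noteq> 0\<close> by (auto simp: X_def)
  qed (auto simp: X_def)
  then obtain k where "a = a - 1 - of_nat k" by blast
  then have "- 1 = (of_nat k :: complex)" by simp
  then have "Re (- 1) = Re (of_nat k)" by (rule arg_cong)
  then show False by simp
qed

lemma gm_square: "gm q (gm q v) = 0"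
  by (rule eq_uminus_self_imp_zero) (rule gmgm)

text \<open>Here \<open>gm q (w (N - q)) = A N + q B N\<close> because the second difference in \<open>q\<close> is killed by all \<open>gp p\<close>,
  and \<open>gm r (gm q (w (N - q - r))) = (q - r) Y N\<close> by antisymmetry.\<close>

lemma weight_space_spanned:
  obtains w A B Y where "w \<in> grade \<tau>" "Y \<in> grade \<tau>" "A \<in> grade (\<tau> + 1)" "B \<in> grade (\<tau> + 1)"
    "{v. l 0 v = (\<mu> + of_int N) *s v} \<subseteq> span {w, Y, A, B}"
proof -
  obtain w \<beta> where w: "\<And>i. W i = span {w i}" "\<And>i. w i \<in> W i" "\<And>i. w i \<noteq> 0"
    "\<And>m i. l m (w i) = (\<mu> + \<beta> * of_int m + of_int i) *s w (i + m)" "\<And>m i. h m (w i) = a *s w (i + m)"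
    using W_basis by metis
  define A B Y where "A N = gm 0 (w N)" and "B N = gm 1 (w (N - 1)) - gm 0 (w N)" and "Y N = gm 0 (B N)" for N
  have gmw: "gm q (w (N - q)) \<in> component (a - 1) N (\<tau> + 1)" for q N
    using component_gm[OF w(2), of q "N - q"] by simp
  have gpgm_w: "gp p (gm q (w (N - q))) = ((- 2) * (\<mu> + \<beta> * of_int (p + q) + of_int (N - q)) + of_int (p - q) * a) *s w (N + p)" for p q N
  proof -
    have "gp p (gm q (w (N - q))) = (- 2) *s l (p + q) (w (N - q)) + of_int (p - q) *s h (p + q) (w (N - q))"
      using gpgm[of p q "w (N - q)"] highest[OF w(2)] by (simp add: lin)
    moreover have "N - q + (p + q) = N + p" by simp
    ultimately show ?thesis unfolding w(4,5) scale_scale by (simp only: scale_left_distrib)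
  qed
  have AS: "A N \<in> component (a - 1) N (\<tau> + 1)" for N using gmw[of 0 N] by (simp add: A_def)
  have BS: "B N \<in> component (a - 1) N (\<tau> + 1)" for N
    using subspace_diff[OF subspace_component gmw[of 1 N] gmw[of 0 N]] by (simp add: B_def)
  have lin_q: "gm q (w (N - q)) = A N + of_int q *s B N" for q N
  proof -
    let ?x = "gm q (w (N - q)) - (A N + of_int q *s B N)"
    have "?x = 0"
    proof (rule no_singular_vectors)
      show "?x \<in> component (a - 1) N (\<tau> + 1)"
        by (intro subspace_diff[OF subspace_component] subspace_add[OF subspace_component] subspace_scale[OF subspace_component] gmw AS BS)
      fix p
      let ?c = "\<lambda>q. (- 2) * (\<mu> + \<beta> * of_int (p + q) + of_int (N - q)) + of_int (p - q) * a"
      have "gp p ?x = (?c q - (?c 0 + of_int q * (?c 1 - ?c 0))) *s w (N + p)"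
        using gpgm_w[of p q N] gpgm_w[of p 0 N] gpgm_w[of p 1 N]
        by (simp only: A_def B_def lin scale_left_diff_distrib scale_left_distrib scale_scale[symmetric] diff_zero)
      also have "?c q - (?c 0 + of_int q * (?c 1 - ?c 0)) = 0" by (simp add: algebra_simps)
      finally show "gp p ?x = 0" by simp
    qed
    then show ?thesis by simp
  qed
  have anti: "gm r (A (N - r)) + of_int q *s gm r (B (N - r)) = - (gm q (A (N - q)) + of_int r *s gm q (B (N - q)))" for q r N
  proof -
    have "gm r (gm q (w (N - r - q))) = - gm q (gm r (w (N - q - r)))"
      using gmgm[of r q "w (N - r - q)"] by (simp add: algebra_simps)
    then show ?thesis unfolding lin_q by (simp add: lin)
  qed
  \<comment> \<open>The case \<open>q = r\<close> of \<open>anti\<close>, where both sides differ by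
    a sign only.\<close>
  have gmA: "gm r (A (N - r)) = - (of_int r *s gm r (B (N - r)))" for r N
  proof -
    have "gm r (A (N - r)) + of_int r *s gm r (B (N - r)) = 0"
      by (rule eq_uminus_self_imp_zero) (rule anti)
    then show ?thesis by (simp add: eq_neg_iff_add_eq_0)
  qed
  \<comment> \<open>For \<open>q = 0\<close> in \<open>anti\<close> the term with \<open>A\<close>
    on the right vanishes by \<open>gmA\<close>; dividing by \<open>r\<close> shows that the value
    does not depend on \<open>r\<close>.\<close>
  have gmB: "gm r (B (N - r)) = Y N" for r N
  proof (cases "r = 0")
    case False
    have "of_int r *s gm r (B (N - r)) = of_int r *s Y N"
      using anti[where q=0 and r=r and N=N] gmA[of r N] gmA[of 0 N] by (simp add: Y_def)
    then show ?thesis using False by simp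
  qed (simp add: Y_def)
  \<comment> \<open>By \<open>gmB\<close>, \<open>Y M\<close> can be written with the very
    \<open>gm s\<close> that is applied to it.\<close>
  have gmY: "gm s (Y M) = 0" for s M
    using gm_square[of s "B (M - s)"] by (simp add: gmB)
  have w1: "gm_words W 1 N \<subseteq> span {A N, B N}" for N
  proof -
    have "gm q x \<in> span {A N, B N}" if "x \<in> W (N - q)" for q x
    proof (rule endo_span[OF endo(4) subspace_span _ that[unfolded w(1)]])
      show "y \<in> {w (N - q)} \<Longrightarrow> gm q y \<in> span {A N, B N}" for y
        by (auto simp: lin_q intro!: span_add span_scale intro: span_base)
    qed
    then have "(\<Union>q. gm q ` W (N - q)) \<subseteq> span {A N, B N}" by blast
    then show ?thesis by (simp add: span_minimal)
  qed
  have w2: "gm_words W 2 N \<subseteq> span {Y N}" for N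
  proof -
    have "gm q x \<in> span {Y N}" if "x \<in> gm_words W 1 (N - q)" for q x
    proof (rule endo_span[OF endo(4) subspace_span])
      show "x \<in> span {A (N - q), B (N - q)}" using that w1 by blast
      show "y \<in> {A (N - q), B (N - q)} \<Longrightarrow> gm q y \<in> span {Y N}" for y
        using gmA[of q N] gmB[of q N] by (auto intro!: span_neg span_scale intro: span_base)
    qed
    then have "(\<Union>q. gm q ` gm_words W 1 (N - q)) \<subseteq> span {Y N}" by blast
    then have "span (\<Union>q. gm q ` gm_words W 1 (N - q)) \<subseteq> span {Y N}" by (intro span_minimal) auto
    then show ?thesis by (simp only: numeral_2_eq_2 One_nat_def gm_words.simps(2)[of W "Suc 0"])
  qed
  have w3: "gm_words W (k + 3) N \<subseteq> {0}" for k N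
  proof (induction k arbitrary: N)
    case 0
    have "gm q x \<in> {0}" if "x \<in> gm_words W 2 (N - q)" for q x
      by (rule endo_span[OF endo(4) subspace_single_0, of "{Y (N - q)}"]) (use that w2 gmY in auto)
    then have "span (\<Union>q. gm q ` gm_words W 2 (N - q)) \<subseteq> {0}" by (intro span_minimal) auto
    then show ?case by (simp only: gm_words.simps numeral_3_eq_3 numeral_2_eq_2 add_0)
  next
    case (Suc k)
    have "gm q x = 0" if "x \<in> gm_words W (k + 3) (N - q)" for q x
      using that Suc[of "N - q"] by (auto simp: lin)
    then have "span (\<Union>q. gm q ` gm_words W (k + 3) (N - q)) \<subseteq> {0}" by (intro span_minimal) auto
    then show ?case by (simp only: gm_words.simps add_Suc)
  qed
  have "gm_words W k N \<subseteq> span {w N, Y N, A N, B N}" for k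
  proof -
    have "k = 0 \<or> k = 1 \<or> k = 2 \<or> (\<exists>j. k = j + 3)" by presburger
    then show ?thesis
    proof (elim disjE exE)
      assume "k = 0" then show ?thesis using w(1)[of N] span_mono[of "{w N}" "{w N, Y N, A N, B N}"] by simp
    next
      assume "k = 1" then show ?thesis using w1[of N] span_mono[of "{A N, B N}" "{w N, Y N, A N, B N}"] by auto
    next
      assume "k = 2" then show ?thesis using w2[of N] span_mono[of "{Y N}" "{w N, Y N, A N, B N}"] by auto
    next
      fix j assume "k = j + 3" then show ?thesis using w3[of j N] span_zero by auto
    qed
  qed
  then have sp: "span (\<Union>k. gm_words W k N) \<subseteq> span {w N, Y N, A N, B N}"
    by (intro span_minimal) auto
  have weights: "{v. l 0 v = (\<mu> + of_int N) *s v} \<subseteq> span (\<Union>k. gm_words W k N)"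
  proof
    fix v assume "v \<in> {v. l 0 v = (\<mu> + of_int N) *s v}"
    then have v: "l 0 v = (\<mu> + of_int N) *s v" by simp
    show "v \<in> span (\<Union>k. gm_words W k N)"
      by (rule gm_words_weight[where a=a and \<tau>=\<tau>, OF subspace_component order_refl component_l component_h highest nontrivial v])
  qed
  have "Y N \<in> grade (\<tau> + 1 + 1)" unfolding Y_def using BS componentD(1) grade_closed(4) by blast
  moreover have "\<tau> + 1 + 1 = \<tau>" by (cases \<tau>) auto
  ultimately have "Y N \<in> grade \<tau>" by (simp only:)
  then show ?thesis
    using weights that[of "w N" "Y N" "A N" "B N"] sp componentD(1)[OF w(2)] componentD(1)[OF AS] componentD(1)[OF BS] by blast
qed

lemma dim_weight_space_le: "dim ({v. l 0 v = (\<mu> + of_int N) *s v} \<inter> grade \<sigma>) \<le> 2"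
proof -
  obtain w A B Y where w: "w \<in> grade \<tau>" "Y \<in> grade \<tau>" "A \<in> grade (\<tau> + 1)" "B \<in> grade (\<tau> + 1)"
    "{v. l 0 v = (\<mu> + of_int N) *s v} \<subseteq> span {w, Y, A, B}"
    using weight_space_spanned by metis
  have int: "grade \<tau> \<inter> grade (\<tau> + 1) = {0}" using grade_Int by (cases \<tau>) (auto simp: Int_commute)
  have "card {w, Y} \<le> 2" "card {A, B} \<le> 2" by (simp_all add: card_insert_if)
  moreover have "dim ({v. l 0 v = (\<mu> + of_int N) *s v} \<inter> grade \<tau>) \<le> card {w, Y}"
    by (rule dim_Int_le[OF subspace_grade subspace_grade int, of _ "{A, B}"]) (use w in \<open>auto simp: insert_commute\<close>)
  moreover have "dim ({v. l 0 v = (\<mu> + of_int N) *s v} \<inter> grade (\<tau> + 1)) \<le> card {A, B}"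
    by (rule dim_Int_le[OF subspace_grade subspace_grade, of "\<tau> + 1" \<tau> _ "{w, Y}"])
      (use w int in \<open>auto simp: insert_commute Int_commute\<close>)
  moreover have "\<sigma> = \<tau> \<or> \<sigma> = \<tau> + 1" by (cases \<sigma>; cases \<tau>) auto
  ultimately show ?thesis by auto
qed

end

context ramond_operators
begin

section \<open>All simple bounded modules\<close>

text \<open>\<open>h\<close> changes sign because it measures the charge; in the odd bracket this
  matches the antisymmetry of its coefficient \<open>p - q\<close>.\<close>

lemma charge_conjugate: "ramond_operators scale l (\<lambda>m v. - h m v) gm gp grade \<mu> nb"
proof
  show "endo_on UNIV (\<lambda>v. - h m v)" for m by (simp add: endo_on_def lin)
  show "gm p (gp q v) + gp q (gm p v) = (- 2) *s l (p + q) v + of_int (p - q) *s - h (p + q) v" for p q v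
    using gpgm[of q p v] by (simp add: algebra_simps scale_left_diff_distrib)
  show "v \<in> grade \<tau> \<Longrightarrow> - h m v \<in> grade \<tau>" for v \<tau> m
    by (intro subspace_neg[OF subspace_grade] grade_closed)
  show "Y = UNIV"
    if Y: "subspace Y" "\<And>m y. y \<in> Y \<Longrightarrow> l m y \<in> Y" "\<And>m y. y \<in> Y \<Longrightarrow> - h m y \<in> Y"
      "\<And>m y. y \<in> Y \<Longrightarrow> gm m y \<in> Y" "\<And>m y. y \<in> Y \<Longrightarrow> gp m y \<in> Y"
      "Y \<subseteq> span (Y \<inter> grade 0 \<union> Y \<inter> grade 1)" "y \<in> Y" "y \<noteq> 0" for Y y
    using Y subspace_neg[OF Y(1) Y(3)] by (intro simple[of Y y]) auto
  show "- h m (- h n v) = - h n (- h m v)" for m n v using hh[of m n v] by (simp add: lin)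
  show "l m (- h n v) - - h n (l m v) = of_int n *s - h (m + n) v" for m n v
    using lh[of m n v] by (simp add: lin algebra_simps)
  show "- h m (gm p v) - gm p (- h m v) = gm (m + p) v" for m p v
    using hgm[of m p v] by (simp add: lin algebra_simps)
  show "- h m (gp p v) - gp p (- h m v) = - gp (m + p) v" for m p v
    using hgp[of m p v] by (simp add: lin algebra_simps)
qed (fact endo ll lgp lgm gpgp gmgm subspace_grade grade_Int bounded | erule grade_closed)+

text \<open>A weight module is diagonal for \<open>l 0\<close> only. In a nonzero weight space of
  pure parity \<open>h 0\<close> has some eigenvector, so the span of all components is a nonzero
  graded submodule.\<close>

lemma span_component:
  assumes "v \<in> grade \<tau>" "l 0 v = (\<mu> + of_int i) *s v" "v \<noteq> 0"
  shows "span (\<Union>b. \<Union>i. \<Union>\<tau>. component b i \<tau>) = UNIV" (is "span ?G = UNIV")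
    and "\<exists>b v. v \<in> component b i \<tau> \<and> v \<noteq> 0"
proof -
  define X where "X = {v\<in>grade \<tau>. l 0 v = (\<mu> + of_int i) *s v}"
  have sub: "subspace X"
    using subspace_grade[of \<tau>] unfolding X_def subspace_def by (auto simp: lin scale_right_distrib mult.commute)
  have bd: "bounded_dim nb X" by (rule bounded_dim_mono[OF bounded[of i]]) (auto simp: X_def)
  have "endo_on X (h 0)"
    by (rule endo_on_subset[OF endo(2)]) (use lh[of 0 0] in \<open>auto simp: X_def grade_closed lin\<close>)
  moreover have "\<not> X \<subseteq> {0}" using assms by (auto simp: X_def)
  ultimately obtain w b where w: "w \<in> X" "w \<noteq> 0" "h 0 w = b *s w"
    using eigenvector_exists[OF bd sub] by metis
  then have wS: "w \<in> component b i \<tau>" by (simp add: X_def component_def)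
  then show "\<exists>b v. v \<in> component b i \<tau> \<and> v \<noteq> 0" using w by blast
  have sp: "subspace (span ?G)" by simp
  have inc: "y \<in> component b i \<tau> \<Longrightarrow> y \<in> span ?G" for y b i \<tau> by (rule span_base) blast
  show "span ?G = UNIV"
  proof (rule simple[OF sp _ _ _ _ _ inc[OF wS] w(2)])
    fix m y assume y: "y \<in> span ?G"
    show "l m y \<in> span ?G" by (rule endo_span[OF endo(1) sp _ y]) (use component_l inc in blast)
    show "h m y \<in> span ?G" by (rule endo_span[OF endo(2) sp _ y]) (use component_h inc in blast)
    show "gp m y \<in> span ?G" by (rule endo_span[OF endo(3) sp _ y]) (use component_gp inc in blast)
    show "gm m y \<in> span ?G" by (rule endo_span[OF endo(4) sp _ y]) (use component_gm inc in blast)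
  next
    have "x \<in> span ?G \<inter> grade 0 \<union> span ?G \<inter> grade 1" if "x \<in> ?G" for x
    proof -
      obtain b i \<tau> where x: "x \<in> component b i \<tau>" using \<open>x \<in> ?G\<close> by blast
      moreover have "\<tau> = 0 \<or> \<tau> = 1" by (cases \<tau>) auto
      ultimately show ?thesis using inc[OF x] componentD(1)[OF x] by auto
    qed
    then show "span ?G \<subseteq> span (span ?G \<inter> grade 0 \<union> span ?G \<inter> grade 1)"
      by (intro span_mono) blast
  qed
qed

lemma dim_weight_space_le_of_charge:
  assumes "b \<noteq> 0" "v \<in> component b i \<tau>" "v \<noteq> 0" "\<And>i \<tau>. component (b + 1) i \<tau> \<subseteq> {0}"
  shows "dim ({v. l 0 v = (\<mu> + of_int N) *s v} \<inter> grade \<sigma>) \<le> 2"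
proof -
  interpret highest_charge scale l h gp gm grade \<mu> nb b \<tau>
    by unfold_locales (use assms component_gp in blast)+
  show ?thesis by (rule dim_weight_space_le)
qed

text \<open>Odd operators change the charge by one, so they vanish here. The bracket of
  \<open>gp p\<close> and \<open>gm (m - p)\<close> then relates \<open>l m\<close> and
  \<open>h m\<close> for every \<open>p\<close>, and two values of \<open>p\<close> make both
  vanish. Hence a homogeneous line is the whole module.\<close>

lemma dim_weight_space_le_of_uncharged:
  assumes "span (\<Union>b. \<Union>i. \<Union>\<tau>. component b i \<tau>) = UNIV" "\<And>b i \<tau>. b \<noteq> 0 \<Longrightarrow> component b i \<tau> \<subseteq> {0}"
    "v \<in> grade \<tau>" "v \<noteq> 0"
  shows "dim ({v. l 0 v = (\<mu> + of_int N) *s v} \<inter> grade \<sigma>) \<le> 2"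
proof -
  have G: "gp m x = 0" "gm m x = 0" for m x
  proof -
    have x: "x \<in> span (\<Union>b. \<Union>i. \<Union>\<tau>. component b i \<tau>)" using assms(1) by simp
    have "gp m y \<in> {0} \<and> gm m y \<in> {0}" if y: "y \<in> component b i \<tau>" for y b i \<tau>
    proof (cases "b = 0")
      case True
      then show ?thesis using subsetD[OF assms(2) component_gp[OF y, of m]] subsetD[OF assms(2) component_gm[OF y, of m]] by simp
    next
      case False
      then have "y = 0" using y assms(2) by blast
      then show ?thesis by (simp add: lin)
    qed
    then show "gp m x = 0" "gm m x = 0"
      using endo_span[OF endo(3) subspace_single_0 _ x] endo_span[OF endo(4) subspace_single_0 _ x] by blast+
  qed
  have lh0: "(- 2) *s l m x + of_int (2 * p - m) *s h m x = 0" for m p x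
    using gpgm[of p "m - p" x] by (simp add: G lin algebra_simps)
  have h0: "h m x = 0" for m x
  proof -
    have "((- 2) *s l m x + of_int (2 * 1 - m) *s h m x) - ((- 2) *s l m x + of_int (2 * 0 - m) *s h m x) = 0"
      unfolding lh0 by simp
    then have "(of_int (2 * 1 - m) - of_int (2 * 0 - m) :: complex) *s h m x = 0"
      by (simp only: scale_left_diff_distrib add_diff_cancel_left)
    then show ?thesis by simp
  qed
  have l0: "l m x = 0" for m x using lh0[of m x 0] h0[of m x] by simp
  have "span {v} = UNIV"
  proof (rule simple)
    have "\<tau> = 0 \<or> \<tau> = 1" by (cases \<tau>) auto
    then have "v \<in> span {v} \<inter> grade 0 \<union> span {v} \<inter> grade 1" using assms(3) by (auto intro: span_base)
    then show "span {v} \<subseteq> span (span {v} \<inter> grade 0 \<union> span {v} \<inter> grade 1)"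
      by (intro span_mono) blast
  qed (use assms(4) h0 l0 G in \<open>auto intro: span_base span_zero\<close>)
  then have "dim ({v. l 0 v = (\<mu> + of_int N) *s v} \<inter> grade \<sigma>) \<le> card {v}"
    by (intro dim_le_card) auto
  then show ?thesis by simp
qed

lemma dim_weight_space_le_2:
  assumes "v \<in> grade \<tau>" "l 0 v = (\<mu> + of_int i) *s v" "v \<noteq> 0"
  shows "dim ({v. l 0 v = (\<mu> + of_int N) *s v} \<inter> grade \<sigma>) \<le> 2"
proof -
  interpret conj: ramond_operators scale l "\<lambda>m v. - h m v" gm gp grade \<mu> nb
    by (rule charge_conjugate)
  have conj_component: "conj.component b i \<tau> = component (- b) i \<tau>" for b i \<tau>
    by (auto simp: conj.component_def component_def minus_equation_iff[of _ "_ *s _"])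
  define K where "K = {b. b \<noteq> 0 \<and> (\<exists>i \<tau>. \<exists>v\<in>component b i \<tau>. v \<noteq> 0)}"
  have finK: "finite K" unfolding K_def by (rule finite_nonzero_charges)
  have KI: "component b i \<tau> \<subseteq> {0}" if "b \<noteq> 0" "b \<notin> K" for b i \<tau> using that by (auto simp: K_def)
  have top: ?thesis if b: "b \<in> K" "b + 1 \<notin> K" "b + 1 \<noteq> 0" for b
  proof -
    from b(1) obtain i \<tau> v where "b \<noteq> 0" "v \<in> component b i \<tau>" "v \<noteq> 0" by (auto simp: K_def)
    then show ?thesis by (rule dim_weight_space_le_of_charge) (use KI b in blast)
  qed
  have bot: ?thesis if b: "b \<in> K" "b - 1 \<notin> K" "b - 1 \<noteq> 0" for b
  proof -
    from b(1) obtain i \<tau> v where "b \<noteq> 0" "v \<in> component b i \<tau>" "v \<noteq> 0" by (auto simp: K_def)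
    then have v: "- b \<noteq> 0" "v \<in> conj.component (- b) i \<tau>" "v \<noteq> 0" by (auto simp: conj_component)
    have "conj.component (- b + 1) i \<tau> \<subseteq> {0}" for i \<tau> using KI[OF b(3,2)] by (simp add: conj_component)
    from conj.dim_weight_space_le_of_charge[OF v this] show ?thesis .
  qed
  show ?thesis
  proof (cases "K = {}")
    case True
    then show ?thesis
      by (intro dim_weight_space_le_of_uncharged[OF span_component(1)[OF assms] _ assms(1,3)] KI) auto
  next
    case False
    \<comment> \<open>Charges are complex, so extremal ones are chosen by real part. As
      \<open>K\<close> omits 0, the charge \<open>b + 1\<close> is excluded unless it is 0;
      \<open>b + 1\<close> and \<open>d - 1\<close> cannot both be 0, because \<open>d = 1\<close>
      would lie above \<open>b = - 1\<close>.\<close>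
    obtain b where b: "b \<in> K" "\<And>c. c \<in> K \<Longrightarrow> Re c \<le> Re b"
      using Max_in[of "Re ` K"] Max_ge[of "Re ` K"] finK False by (metis (no_types, lifting) finite_imageI image_iff image_is_empty)
    obtain d where d: "d \<in> K" "\<And>c. c \<in> K \<Longrightarrow> Re d \<le> Re c"
      using Min_in[of "Re ` K"] Min_le[of "Re ` K"] finK False by (metis (no_types, lifting) finite_imageI image_iff image_is_empty)
    have "b + 1 \<notin> K" "d - 1 \<notin> K" using b(2)[of "b + 1"] d(2)[of "d - 1"] by auto
    moreover have "b + 1 \<noteq> 0 \<or> d - 1 \<noteq> 0"
    proof (rule ccontr)
      assume "\<not> ?thesis"
      then have "b = - 1" "d = 1" by (auto simp: add_eq_0_iff2)
      then show False using b(2)[OF d(1)] by simp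
    qed
    ultimately show ?thesis using top[OF b(1)] bot[OF d(1)] by blast
  qed
qed

end

section \<open>The action of basis elements\<close>

context ramond_module
begin

sublocale complex_vector_space scale
  by unfold_locales

lemma act_add: "act (x + y) v = act x v + act y v"
  and act_scale: "act (ramond_scale c x) v = scale c (act x v)"
  and endo_act: "endo_on UNIV (act x)"
  using linear_act_left[of v] linear_act_right[of x]
  by (auto simp: Vector_Spaces.linear_iff endo_on_def)

lemma act_0: "act 0 v = 0"
  using act_add[of 0 0 v] by simp

text \<open>A separate constant, because \<open>basis_vec b\<close> is itself an instance of \<open>Poly_Mapping.single b c\<close>.\<close>

definition bact :: "ramond_basis \<Rightarrow> 'v \<Rightarrow> 'v" where
  "bact b = act (basis_vec b)"

lemma endo_bact: "endo_on UNIV (bact b)"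
  unfolding bact_def by (rule endo_act)

lemma weight_space_bact: "weight_space \<nu> = {v. bact (L 0) v = scale \<nu> v}"
  by (simp add: weight_space_def bact_def)

lemma act_single: "act (Poly_Mapping.single b c) v = scale c (bact b v)"
proof -
  have "Poly_Mapping.single b c = ramond_scale c (basis_vec b)"
    by (rule poly_mapping_eqI) (simp add: lookup_ramond_scale lookup_single when_def)
  then show ?thesis by (simp add: act_scale bact_def)
qed

lemma act_sum: "finite F \<Longrightarrow> act (\<Sum>b\<in>F. f b) v = (\<Sum>b\<in>F. act (f b) v)"
  by (induction F rule: finite_induct) (simp_all add: act_0 act_add)

lemma act_basis: "act x v = (\<Sum>b\<in>Poly_Mapping.keys x. scale (Poly_Mapping.lookup x b) (bact b v))"
proof -
  have "x = (\<Sum>b\<in>Poly_Mapping.keys x. Poly_Mapping.single b (Poly_Mapping.lookup x b))"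
  proof (rule poly_mapping_eqI)
    fix k
    show "Poly_Mapping.lookup x k
      = Poly_Mapping.lookup (\<Sum>b\<in>Poly_Mapping.keys x. Poly_Mapping.single b (Poly_Mapping.lookup x b)) k"
      by (auto simp: lookup_sum lookup_single when_def not_in_keys_iff_lookup_eq_zero)
  qed
  then have "act x v = act (\<Sum>b\<in>Poly_Mapping.keys x. Poly_Mapping.single b (Poly_Mapping.lookup x b)) v"
    by simp
  also have "\<dots> = (\<Sum>b\<in>Poly_Mapping.keys x. scale (Poly_Mapping.lookup x b) (bact b v))"
    by (simp add: act_sum act_single)
  finally show ?thesis .
qed

lemma basis_vec_grade: "basis_vec b \<in> ramond_grade (basis_parity b)"
  by (simp add: ramond_grade_def)

lemma act_basis_bracket:
  "act (basis_bracket b c) v = bact b (bact c v)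
    - scale (super_sign (basis_parity b) (basis_parity c)) (bact c (bact b v))"
proof -
  have "ramond_bracket (basis_vec b) (basis_vec c) = ramond_scale 1 (basis_bracket b c)"
    by (simp add: ramond_bracket_def)
  also have "\<dots> = basis_bracket b c" by (rule poly_mapping_eqI) (simp add: lookup_ramond_scale)
  finally show ?thesis using act_bracket[OF basis_vec_grade[of b] basis_vec_grade[of c], of v] by (simp add: bact_def)
qed

lemma bact_grade: "v \<in> grade \<tau> \<Longrightarrow> bact b v \<in> grade (basis_parity b + \<tau>)"
  unfolding bact_def by (rule act_grade[OF basis_vec_grade])

lemma bact_grade_even: "basis_parity b = 0 \<Longrightarrow> v \<in> grade \<tau> \<Longrightarrow> bact b v \<in> grade \<tau>"
  using bact_grade[of v \<tau> b] by (simp only: add_0_left)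

lemma bact_grade_odd: "basis_parity b = 1 \<Longrightarrow> v \<in> grade \<tau> \<Longrightarrow> bact b v \<in> grade (\<tau> + 1)"
  using bact_grade[of v \<tau> b] by (simp only: add.commute)

lemma graded_submoduleI:
  assumes "subspace Y" "\<And>b y. y \<in> Y \<Longrightarrow> bact b y \<in> Y"
    "Y \<subseteq> span (Y \<inter> grade 0 \<union> Y \<inter> grade 1)"
  shows "graded_submodule Y"
  unfolding graded_submodule_def
proof (intro conjI allI ballI)
  fix x y assume "y \<in> Y"
  then show "act x y \<in> Y"
    unfolding act_basis[of x y] by (intro subspace_sum[OF assms(1)] subspace_scale[OF assms(1)] assms(2))
next
  fix w assume "w \<in> Y"
  then have "w \<in> span (Y \<inter> grade 0 \<union> Y \<inter> grade 1)" using assms(3) by blast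
  then obtain w0 w1 where "w = w0 + w1" "w0 \<in> span (Y \<inter> grade 0)" "w1 \<in> span (Y \<inter> grade 1)"
    by (auto simp: span_Un)
  moreover have "span (Y \<inter> grade \<tau>) = Y \<inter> grade \<tau>" for \<tau>
    using subspace_inter[OF assms(1) subspace_grade] by simp
  ultimately show "\<exists>w0\<in>Y \<inter> grade 0. \<exists>w1\<in>Y \<inter> grade 1. w = w0 + w1" by blast
qed (rule assms(1))

text \<open>An even operator preserves parity, so the eigenvector equation holds for each
  homogeneous part. This is applied to \<open>L 0\<close> and \<open>C\<close>.\<close>

lemma eigenspace_graded:
  assumes "bact b v = scale c v" "basis_parity b = 0"
  obtains v0 v1 where "v0 \<in> grade 0" "v1 \<in> grade 1" "v = v0 + v1"
    "bact b v0 = scale c v0" "bact b v1 = scale c v1"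
proof -
  obtain v0 v1 where v: "v0 \<in> grade 0" "v1 \<in> grade 1" "v = v0 + v1" using grade_sum by blast
  let ?d = "\<lambda>w. bact b w - scale c w"
  have d: "?d v0 \<in> grade 0" "?d v1 \<in> grade 1"
    by (intro subspace_diff[OF subspace_grade] subspace_scale[OF subspace_grade] bact_grade_even[OF assms(2)] v(1,2))+
  have "?d v0 + ?d v1 = 0"
    using assms(1) unfolding v(3) endo_UNIV_simps(1)[OF endo_bact] by (simp add: scale_right_distrib algebra_simps)
  then have e: "?d v0 = - ?d v1" by (simp only: eq_neg_iff_add_eq_0)
  then have "?d v0 \<in> grade 0 \<inter> grade 1" using d subspace_neg[OF subspace_grade d(2)] by auto
  then have "?d v0 = 0" using grade_Int by blast
  then show ?thesis using e that[OF v] by simp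
qed

text \<open>\<open>fin_dim\<close> ensures that \<open>dim\<close> counts a finite basis in each
  parity; the bound doubles because both parities are taken together.\<close>

lemma bounded_dim_weight_space:
  assumes "fin_dim (weight_space \<nu>)" "\<And>\<tau>. dim (weight_space \<nu> \<inter> grade \<tau>) \<le> p"
  shows "bounded_dim (2 * p) (weight_space \<nu>)"
  unfolding bounded_dim_def
proof (intro allI impI)
  fix B assume B: "B \<subseteq> weight_space \<nu>" "independent B"
  obtain E where E: "finite E" "span E = weight_space \<nu>" using assms(1) by (auto simp: fin_dim_def)
  have "\<exists>F. finite F \<and> weight_space \<nu> \<inter> grade \<tau> \<subseteq> span F \<and> card F \<le> p" for \<tau>
  proof -
    obtain F where F: "F \<subseteq> weight_space \<nu> \<inter> grade \<tau>" "independent F" "weight_space \<nu> \<inter> grade \<tau> \<subseteq> span F"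
      "card F = dim (weight_space \<nu> \<inter> grade \<tau>)" by (rule basis_exists)
    then have "finite F" using independent_span_bound[OF E(1) F(2)] E(2) by auto
    then show ?thesis using F assms(2)[of \<tau>] by auto
  qed
  then obtain F where F: "\<And>\<tau>. finite (F \<tau>)" "\<And>\<tau>. weight_space \<nu> \<inter> grade \<tau> \<subseteq> span (F \<tau>)" "\<And>\<tau>. card (F \<tau>) \<le> p"
    by metis
  have "weight_space \<nu> \<subseteq> span (F 0 \<union> F 1)"
  proof
    fix v assume "v \<in> weight_space \<nu>"
    then obtain v0 v1 where v: "v0 \<in> grade 0" "v1 \<in> grade 1" "v = v0 + v1"
      "v0 \<in> weight_space \<nu>" "v1 \<in> weight_space \<nu>"
      unfolding weight_space_bact using eigenspace_graded[of "L 0" v \<nu>] by auto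
    then have "v0 \<in> span (F 0)" "v1 \<in> span (F 1)" using F(2) by blast+
    then show "v \<in> span (F 0 \<union> F 1)" unfolding v(3) by (auto simp: span_Un)
  qed
  then have "finite B \<and> card B \<le> card (F 0 \<union> F 1)"
    using B F(1) by (intro independent_span_bound) auto
  moreover have "card (F 0 \<union> F 1) \<le> 2 * p"
    using card_Un_le[of "F 0" "F 1"] F(3)[of 0] F(3)[of 1] by simp
  ultimately show "finite B \<and> card B \<le> 2 * p" by simp
qed

lemma simple_cuspidal_dim_le:
  assumes simple: simple_module and qf: "quasi_finite_at \<mu>"
    and bd: "\<And>i \<tau>. dim (weight_space (\<mu> + of_int i) \<inter> grade \<tau>) \<le> p"
  shows "dim (weight_space (\<mu> + of_int N) \<inter> grade \<sigma>) \<le> 2"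
proof -
  define l where "l m = bact (L m)" for m
  define h where "h m = bact (H m)" for m
  define gp where "gp m = bact (Gp m)" for m
  define gm where "gm m = bact (Gm m)" for m
  define cc where "cc = bact C"
  note ops = l_def h_def gp_def gm_def cc_def
  note lin = endo_UNIV_simps[OF endo_bact]
  have ws: "weight_space \<nu> = {v. l 0 v = scale \<nu> v}" for \<nu> by (simp add: weight_space_bact l_def)
  have bounded: "bounded_dim (2 * p) {v. l 0 v = scale (\<mu> + of_int i) v}" for i
    using bounded_dim_weight_space[of "\<mu> + of_int i" p] qf bd by (simp add: quasi_finite_at_def ws)
  have sub_ws: "subspace {v. bact b v = scale \<nu> v}" for b \<nu>
    unfolding subspace_def by (auto simp: lin scale_right_distrib mult.commute)
  have simpleD: "Y = UNIV" if Y: "subspace Y" "\<And>b y. y \<in> Y \<Longrightarrow> bact b y \<in> Y"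
    "Y \<subseteq> span (Y \<inter> grade 0 \<union> Y \<inter> grade 1)" "y \<in> Y" "y \<noteq> 0" for Y y
    using graded_submoduleI[OF Y(1-3)] simple Y(4,5) unfolding simple_module_def by blast

  obtain i v \<tau> where v: "v \<in> grade \<tau>" "l 0 v = scale (\<mu> + of_int i) v" "v \<noteq> 0"
  proof -
    have "\<exists>i. \<exists>v\<in>weight_space (\<mu> + of_int i). v \<noteq> 0"
    proof (rule ccontr)
      assume "\<not> ?thesis"
      then have "(\<Union>i::int. weight_space (\<mu> + of_int i)) \<subseteq> {0}" by blast
      then have "span (\<Union>i::int. weight_space (\<mu> + of_int i)) \<subseteq> {0}" by (intro span_minimal) auto
      then show False using qf simple by (auto simp: quasi_finite_at_def simple_module_def)
    qed
    then obtain i u where u: "bact (L 0) u = scale (\<mu> + of_int i) u" "u \<noteq> 0" by (auto simp: weight_space_bact)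
    from u(1) obtain v0 v1 where v: "v0 \<in> grade 0" "v1 \<in> grade 1" "u = v0 + v1"
      "l 0 v0 = scale (\<mu> + of_int i) v0" "l 0 v1 = scale (\<mu> + of_int i) v1"
      by (rule eigenspace_graded) (auto simp: l_def)
    then have "v0 \<noteq> 0 \<or> v1 \<noteq> 0" using u(2) by auto
    then show thesis using v that by blast
  qed
  have br: "act (basis_bracket b c) x = bact b (bact c x)
      - scale (super_sign (basis_parity b) (basis_parity c)) (bact c (bact b x))" for b c x
    by (rule act_basis_bracket)
  have central: "cc (bact b x) = bact b (cc x)" for b x
    using br[of C b x] by (simp add: cc_def act_0 super_sign_def)
  have l_weight: "bact b x \<in> {v. l 0 v = scale (\<mu> + of_int (j + m)) v}"
    if "basis_bracket (L 0) b = Poly_Mapping.single b (of_int m)" "x \<in> {v. l 0 v = scale (\<mu> + of_int j) v}" for b m j x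
    using br[of "L 0" b x] that
    by (simp add: act_single super_sign_def lin l_def algebra_simps scale_left_distrib)

  obtain w c where w: "w \<in> grade \<tau>" "l 0 w = scale (\<mu> + of_int i) w" "w \<noteq> 0" "cc w = scale c w"
  proof -
    define X where "X = grade \<tau> \<inter> {v. l 0 v = scale (\<mu> + of_int i) v}"
    have "subspace X" unfolding X_def l_def by (intro subspace_inter subspace_grade sub_ws)
    moreover have "bounded_dim (2 * p) X" by (rule bounded_dim_mono[OF bounded[of i]]) (auto simp: X_def)
    moreover have "endo_on X cc" unfolding cc_def
    proof (rule endo_on_subset[OF endo_bact])
      fix y assume y: "y \<in> X"
      have "l 0 (bact C y) = bact C (l 0 y)" using central[of "L 0" y] by (simp add: cc_def l_def)
      then show "bact C y \<in> X" using y bact_grade_even[of C y \<tau>] by (simp add: X_def lin)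
    qed simp
    moreover have "\<not> X \<subseteq> {0}" using v by (auto simp: X_def)
    ultimately show thesis using eigenvector_exists[of "2 * p" X cc] that by (auto simp: X_def)
  qed
  \<comment> \<open>Schur's lemma: \<open>C\<close> commutes with the action and has an eigenvector
    in a weight space, so that eigenspace is a nonzero graded submodule.\<close>
  have cc: "cc x = scale c x" for x
  proof -
    define Y where "Y = {x. bact C x = scale c x}"
    have "Y = UNIV"
    proof (rule simpleD[of Y w])
      show "subspace Y" unfolding Y_def by (rule sub_ws)
      show "bact b y \<in> Y" if "y \<in> Y" for b y
        using that central[of b y] by (simp add: Y_def cc_def lin)
      show "Y \<subseteq> span (Y \<inter> grade 0 \<union> Y \<inter> grade 1)"
      proof
        fix y assume "y \<in> Y"
        then have "bact C y = scale c y" by (simp add: Y_def)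
        then obtain y0 y1 where "y0 \<in> grade 0" "y1 \<in> grade 1" "y = y0 + y1" "y0 \<in> Y" "y1 \<in> Y"
          by (rule eigenspace_graded) (auto simp: Y_def)
        then show "y \<in> span (Y \<inter> grade 0 \<union> Y \<inter> grade 1)" by (auto intro!: span_add intro: span_base)
      qed
    qed (use w in \<open>auto simp: Y_def cc_def\<close>)
    then show ?thesis by (auto simp: Y_def cc_def)
  qed
  \<comment> \<open>The factor \<open>1 / 3\<close> comes from the bracket of the
    \<open>H m\<close>. Weights are counted from \<open>i\<close>, so that the space with index 0 is
    nonzero.\<close>
  have c0: "c / 3 = 0"
  proof (rule heisenberg_central_charge_zero[where h=h and n="2 * p" and X="\<lambda>j. {v. l 0 v = scale (\<mu> + of_int (i + j)) v}"])
    show "h m (h n x) - h n (h m x) = scale (if m + n = 0 then of_int m * (c / 3) else 0) x" for m n x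
      using br[of "H m" "H n" x] cc[of x] by (auto simp: h_def act_single super_sign_def cc_def mult.commute)
    show "h m x \<in> {v. l 0 v = scale (\<mu> + of_int (i + (j + m))) v}"
      if "x \<in> {v. l 0 v = scale (\<mu> + of_int (i + j)) v}" for m j x
    proof -
      have "basis_bracket (L 0) (H m) = Poly_Mapping.single (H m) (of_int m)" by simp
      from l_weight[OF this that] show ?thesis by (simp add: h_def add.assoc)
    qed
    show "\<not> {v. l 0 v = scale (\<mu> + of_int (i + 0)) v} \<subseteq> {0}" using v by auto
    show "subspace {v. l 0 v = scale (\<mu> + of_int (i + j)) v}" for j unfolding l_def by (rule sub_ws)
  qed (use bounded endo_bact in \<open>simp_all add: h_def del: of_int_add\<close>)
  then have C0: "bact C x = 0" for x using cc[of x] by (simp add: cc_def)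
  note brs = act_add act_single act_0 C0 super_sign_def
  interpret ro: ramond_operators scale l h gp gm grade \<mu> "2 * p"
  proof
    fix m n q x
    show "l m (l n x) - l n (l m x) = scale (of_int (n - m)) (l (m + n) x)"
      using br[of "L m" "L n" x] by (simp add: brs ops)
    show "l m (h n x) - h n (l m x) = scale (of_int n) (h (m + n) x)"
      using br[of "L m" "H n" x] by (simp add: brs ops)
    show "h m (h n x) = h n (h m x)"
      using br[of "H m" "H n" x] by (simp add: brs ops)
    show "l m (gp n x) - gp n (l m x) = scale (of_int n - of_int m / 2) (gp (n + m) x)"
      using br[of "L m" "Gp n" x] by (simp add: brs ops)
    show "l m (gm n x) - gm n (l m x) = scale (of_int n - of_int m / 2) (gm (n + m) x)"
      using br[of "L m" "Gm n" x] by (simp add: brs ops)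
    show "h m (gp n x) - gp n (h m x) = gp (m + n) x"
      using br[of "H m" "Gp n" x] by (simp add: brs ops)
    show "h m (gm n x) - gm n (h m x) = - gm (m + n) x"
      using br[of "H m" "Gm n" x] by (simp add: brs ops)
    show "gp m (gm n x) + gm n (gp m x) = scale (- 2) (l (m + n) x) + scale (of_int (m - n)) (h (m + n) x)"
      using br[of "Gp m" "Gm n" x] by (simp add: brs ops)
    show "gp m (gp n x) = - gp n (gp m x)"
      using br[of "Gp m" "Gp n" x] by (simp add: brs ops eq_neg_iff_add_eq_0)
    show "gm m (gm n x) = - gm n (gm m x)"
      using br[of "Gm m" "Gm n" x] by (simp add: brs ops eq_neg_iff_add_eq_0)
  next
    fix x \<tau> m assume x: "x \<in> grade \<tau>"
    show "l m x \<in> grade \<tau>" "h m x \<in> grade \<tau>" "gp m x \<in> grade (\<tau> + 1)" "gm m x \<in> grade (\<tau> + 1)"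
      unfolding ops by (intro bact_grade_even bact_grade_odd x; simp)+
  next
    fix Y y
    assume Y: "subspace Y" "\<And>m y. y \<in> Y \<Longrightarrow> l m y \<in> Y" "\<And>m y. y \<in> Y \<Longrightarrow> h m y \<in> Y"
      "\<And>m y. y \<in> Y \<Longrightarrow> gp m y \<in> Y" "\<And>m y. y \<in> Y \<Longrightarrow> gm m y \<in> Y"
      "Y \<subseteq> span (Y \<inter> grade 0 \<union> Y \<inter> grade 1)" "y \<in> Y" "y \<noteq> 0"
    have "bact b z \<in> Y" if "z \<in> Y" for b z
      using that Y(2-5)[OF that] C0[of z] subspace_0[OF Y(1)] by (cases b) (auto simp: ops)
    then show "Y = UNIV" using simpleD[OF Y(1) _ Y(6-8)] by blast
  qed (use bounded endo_bact subspace_grade grade_Int in \<open>simp_all add: ops\<close>)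
  show ?thesis unfolding ws by (rule ro.dim_weight_space_le_2[OF v])
qed

end

theorem proposition4p1:
  fixes scale :: "complex \<Rightarrow> 'v::ab_group_add \<Rightarrow> 'v"
    and act :: "ramond \<Rightarrow> 'v \<Rightarrow> 'v"
    and grade :: "bit \<Rightarrow> 'v set"
  assumes "ramond_module scale act grade"
    and "ramond_module.simple_module scale act grade"
    and "ramond_module.cuspidal scale act grade"
  shows "ramond_module.cuspidal_b scale act grade \<le> 2"
proof -
  interpret ramond_module scale act grade by (rule assms(1))
  obtain p \<mu> where \<mu>: "quasi_finite_at \<mu>"
    "\<And>(i::int) \<tau>. dim (weight_space (\<mu> + of_int i) \<inter> grade \<tau>) \<le> p"
    using assms(3) unfolding cuspidal_def cuspidal_bound_def by blast
  have "cuspidal_bound 2"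
    unfolding cuspidal_bound_def
    using \<mu>(1) simple_cuspidal_dim_le[OF assms(2) \<mu>] by auto
  then show ?thesis unfolding cuspidal_b_def by (rule Least_le)
qed

end
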